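(* There exists a pair $(X,Y)$ consisting of a separable Banach space $X$ and a closed subspace $Y\subseteq X$ such that $(X,Y)$ has the Lipschitz BAP but does not have the BAP. In particular, $(X,Y)$ does not have the Lipschitz-lifting property.
   Context: Banach spaces are real here. For $\lambda\ge 1$, the pair $(X,Y)$ has the $\lambda$-BAP if for each $\varepsilon>0$ and compact $K\subset X$ there is a finite-rank linear map $S:X\to X$ with $\|S\|\le\lambda$, $\|S(x)-x\|\le\varepsilon$ for each $x\in K$, and $S(Y)\subseteq Y$. It has the $\lambda$-Lipschitz BAP if for each $\varepsilon>0$ and compact $K\subset X$ there is a Lipschitz map $S:X\to X$ with range contained in a finite-dimensional subspace, $S(Y)\subseteq Y$, Lipschitz constant $\mathrm{Lip}(S)\le\lambda$, and $\|S(x)-x\|\le\varepsilon$ for each $x\in K$. The BAP (resp. Lipschitz BAP) means the $\lambda$-BAP (resp. $\lambda$-Lipschitz BAP) for some $\lambda$. For a pointed metric space $M$ (distinguished point $0$), $\mathrm{Lip}_0(M)$ is the Banach space of Lipschitz functions $f:M\to\mathbb{R}$ with $f(0)=0$, normed by the Lipschitz constant. The Lipschitz-free space $\mathscr{F}(M)$ is the closed linear span in $\mathrm{Lip}_0(M)^*$ of the evaluation functionals $\delta(x):f\mapsto f(x)$, $x\in M$. If $N\subseteq M$ contains $0$, $\mathscr{F}(N)$ is identified with the closed span of $\delta(N)$ in $\mathscr{F}(M)$. For a Banach space $X$ (pointed at its origin), the barycentric map $\beta_X:\mathscr{F}(X)\to X$ is the norm-one linear map with $\beta_X(\delta(x))=x$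 for all $x\in X$. The pair $(X,Y)$ has the Lipschitz-lifting property if there is a continuous linear map $T:X\to\mathscr{F}(X)$ with $T(Y)\subseteq\mathscr{F}(Y)$ and $\beta_X\circ T=\mathrm{Id}_X$. *)

theory Defs
  imports "HOL-Analysis.Analysis" "HOL-Library.Function_Algebras"
begin

text \<open>
  Banach spaces are complete linear subspaces \<open>X\<close> of an ambient normed space \<open>'a\<close>, carrying the
  induced norm. Maps between such spaces are functions on the ambient types of which only the values on
  the carrier matter.
\<close>

definition banach_on :: "'a::real_normed_vector set \<Rightarrow> bool" where
  "banach_on X \<longleftrightarrow> subspace X \<and> complete X"

definition closed_subspace_of :: "'a::real_normed_vector set \<Rightarrow> 'a set \<Rightarrow> bool" where
  "closed_subspace_of X Y \<longleftrightarrow> subspace Y \<and> Y \<subseteq> X \<and> closedin (top_of_set X) Y"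

definition linear_map_on :: "'a::real_vector set \<Rightarrow> ('a \<Rightarrow> 'b::real_vector) \<Rightarrow> bool" where
  "linear_map_on X S \<longleftrightarrow>
     (\<forall>x\<in>X. \<forall>y\<in>X. S (x + y) = S x + S y) \<and> (\<forall>c. \<forall>x\<in>X. S (c *\<^sub>R x) = c *\<^sub>R S x)"

definition finite_dim_range_on :: "'a::real_vector set \<Rightarrow> ('a \<Rightarrow> 'a) \<Rightarrow> bool" where
  "finite_dim_range_on X S \<longleftrightarrow> (\<exists>B. finite B \<and> B \<subseteq> X \<and> S ` X \<subseteq> span B)"


section \<open>Approximation properties of pairs\<close>

text \<open>For linear \<open>S\<close>, the condition \<open>norm (S x) \<le> lam * norm x\<close> on \<open>X\<close> says that the operator norm
  of \<open>S\<close> on \<open>X\<close> is at most \<open>lam\<close>.\<close>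

definition pair_lambda_BAP :: "real \<Rightarrow> 'a::real_normed_vector set \<Rightarrow> 'a set \<Rightarrow> bool" where
  "pair_lambda_BAP lam X Y \<longleftrightarrow>
     (\<forall>\<epsilon>>0. \<forall>K. compact K \<and> K \<subseteq> X \<longrightarrow>
       (\<exists>S. S ` X \<subseteq> X \<and> linear_map_on X S \<and> finite_dim_range_on X S \<and>
            (\<forall>x\<in>X. norm (S x) \<le> lam * norm x) \<and>
            (\<forall>x\<in>K. norm (S x - x) \<le> \<epsilon>) \<and> S ` Y \<subseteq> Y))"

definition pair_lambda_Lipschitz_BAP :: "real \<Rightarrow> 'a::real_normed_vector set \<Rightarrow> 'a set \<Rightarrow> bool" where
  "pair_lambda_Lipschitz_BAP lam X Y \<longleftrightarrow>
     (\<forall>\<epsilon>>0. \<forall>K. compact K \<and> K \<subseteq> X \<longrightarrow>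
       (\<exists>S. S ` X \<subseteq> X \<and> finite_dim_range_on X S \<and> S ` Y \<subseteq> Y \<and>
            lipschitz_on lam X S \<and> (\<forall>x\<in>K. norm (S x - x) \<le> \<epsilon>)))"

definition pair_BAP :: "'a::real_normed_vector set \<Rightarrow> 'a set \<Rightarrow> bool" where
  "pair_BAP X Y \<longleftrightarrow> (\<exists>lam\<ge>1. pair_lambda_BAP lam X Y)"

definition pair_Lipschitz_BAP :: "'a::real_normed_vector set \<Rightarrow> 'a set \<Rightarrow> bool" where
  "pair_Lipschitz_BAP X Y \<longleftrightarrow> (\<exists>lam\<ge>1. pair_lambda_Lipschitz_BAP lam X Y)"


section \<open>Pointwise real vector space structure on functions\<close>

instantiation "fun" :: (type, real_vector) real_vector
begin

definition scaleR_fun :: "real \<Rightarrow> ('a \<Rightarrow> 'b) \<Rightarrow> 'a \<Rightarrow> 'b" where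
  "scaleR_fun c f = (\<lambda>x. c *\<^sub>R f x)"

instance
  by standard
    (auto simp: scaleR_fun_def fun_eq_iff scaleR_add_right scaleR_add_left)

end

lemma scaleR_fun_apply [simp]: "(c *\<^sub>R f) x = c *\<^sub>R f x"
  by (simp add: scaleR_fun_def)


section \<open>Lipschitz-free spaces\<close>

text \<open>The distinguished point of \<open>M\<close> is \<open>0\<close>. Functions on \<open>M\<close> are represented by their extension
  by \<open>0\<close> to the ambient type, so that \<open>Lip0 M\<close> is a linear subspace of the function type;
  functionals on \<open>Lip0 M\<close> are treated in the same way.\<close>

definition Lip0 :: "'a::real_normed_vector set \<Rightarrow> ('a \<Rightarrow> real) set" where
  "Lip0 M = {f. (\<exists>L. lipschitz_on L M f) \<and> f 0 = 0 \<and> (\<forall>x. x \<notin> M \<longrightarrow> f x = 0)}"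

definition lip_const :: "'a::real_normed_vector set \<Rightarrow> ('a \<Rightarrow> real) \<Rightarrow> real" where
  "lip_const M f = Inf {L. lipschitz_on L M f}"

definition Lip0_dual :: "'a::real_normed_vector set \<Rightarrow> (('a \<Rightarrow> real) \<Rightarrow> real) set" where
  "Lip0_dual M = {\<phi>. linear_map_on (Lip0 M) \<phi> \<and>
      (\<exists>C. \<forall>f\<in>Lip0 M. \<bar>\<phi> f\<bar> \<le> C * lip_const M f) \<and> (\<forall>f. f \<notin> Lip0 M \<longrightarrow> \<phi> f = 0)}"

definition Lip0_dual_norm :: "'a::real_normed_vector set \<Rightarrow> (('a \<Rightarrow> real) \<Rightarrow> real) \<Rightarrow> real" where
  "Lip0_dual_norm M \<phi> = (SUP f\<in>{f\<in>Lip0 M. lip_const M f \<le> 1}. \<bar>\<phi> f\<bar>)"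

definition delta :: "'a::real_normed_vector set \<Rightarrow> 'a \<Rightarrow> ('a \<Rightarrow> real) \<Rightarrow> real" where
  "delta M x = (\<lambda>f. if f \<in> Lip0 M then f x else 0)"

text \<open>\<open>lipschitz_free_in M N\<close> is the closed linear span of \<open>delta M ` N\<close> in the dual of \<open>Lip0 M\<close>,
  that is, the free space of \<open>N \<subseteq> M\<close> as a subspace of the free space of \<open>M\<close>.\<close>

definition lipschitz_free_in ::
    "'a::real_normed_vector set \<Rightarrow> 'a set \<Rightarrow> (('a \<Rightarrow> real) \<Rightarrow> real) set" where
  "lipschitz_free_in M N =
     {\<phi>\<in>Lip0_dual M. \<forall>\<epsilon>>0. \<exists>\<mu>\<in>span (delta M ` N). Lip0_dual_norm M (\<phi> - \<mu>) < \<epsilon>}"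

abbreviation lipschitz_free :: "'a::real_normed_vector set \<Rightarrow> (('a \<Rightarrow> real) \<Rightarrow> real) set" where
  "lipschitz_free M \<equiv> lipschitz_free_in M M"

text \<open>The norm bound \<open>\<le> 1\<close> is an equality unless \<open>X = {0}\<close>, because \<open>delta X x\<close> has norm
  \<open>norm x\<close>. On the free space these conditions determine \<open>\<beta>\<close> uniquely.\<close>

definition is_barycentric_map ::
    "'a::real_normed_vector set \<Rightarrow> ((('a \<Rightarrow> real) \<Rightarrow> real) \<Rightarrow> 'a) \<Rightarrow> bool" where
  "is_barycentric_map X \<beta> \<longleftrightarrow>
     \<beta> ` lipschitz_free X \<subseteq> X \<and> linear_map_on (lipschitz_free X) \<beta> \<and>
     (\<forall>\<phi>\<in>lipschitz_free X. norm (\<beta> \<phi>) \<le> Lip0_dual_norm X \<phi>) \<and>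
     (\<forall>x\<in>X. \<beta> (delta X x) = x)"

definition continuous_into_Lip0_dual ::
    "'a::real_normed_vector set \<Rightarrow> ('a \<Rightarrow> ('a \<Rightarrow> real) \<Rightarrow> real) \<Rightarrow> bool" where
  "continuous_into_Lip0_dual X T \<longleftrightarrow>
     (\<forall>x\<in>X. \<forall>\<epsilon>>0. \<exists>\<eta>>0. \<forall>x'\<in>X. norm (x' - x) < \<eta> \<longrightarrow> Lip0_dual_norm X (T x' - T x) < \<epsilon>)"

definition pair_Lipschitz_lifting :: "'a::real_normed_vector set \<Rightarrow> 'a set \<Rightarrow> bool" where
  "pair_Lipschitz_lifting X Y \<longleftrightarrow>
     (\<exists>\<beta> T. is_barycentric_map X \<beta> \<and>
        T ` X \<subseteq> lipschitz_free X \<and> linear_map_on X T \<and> continuous_into_Lip0_dual X T \<and>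
        T ` Y \<subseteq> lipschitz_free_in X Y \<and> (\<forall>x\<in>X. \<beta> (T x) = x))"

text \<open>The space of bounded real sequences. By the Hahn-Banach theorem every separable Banach space
  is isometrically isomorphic to a complete subspace of it, so that quantifying over the separable
  \<open>X :: ell_infty set\<close> with \<open>banach_on X\<close> is quantifying over all separable Banach spaces up to
  isometric isomorphism.\<close>

type_synonym ell_infty = "nat \<Rightarrow>\<^sub>C real"

section \<open>Existence of the barycentric map\<close>

lemma subspace_Lip0_dual: "subspace (Lip0_dual M)"
proof (rule subspaceI)
  show "0 \<in> Lip0_dual M"
    by (auto simp: Lip0_dual_def linear_map_on_def intro!: exI[of _ 0])
next
  fix \<phi> \<psi> assume a: "\<phi> \<in> Lip0_dual M" "\<psi> \<in> Lip0_dual M"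
  then obtain C D where "\<forall>f\<in>Lip0 M. \<bar>\<phi> f\<bar> \<le> C * lip_const M f"
      "\<forall>f\<in>Lip0 M. \<bar>\<psi> f\<bar> \<le> D * lip_const M f"
    by (auto simp: Lip0_dual_def)
  then have "\<forall>f\<in>Lip0 M. \<bar>(\<phi> + \<psi>) f\<bar> \<le> (C + D) * lip_const M f"
    by (fastforce simp: distrib_right)
  then have "\<exists>C. \<forall>f\<in>Lip0 M. \<bar>\<phi> f + \<psi> f\<bar> \<le> C * lip_const M f" by auto
  with a show "\<phi> + \<psi> \<in> Lip0_dual M"
    by (auto simp: Lip0_dual_def linear_map_on_def distrib_left)
next
  fix c \<phi> assume a: "\<phi> \<in> Lip0_dual M"
  then obtain C where "\<forall>f\<in>Lip0 M. \<bar>\<phi> f\<bar> \<le> C * lip_const M f"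
    by (auto simp: Lip0_dual_def)
  then have "\<forall>f\<in>Lip0 M. \<bar>(c *\<^sub>R \<phi>) f\<bar> \<le> (\<bar>c\<bar> * C) * lip_const M f"
    by (auto simp: abs_mult mult.assoc intro!: mult_left_mono)
  then have "\<exists>C. \<forall>f\<in>Lip0 M. \<bar>(c *\<^sub>R \<phi>) f\<bar> \<le> C * lip_const M f" by blast
  with a show "c *\<^sub>R \<phi> \<in> Lip0_dual M"
    by (auto simp: Lip0_dual_def linear_map_on_def algebra_simps)
qed

lemma lip_const_le: "lipschitz_on L M f \<Longrightarrow> lip_const M f \<le> L"
  unfolding lip_const_def
  by (rule cInf_lower) (auto intro!: bdd_belowI[of _ 0] lipschitz_on_nonneg)

lemma lip_const_nonneg: "f \<in> Lip0 M \<Longrightarrow> 0 \<le> lip_const M f"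
  unfolding lip_const_def
  by (rule cInf_greatest) (auto simp: Lip0_def intro: lipschitz_on_nonneg)

lemma Lip0_bound:
  assumes "f \<in> Lip0 M" "0 \<in> M" "x \<in> M"
  shows "\<bar>f x\<bar> \<le> norm x * lip_const M f"
proof (cases "x = 0")
  case True
  then show ?thesis using assms by (simp add: Lip0_def)
next
  case False
  have "\<bar>f x\<bar> / norm x \<le> lip_const M f"
    unfolding lip_const_def
  proof (rule cInf_greatest)
    show "{L. lipschitz_on L M f} \<noteq> {}" using assms(1) by (auto simp: Lip0_def)
    fix L assume "L \<in> {L. lipschitz_on L M f}"
    then have "dist (f x) (f 0) \<le> L * dist x 0"
      using assms lipschitz_onD by blast
    then show "\<bar>f x\<bar> / norm x \<le> L"
      using assms(1) False by (simp add: Lip0_def dist_real_def field_simps)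
  qed
  then show ?thesis using False by (simp add: field_simps)
qed

lemma delta_in_Lip0_dual:
  assumes "subspace M" "x \<in> M"
  shows "delta M x \<in> Lip0_dual M"
proof -
  have sub: "f + g \<in> Lip0 M" if "f \<in> Lip0 M" "g \<in> Lip0 M" for f g
  proof -
    from that obtain L K where "lipschitz_on L M f" "lipschitz_on K M g"
      by (auto simp: Lip0_def)
    then have "lipschitz_on (L + K) M (\<lambda>x. f x + g x)" by (rule lipschitz_on_add)
    then show ?thesis using that by (auto simp: Lip0_def plus_fun_def)
  qed
  have scl: "c *\<^sub>R f \<in> Lip0 M" if "f \<in> Lip0 M" for f c
  proof -
    from that obtain L where "lipschitz_on L M f" by (auto simp: Lip0_def)
    then have "lipschitz_on (\<bar>c\<bar> * L) M (\<lambda>x. c *\<^sub>R f x)" by (rule lipschitz_on_cmult)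
    then show ?thesis using that by (auto simp: Lip0_def scaleR_fun_def)
  qed
  have "\<forall>f\<in>Lip0 M. \<bar>delta M x f\<bar> \<le> norm x * lip_const M f"
    using Lip0_bound[of _ M x] assms subspace_0 by (auto simp: delta_def)
  then show ?thesis
    using sub scl by (auto simp: Lip0_dual_def linear_map_on_def delta_def)
qed

lemma Lip0_dual_norm_bound:
  assumes "\<phi> \<in> Lip0_dual M" "f \<in> Lip0 M" "lip_const M f \<le> 1"
  shows "\<bar>\<phi> f\<bar> \<le> Lip0_dual_norm M \<phi>"
  unfolding Lip0_dual_norm_def
proof (rule cSUP_upper)
  from assms obtain C where C: "\<forall>f\<in>Lip0 M. \<bar>\<phi> f\<bar> \<le> C * lip_const M f"
    by (auto simp: Lip0_dual_def)
  have "\<bar>\<phi> g\<bar> \<le> \<bar>C\<bar>" if "g \<in> Lip0 M" "lip_const M g \<le> 1" for g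
  proof -
    have "\<bar>\<phi> g\<bar> \<le> C * lip_const M g" using C that by blast
    also have "\<dots> \<le> \<bar>C\<bar> * 1"
      using that lip_const_nonneg[of g M] by (intro mult_mono) auto
    finally show ?thesis by simp
  qed
  then show "bdd_above ((\<lambda>f. \<bar>\<phi> f\<bar>) ` {f \<in> Lip0 M. lip_const M f \<le> 1})"
    by (auto intro!: bdd_aboveI[of _ "\<bar>C\<bar>"])
qed (use assms in auto)

lemma ex_barycentric_map:
  fixes X :: "ell_infty set"
  assumes "banach_on X"
  shows "\<exists>\<beta>. is_barycentric_map X \<beta>"
proof -
  have X: "subspace X" "complete X" using assms by (auto simp: banach_on_def)
  define p where "p n = (\<lambda>x::ell_infty. if x \<in> X then apply_bcontfun x n else 0)" for n
  have "lipschitz_on 1 X (p n)" for n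
    by (rule lipschitz_onI) (auto simp: p_def dist_bounded)
  moreover have "p n 0 = 0" for n by (simp add: p_def)
  ultimately have p: "p n \<in> Lip0 X" "lip_const X (p n) \<le> 1" for n
    by (auto simp: Lip0_def p_def intro: lip_const_le)
  have span_dual: "span (delta X ` X) \<subseteq> Lip0_dual X"
    by (rule span_minimal) (auto simp: subspace_Lip0_dual delta_in_Lip0_dual X)
  have span_ev: "\<exists>x\<in>X. \<forall>n. apply_bcontfun x n = \<mu> (p n)" if "\<mu> \<in> span (delta X ` X)" for \<mu>
    using that
  proof (induction rule: span_induct_alt)
    case base
    then show ?case by (rule bexI[of _ 0]) (auto simp: X subspace_0)
  next
    case (step c \<delta> \<mu>)
    then obtain x y where "x \<in> X" "y \<in> X" "\<delta> = delta X y"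
      "\<forall>n. apply_bcontfun x n = \<mu> (p n)" by auto
    then show ?case
      by (intro bexI[of _ "c *\<^sub>R y + x"])
         (auto simp: X subspace_add subspace_scale delta_def p, simp add: p_def)
  qed
  have ev: "\<exists>x\<in>X. \<forall>n. apply_bcontfun x n = \<phi> (p n)" if \<phi>: "\<phi> \<in> lipschitz_free X" for \<phi>
  proof -
    have "\<exists>x\<in>X. \<forall>n. \<bar>apply_bcontfun x n - \<phi> (p n)\<bar> \<le> \<epsilon>" if \<epsilon>: "\<epsilon> > 0" for \<epsilon>
    proof -
      obtain \<mu> where \<mu>: "\<mu> \<in> span (delta X ` X)" "Lip0_dual_norm X (\<phi> - \<mu>) < \<epsilon>"
        using \<phi> \<epsilon> unfolding lipschitz_free_in_def by blast
      obtain x where x: "x \<in> X" "\<forall>n. apply_bcontfun x n = \<mu> (p n)" using span_ev \<mu> by blast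
      have "\<phi> - \<mu> \<in> Lip0_dual X"
        using \<phi> \<mu> span_dual by (auto simp: lipschitz_free_in_def intro!: subspace_diff subspace_Lip0_dual)
      then have "\<bar>(\<phi> - \<mu>) (p n)\<bar> < \<epsilon>" for n
        using order.strict_trans1[OF Lip0_dual_norm_bound[OF _ p] \<mu>(2)] by blast
      then show ?thesis using x by (intro bexI[of _ x]) (auto simp: abs_minus_commute less_imp_le)
    qed
    then have "\<forall>k. \<exists>x\<in>X. \<forall>n. \<bar>apply_bcontfun x n - \<phi> (p n)\<bar> \<le> inverse (real (Suc k))"
      by simp
    then obtain s where s: "\<And>k. s k \<in> X"
      "\<And>k n. \<bar>apply_bcontfun (s k) n - \<phi> (p n)\<bar> \<le> inverse (real (Suc k))" by metis
    have "Cauchy s"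
    proof (rule metric_CauchyI)
      fix e :: real assume "e > 0"
      then obtain N where N: "inverse (real (Suc N)) < e / 2"
        using reals_Archimedean[of "e/2"] by auto
      have "dist (s i) (s j) < e" if "i \<ge> N" "j \<ge> N" for i j
      proof -
        have "inverse (real (Suc i)) \<le> inverse (real (Suc N))"
             "inverse (real (Suc j)) \<le> inverse (real (Suc N))"
          using that by (auto intro!: le_imp_inverse_le)
        then have "dist (apply_bcontfun (s i) n) (apply_bcontfun (s j) n)
            \<le> 2 * inverse (real (Suc N))" for n
          using s(2)[of i n] s(2)[of j n] unfolding dist_real_def by linarith
        then have "dist (s i) (s j) \<le> 2 * inverse (real (Suc N))" by (rule dist_bound)
        then show ?thesis using N by linarith
      qed
      then show "\<exists>M. \<forall>m\<ge>M. \<forall>n\<ge>M. dist (s m) (s n) < e" by blast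
    qed
    then obtain x where "x \<in> X" and x: "s \<longlonglongrightarrow> x"
      using X(2) s(1) unfolding complete_def by blast
    note \<open>x \<in> X\<close>
    moreover have "apply_bcontfun x n = \<phi> (p n)" for n
    proof -
      have "(\<lambda>k. apply_bcontfun (s k) n) \<longlonglongrightarrow> apply_bcontfun x n"
        by (rule metric_tendsto_imp_tendsto[OF x]) (simp add: dist_bounded)
      moreover have "(\<lambda>k. apply_bcontfun (s k) n) \<longlonglongrightarrow> \<phi> (p n)"
      proof (rule Lim_transform2)
        show "(\<lambda>k. \<phi> (p n)) \<longlonglongrightarrow> \<phi> (p n)" by simp
        have "(\<lambda>k. apply_bcontfun (s k) n - \<phi> (p n)) \<longlonglongrightarrow> 0"
          by (rule Lim_null_comparison[OF _ LIMSEQ_inverse_real_of_nat], rule always_eventually)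
             (use s(2) in \<open>simp only: real_norm_def simp_thms\<close>)
        from tendsto_minus[OF this]
        show "(\<lambda>k. \<phi> (p n) - apply_bcontfun (s k) n) \<longlonglongrightarrow> 0" by simp
      qed
      ultimately show ?thesis by (rule LIMSEQ_unique)
    qed
    ultimately show ?thesis by blast
  qed
  define \<beta> where "\<beta> \<phi> = (THE x::ell_infty. \<forall>n. apply_bcontfun x n = \<phi> (p n))" for \<phi>
  have \<beta>I: "\<beta> \<phi> = x" if "\<And>n. apply_bcontfun x n = \<phi> (p n)" for \<phi> x
    unfolding \<beta>_def by (rule the_equality) (simp_all add: that bcontfun_eqI)
  have \<beta>: "\<beta> \<phi> \<in> X" "apply_bcontfun (\<beta> \<phi>) n = \<phi> (p n)" if \<phi>: "\<phi> \<in> lipschitz_free X" for \<phi> n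
  proof -
    obtain x where x: "x \<in> X" "\<And>n. apply_bcontfun x n = \<phi> (p n)" using ev[OF \<phi>] by blast
    have "\<beta> \<phi> = x" using x(2) by (rule \<beta>I)
    with x show "\<beta> \<phi> \<in> X" "apply_bcontfun (\<beta> \<phi>) n = \<phi> (p n)" by simp_all
  qed
  have "norm (\<beta> \<phi>) \<le> Lip0_dual_norm X \<phi>" if "\<phi> \<in> lipschitz_free X" for \<phi>
  proof (rule norm_bound)
    have "\<phi> \<in> Lip0_dual X" using that by (simp add: lipschitz_free_in_def)
    then show "norm (apply_bcontfun (\<beta> \<phi>) n) \<le> Lip0_dual_norm X \<phi>" for n
      using Lip0_dual_norm_bound[OF _ p] \<beta>(2)[OF that] by simp
  qed
  moreover have "\<beta> (delta X x) = x" if "x \<in> X" for x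
    by (rule \<beta>I) (use that p in \<open>simp add: delta_def, simp add: p_def\<close>)
  moreover have "linear_map_on (lipschitz_free X) \<beta>"
    unfolding linear_map_on_def by (intro conjI ballI allI \<beta>I) (simp_all add: \<beta>)
  ultimately have "is_barycentric_map X \<beta>"
    using \<beta>(1) by (auto simp: is_barycentric_map_def)
  then show ?thesis by blast
qed

end

theory Submission
  imports Defs
begin

text \<open>
  Let \<open>E\<^sub>0 \<subseteq> E\<^sub>1 \<subseteq> \<dots>\<close> be finite-dimensional
  subspaces of a Banach space, with union \<open>W\<close> and \<open>Z\<close> the closure of
  \<open>W\<close>. Let \<open>X\<close> be the space of convergent sequences \<open>h\<close> with
  \<open>h\<^sub>m \<in> E\<^sub>m\<close>, with the supremum norm, and \<open>Y\<close> its
  subspace of null sequences. Taking limits identifies \<open>X / Y\<close> with \<open>Z\<close>.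

  A linear map that preserves \<open>Y\<close> acts on the quotient, so if \<open>(X, Y)\<close> has
  the BAP then so has \<open>Z\<close> (\<open>BAP_passes_to_quotient\<close>). A Lipschitz map that
  preserves \<open>Y\<close> need not act on the quotient, and \<open>(X, Y)\<close> has the
  Lipschitz BAP whatever \<open>Z\<close> is (\<open>Lipschitz_BAP\<close>): cut \<open>h\<close>
  off after the term \<open>h\<^sub>n\<close> and continue it by the constant
  \<open>\<pi>\<^sub>r(h\<^sub>n)\<close>, where \<open>\<pi>\<^sub>r\<close> is the radial
  retraction onto the ball of radius \<open>r = \<parallel>lim h\<parallel>\<close>. These maps are
  uniformly Lipschitz, have finite-dimensional range, and converge pointwise to the identity because
  \<open>\<parallel>h\<^sub>n\<parallel>\<close> tends to \<open>r\<close>. They preserve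
  \<open>Y\<close> because \<open>r = 0\<close> there.

  It remains to find \<open>Z\<close> without the BAP. The construction follows the idea of Enflo,
  Davie and Szankowski, in an explicit combinatorial form. Vectors
  \<open>z\<^sub>n\<^sub>,\<^sub>S\<close> indexed by the vertices of the binary tree are finite
  combinations of coordinate vectors \<open>x\<close> on levels \<open>n + 1\<close> and \<open>n +
  2\<close>, and a biorthogonal functional can be read off on either of these levels
  (\<open>biorth_eq_biorth'\<close>). Let \<open>avg_trace n D\<close> be the trace of
  \<open>D\<close> over the vectors of level \<open>n\<close>, divided by their number. The two
  readings turn \<open>avg_trace (n + 1) D - avg_trace n D\<close> into the average of
  \<open>x\<^sub>V\<^sup>*(D y\<^sub>V)\<close> over the nodes \<open>V\<close> of level \<open>n +
  2\<close>, where \<open>y\<^sub>V\<close> is the vector \<open>z\<close> of the parent of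
  \<open>V\<close>, with a sign, minus that of the grandparent, and has coordinate \<open>0\<close>
  at \<open>V\<close> itself. The nodes are partitioned into classes, and the norm is the supremum
  over the subsets of one class of the absolute value of the sum of coordinates. The partition is
  such that no class meets the supports of two of the vectors \<open>y\<^sub>V\<close> with
  \<open>V\<close> in one class (\<open>yvec_supports_separated\<close>). Hence a signed sum of
  these vectors has norm at most \<open>12\<close>, no matter how large the class is
  (\<open>norm_signed_yelt_sum_le\<close>). A suitable choice of signs bounds the sum of
  \<open>x\<^sub>V\<^sup>*(D y\<^sub>V)\<close> over a class by twice the norm of \<open>D\<close>
  at one signed sum of the \<open>y\<^sub>V\<close>, so that dividing by the class size, which is at
  least \<open>2 ^ (n div 12)\<close>, gives summable increments (\<open>avg_trace_step\<close>). If
  \<open>D = I - T\<close> with \<open>T\<close> of finite rank, bounded by a fixed constant, and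
  close to the identity on a large finite set, all these increments together are small, so
  \<open>avg_trace n D\<close> stays below \<open>1/2\<close>. But \<open>avg_trace n T\<close>
  tends to \<open>0\<close> since the coordinates of a vector of \<open>Z\<close> do, so
  \<open>avg_trace n D\<close> tends to \<open>1\<close> (\<open>zchain_not_BAP\<close>).

  Finally a Lipschitz lifting \<open>T\<close> would turn each Lipschitz approximation
  \<open>S\<close> into the linear map that sends \<open>x\<close> to the value at \<open>T
  x\<close> of the linear extension of \<open>S\<close> to the free space, and so would give the BAP
  (\<open>BAP_of_lifting_and_Lipschitz_BAP\<close>).
\<close>


section \<open>Finite-dimensional subspaces and closures\<close>

lemma compact_coefficient_box:
  fixes B :: "'a::real_normed_vector set"
  assumes "finite B"
  shows "compact {\<Sum>b\<in>B. c b *\<^sub>R b |c. \<forall>b\<in>B. \<bar>c b\<bar> \<le> r}"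
  using assms
proof (induction B)
  case empty
  then show ?case by simp
next
  case (insert b B)
  let ?K = "{\<Sum>b\<in>B. c b *\<^sub>R b |c. \<forall>b\<in>B. \<bar>c b\<bar> \<le> r}"
  let ?I = "(\<lambda>t. t *\<^sub>R b) ` {-r..r}"
  have "compact ?I" by (intro compact_continuous_image continuous_intros) auto
  then have "compact {x + y |x y. x \<in> ?I \<and> y \<in> ?K}" by (rule compact_sums[OF _ insert.IH])
  moreover have "{\<Sum>b\<in>insert b B. c b *\<^sub>R b |c. \<forall>b\<in>insert b B. \<bar>c b\<bar> \<le> r}
      = {x + y |x y. x \<in> ?I \<and> y \<in> ?K}" (is "?L = ?R")
  proof
    show "?L \<subseteq> ?R"
    proof
      fix v assume "v \<in> ?L"
      then obtain c where c: "v = (\<Sum>b\<in>insert b B. c b *\<^sub>R b)" "\<forall>b\<in>insert b B. \<bar>c b\<bar> \<le> r" by blast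
      have "v = c b *\<^sub>R b + (\<Sum>b\<in>B. c b *\<^sub>R b)" using c(1) insert.hyps by simp
      moreover have "c b *\<^sub>R b \<in> ?I" using c(2) by (auto simp: abs_le_iff)
      moreover have "(\<Sum>b\<in>B. c b *\<^sub>R b) \<in> ?K" using c(2) by auto
      ultimately show "v \<in> ?R" by blast
    qed
    show "?R \<subseteq> ?L"
    proof
      fix v assume "v \<in> ?R"
      then obtain t c where v: "v = t *\<^sub>R b + (\<Sum>b\<in>B. c b *\<^sub>R b)" "t \<in> {-r..r}" "\<forall>b\<in>B. \<bar>c b\<bar> \<le> r" by blast
      have "(\<Sum>x\<in>B. (c(b:=t)) x *\<^sub>R x) = (\<Sum>b\<in>B. c b *\<^sub>R b)"
        using insert.hyps by (intro sum.cong) auto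
      then have "v = (\<Sum>x\<in>insert b B. (c(b:=t)) x *\<^sub>R x)" using v insert.hyps by simp
      moreover have "\<forall>x\<in>insert b B. \<bar>(c(b:=t)) x\<bar> \<le> r" using v by auto
      ultimately show "v \<in> ?L" by blast
    qed
  qed
  ultimately show ?case by simp
qed

text \<open>
  A convergent sequence in the span is bounded, so its coefficients stay in a box, whose image is
  compact.
\<close>

lemma closed_span_if_bounded_coefficients:
  fixes B :: "'a::real_normed_vector set"
  assumes B: "finite B" and M: "M \<ge> 0"
    and bd: "\<forall>v\<in>span B. \<exists>c. v = (\<Sum>b\<in>B. c b *\<^sub>R b) \<and> (\<forall>b\<in>B. \<bar>c b\<bar> \<le> M * norm v)"
  shows "closed (span B)"
  unfolding closed_sequential_limits
proof (intro allI impI, elim conjE)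
  fix x l assume x: "\<forall>n. x n \<in> span B" "x \<longlonglongrightarrow> l"
  from x(2) have "Bseq x" by (intro convergent_imp_Bseq convergentI)
  then obtain R where R: "\<And>n. norm (x n) \<le> R" by (auto simp: Bseq_def)
  let ?K = "{\<Sum>b\<in>B. c b *\<^sub>R b |c. \<forall>b\<in>B. \<bar>c b\<bar> \<le> M * R}"
  have "x n \<in> ?K" for n
  proof -
    obtain c where c: "x n = (\<Sum>b\<in>B. c b *\<^sub>R b)" "\<forall>b\<in>B. \<bar>c b\<bar> \<le> M * norm (x n)" using bd x(1) by blast
    have "M * norm (x n) \<le> M * R" using R M by (intro mult_left_mono)
    with c show ?thesis by fastforce
  qed
  moreover have "closed ?K" using compact_coefficient_box[OF B] by (rule compact_imp_closed)
  ultimately have "l \<in> ?K" using x(2) closed_sequentially by blast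
  then obtain c where "l = (\<Sum>b\<in>B. c b *\<^sub>R b)" by blast
  then show "l \<in> span B" by (simp add: span_sum span_scale span_base)
qed

text \<open>
  Coefficients are controlled by the norm although \<open>B\<close> may be dependent. In the
  induction a new vector outside the span of the old ones has positive distance \<open>d\<close>
  from it, because that span is closed by the previous lemma; then \<open>\<bar>t\<bar> * d \<le>
  norm v\<close> bounds the new coefficient \<open>t\<close> of \<open>v\<close>.
\<close>

lemma finite_span_bounded_coefficients:
  fixes B :: "'a::real_normed_vector set"
  assumes "finite B"
  shows "\<exists>M\<ge>0. \<forall>v\<in>span B. \<exists>c. v = (\<Sum>b\<in>B. c b *\<^sub>R b) \<and> (\<forall>b\<in>B. \<bar>c b\<bar> \<le> M * norm v)"
  using assms
proof (induction B)
  case empty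
  then show ?case by auto
next
  case (insert b B)
  then obtain M where M: "M \<ge> 0" "\<forall>v\<in>span B. \<exists>c. v = (\<Sum>b\<in>B. c b *\<^sub>R b) \<and> (\<forall>b\<in>B. \<bar>c b\<bar> \<le> M * norm v)"
    by blast
  note cl = closed_span_if_bounded_coefficients[OF insert.hyps(1) M]
  show ?case
  proof (cases "b \<in> span B")
    case True
    have "\<exists>c. v = (\<Sum>b\<in>insert b B. c b *\<^sub>R b) \<and> (\<forall>b\<in>insert b B. \<bar>c b\<bar> \<le> M * norm v)"
      if v: "v \<in> span (insert b B)" for v
    proof -
      have "v \<in> span B" using v True by (simp add: span_redundant)
      then obtain c where c: "v = (\<Sum>b\<in>B. c b *\<^sub>R b)" "\<forall>b\<in>B. \<bar>c b\<bar> \<le> M * norm v" using M(2) by blast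
      have "(\<Sum>x\<in>B. (c(b:=0)) x *\<^sub>R x) = (\<Sum>b\<in>B. c b *\<^sub>R b)"
        using insert.hyps by (intro sum.cong) auto
      then have "v = (\<Sum>x\<in>insert b B. (c(b:=0)) x *\<^sub>R x)" using c insert.hyps by simp
      moreover have "\<forall>x\<in>insert b B. \<bar>(c(b:=0)) x\<bar> \<le> M * norm v" using c M(1) by auto
      ultimately show ?thesis by blast
    qed
    then show ?thesis using M(1) by blast
  next
    case False
    define d where "d = infdist b (span B)"
    have d: "d > 0" unfolding d_def
      using infdist_pos_not_in_closed[OF cl _ False] span_zero by blast
    define M' where "M' = max (1 / d) (M * (1 + norm b / d))"
    have "\<exists>c. v = (\<Sum>b\<in>insert b B. c b *\<^sub>R b) \<and> (\<forall>b\<in>insert b B. \<bar>c b\<bar> \<le> M' * norm v)"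
      if v: "v \<in> span (insert b B)" for v
    proof -
      obtain t where t: "v - t *\<^sub>R b \<in> span B" using v by (auto simp: span_insert)
      have t_le: "\<bar>t\<bar> * d \<le> norm v"
      proof (cases "t = 0")
        case False
        have "(-1 / t) *\<^sub>R (v - t *\<^sub>R b) \<in> span B" using t by (rule span_scale)
        then have "d \<le> dist b ((-1 / t) *\<^sub>R (v - t *\<^sub>R b))" unfolding d_def by (rule infdist_le)
        also have "b - (-1 / t) *\<^sub>R (v - t *\<^sub>R b) = (1 / t) *\<^sub>R v"
          using False by (simp add: algebra_simps)
        then have "dist b ((-1 / t) *\<^sub>R (v - t *\<^sub>R b)) = norm v / \<bar>t\<bar>"
          by (simp add: dist_norm divide_inverse mult.commute)
        finally show ?thesis using False by (simp add: field_simps)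
      qed simp
      obtain c where c: "v - t *\<^sub>R b = (\<Sum>x\<in>B. c x *\<^sub>R x)" "\<forall>x\<in>B. \<bar>c x\<bar> \<le> M * norm (v - t *\<^sub>R b)"
        using bspec[OF M(2) t] by blast
      have t_le': "\<bar>t\<bar> \<le> norm v / d" using t_le d by (simp add: field_simps)
      have "norm (v - t *\<^sub>R b) \<le> norm v + \<bar>t\<bar> * norm b" using norm_triangle_ineq4[of v "t *\<^sub>R b"] by simp
      also have "\<dots> \<le> norm v + norm v / d * norm b" by (intro add_left_mono mult_right_mono t_le') simp
      finally have "M * norm (v - t *\<^sub>R b) \<le> M * (norm v + norm v / d * norm b)"
        using M(1) by (rule mult_left_mono)
      also have "\<dots> = (M * (1 + norm b / d)) * norm v" by (simp add: field_simps)
      also have "\<dots> \<le> M' * norm v" unfolding M'_def by (intro mult_right_mono) auto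
      finally have *: "M * norm (v - t *\<^sub>R b) \<le> M' * norm v" .
      have "norm v / d = 1 / d * norm v" by simp
      also have "\<dots> \<le> M' * norm v" unfolding M'_def by (intro mult_right_mono) auto
      finally have **: "\<bar>t\<bar> \<le> M' * norm v" using t_le' by linarith
      have "(\<Sum>x\<in>B. (c(b:=t)) x *\<^sub>R x) = (\<Sum>b\<in>B. c b *\<^sub>R b)"
        using insert.hyps by (intro sum.cong) auto
      then have "v = (\<Sum>x\<in>insert b B. (c(b:=t)) x *\<^sub>R x)"
        using c(1) insert.hyps by (simp add: algebra_simps)
      moreover have "\<forall>x\<in>insert b B. \<bar>(c(b:=t)) x\<bar> \<le> M' * norm v" using c(2) * ** by fastforce
      ultimately show ?thesis by blast
    qed
    moreover have "M' \<ge> 0" using d by (auto simp: M'_def le_max_iff_disj)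
    ultimately show ?thesis by blast
  qed
qed

lemma closed_span_finite:
  fixes B :: "'a::real_normed_vector set"
  assumes "finite B"
  shows "closed (span B)"
proof -
  obtain M where "M \<ge> 0" "\<forall>v\<in>span B. \<exists>c. v = (\<Sum>b\<in>B. c b *\<^sub>R b) \<and> (\<forall>b\<in>B. \<bar>c b\<bar> \<le> M * norm v)"
    using finite_span_bounded_coefficients[OF assms] by blast
  then show ?thesis by (rule closed_span_if_bounded_coefficients[OF assms])
qed

lemma subspace_closure:
  fixes W :: "'a::real_normed_vector set"
  assumes "subspace W"
  shows "subspace (closure W)"
proof (rule subspaceI)
  show "0 \<in> closure W" using subspace_0[OF assms] closure_subset by blast
next
  fix x y assume "x \<in> closure W" "y \<in> closure W"
  then obtain f g where "\<forall>n. f n \<in> W" "f \<longlonglongrightarrow> x" "\<forall>n. g n \<in> W" "g \<longlonglongrightarrow> y"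
    unfolding closure_sequential by blast
  then show "x + y \<in> closure W"
    unfolding closure_sequential using assms
    by (intro exI[of _ "\<lambda>n. f n + g n"] conjI allI tendsto_add) (simp_all add: subspace_add)
next
  fix c x assume "x \<in> closure W"
  then obtain f where "\<forall>n. f n \<in> W" "f \<longlonglongrightarrow> x" unfolding closure_sequential by blast
  then show "c *\<^sub>R x \<in> closure W"
    unfolding closure_sequential using assms
    by (intro exI[of _ "\<lambda>n. c *\<^sub>R f n"] conjI allI tendsto_intros) (simp_all add: subspace_scale)
qed


section \<open>A lifting linearizes Lipschitz approximations\<close>

definition coord_fun :: "ell_infty set \<Rightarrow> (ell_infty \<Rightarrow> ell_infty) \<Rightarrow> nat \<Rightarrow> ell_infty \<Rightarrow> real" where
  "coord_fun X S n = (\<lambda>x. if x \<in> X then apply_bcontfun (S x) n else 0)"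

text \<open>
  For \<open>S\<close> Lipschitz with \<open>S 0 = 0\<close> this is the linear extension of
  \<open>S\<close> to the free space of \<open>X\<close>. Working inside the bounded sequences, it
  is enough to apply \<open>\<phi>\<close> to each coordinate function of \<open>S\<close>.
\<close>

definition linearization ::
    "ell_infty set \<Rightarrow> (ell_infty \<Rightarrow> ell_infty) \<Rightarrow> ((ell_infty \<Rightarrow> real) \<Rightarrow> real) \<Rightarrow> ell_infty" where
  "linearization X S \<phi> = Bcontfun (\<lambda>n. \<phi> (coord_fun X S n))"

lemma coord_fun_Lip0:
  assumes "lipschitz_on L X S" "S 0 = 0"
  shows "lipschitz_on L X (coord_fun X S n)" "coord_fun X S n \<in> Lip0 X"
proof -
  show *: "lipschitz_on L X (coord_fun X S n)"
  proof (rule lipschitz_onI)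
    fix x y assume "x \<in> X" "y \<in> X"
    then show "dist (coord_fun X S n x) (coord_fun X S n y) \<le> L * dist x y"
      using order_trans[OF dist_bounded lipschitz_onD[OF assms(1)]] by (simp add: coord_fun_def)
  qed (use assms(1) lipschitz_on_nonneg in blast)
  then show "coord_fun X S n \<in> Lip0 X" using assms(2) by (auto simp: Lip0_def coord_fun_def)
qed

lemma zero_in_Lip0: "0 \<in> Lip0 X" "lip_const X 0 \<le> 1"
proof -
  have *: "lipschitz_on 1 X (0 :: 'a \<Rightarrow> real)" by (auto intro!: lipschitz_onI)
  then show "0 \<in> Lip0 X" by (auto simp: Lip0_def)
  show "lip_const X 0 \<le> 1" by (rule lip_const_le[OF *])
qed

lemma Lip0_dual_norm_bound_Lipschitz:
  assumes \<phi>: "\<phi> \<in> Lip0_dual X" and f: "f \<in> Lip0 X" "lipschitz_on L X f" "L > 0"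
  shows "\<bar>\<phi> f\<bar> \<le> L * Lip0_dual_norm X \<phi>"
proof -
  let ?g = "(1 / L) *\<^sub>R f"
  have g: "lipschitz_on 1 X ?g"
    using lipschitz_on_cmult[OF f(2), of "1 / L"] f(3) by (simp add: scaleR_fun_def)
  then have gL: "?g \<in> Lip0 X" using f(1) by (auto simp: Lip0_def)
  have "f = L *\<^sub>R ?g" using f(3) by (simp add: fun_eq_iff)
  then have "\<phi> f = \<phi> (L *\<^sub>R ?g)" by (rule arg_cong)
  also have "\<phi> (L *\<^sub>R ?g) = L * \<phi> ?g"
    using \<phi> gL unfolding Lip0_dual_def linear_map_on_def real_scaleR_def mem_Collect_eq by blast
  finally have "\<phi> f = L * \<phi> ?g" .
  then show ?thesis
    using Lip0_dual_norm_bound[OF \<phi> gL lip_const_le[OF g]] f(3) by (simp add: abs_mult)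
qed

lemma Lip0_dual_norm_zero: "Lip0_dual_norm X 0 = 0"
proof -
  have "{f \<in> Lip0 X. lip_const X f \<le> 1} \<noteq> {}" using zero_in_Lip0[of X] by blast
  then show ?thesis unfolding Lip0_dual_norm_def by simp
qed

lemma span_delta_subset_free_in:
  assumes "subspace X" "N \<subseteq> X"
  shows "span (delta X ` N) \<subseteq> lipschitz_free_in X N" "span (delta X ` N) \<subseteq> Lip0_dual X"
proof -
  show *: "span (delta X ` N) \<subseteq> Lip0_dual X"
    using assms by (intro span_minimal) (auto simp: subspace_Lip0_dual intro!: delta_in_Lip0_dual)
  show "span (delta X ` N) \<subseteq> lipschitz_free_in X N"
  proof
    fix \<mu> assume \<mu>: "\<mu> \<in> span (delta X ` N)"
    then have "\<forall>\<epsilon>>0. \<exists>\<nu>\<in>span (delta X ` N). Lip0_dual_norm X (\<mu> - \<nu>) < \<epsilon>"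
      by (auto intro!: bexI[of _ \<mu>] simp: Lip0_dual_norm_zero)
    then show "\<mu> \<in> lipschitz_free_in X N" using \<mu> * by (auto simp: lipschitz_free_in_def)
  qed
qed

context
  fixes X :: "ell_infty set" and S :: "ell_infty \<Rightarrow> ell_infty" and L :: real
  assumes X: "subspace X" and S: "lipschitz_on L X S" "S 0 = 0" and L: "L > 0"
begin

lemma apply_linearization:
  assumes "\<phi> \<in> Lip0_dual X"
  shows "apply_bcontfun (linearization X S \<phi>) n = \<phi> (coord_fun X S n)"
proof -
  have "(\<lambda>n. \<phi> (coord_fun X S n)) \<in> bcontfun"
  proof (rule bcontfun_normI)
    show "norm (\<phi> (coord_fun X S n)) \<le> L * Lip0_dual_norm X \<phi>" for n
      unfolding real_norm_def
      by (rule Lip0_dual_norm_bound_Lipschitz[OF assms coord_fun_Lip0(2)[OF S] coord_fun_Lip0(1)[OF S] L])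
  qed simp
  then show ?thesis unfolding linearization_def by (subst Bcontfun_inverse) (assumption, rule refl)
qed

lemma norm_linearization_le:
  assumes "\<phi> \<in> Lip0_dual X"
  shows "norm (linearization X S \<phi>) \<le> L * Lip0_dual_norm X \<phi>"
proof (rule norm_bound)
  show "norm (apply_bcontfun (linearization X S \<phi>) n) \<le> L * Lip0_dual_norm X \<phi>" for n
    unfolding real_norm_def apply_linearization[OF assms]
    by (rule Lip0_dual_norm_bound_Lipschitz[OF assms coord_fun_Lip0(2)[OF S] coord_fun_Lip0(1)[OF S] L])
qed

lemma linearization_scale:
  assumes "\<phi> \<in> Lip0_dual X"
  shows "linearization X S (c *\<^sub>R \<phi>) = c *\<^sub>R linearization X S \<phi>"
  using assms subspace_Lip0_dual[of X] by (auto intro!: bcontfun_eqI simp: apply_linearization subspace_scale)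

lemma linearization_linear:
  assumes "\<phi> \<in> Lip0_dual X" "\<psi> \<in> Lip0_dual X"
  shows "linearization X S (\<phi> + \<psi>) = linearization X S \<phi> + linearization X S \<psi>"
    and "linearization X S (\<phi> - \<psi>) = linearization X S \<phi> - linearization X S \<psi>"
  using assms subspace_Lip0_dual[of X]
  by (auto intro!: bcontfun_eqI simp: apply_linearization subspace_add subspace_diff)

lemma linearization_delta:
  assumes "x \<in> X"
  shows "linearization X S (delta X x) = S x"
proof (rule bcontfun_eqI)
  show "apply_bcontfun (linearization X S (delta X x)) n = apply_bcontfun (S x) n" for n
  proof (subst apply_linearization[OF delta_in_Lip0_dual[OF X assms]])
    have "delta X x (coord_fun X S n) = coord_fun X S n x"
      unfolding delta_def by (rule if_P[OF coord_fun_Lip0(2)[OF S]])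
    then show "delta X x (coord_fun X S n) = apply_bcontfun (S x) n"
      using assms by (simp add: coord_fun_def)
  qed
qed

lemma linearization_zero: "linearization X S 0 = 0"
  using linearization_scale[of 0 0] subspace_0[OF subspace_Lip0_dual, of X] by simp

lemma linearization_sum_delta:
  assumes "finite F" "F \<subseteq> X"
  shows "linearization X S (\<Sum>x\<in>F. c x *\<^sub>R delta X x) = (\<Sum>x\<in>F. c x *\<^sub>R S x)"
  using assms
proof (induction F)
  case empty
  show ?case unfolding sum.empty by (rule linearization_zero)
next
  case (insert x F)
  have "(\<Sum>x\<in>F. c x *\<^sub>R delta X x) \<in> Lip0_dual X" "delta X x \<in> Lip0_dual X"
    using insert.prems
    by (auto intro!: subspace_sum subspace_scale subspace_Lip0_dual delta_in_Lip0_dual[OF X])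
  moreover have "x \<in> X" "F \<subseteq> X" using insert.prems by auto
  ultimately show ?case
    using insert.IH unfolding sum.insert[OF insert.hyps]
    by (simp only: linearization_linear linearization_scale subspace_scale[OF subspace_Lip0_dual] linearization_delta)
qed

text \<open>
  On combinations of point evaluations at points of \<open>N\<close> the linearization is the same
  combination of values of \<open>S\<close>, and these combinations are dense in the free space of
  \<open>N\<close>. With \<open>N = Y\<close> this shows that linearizing keeps the invariance of
  \<open>Y\<close>; with \<open>N = X\<close> and \<open>V\<close> a finite-dimensional space it
  shows that linearizing does not enlarge the range beyond \<open>V\<close>.
\<close>

lemma linearization_in_closed_subspace:
  assumes N: "N \<subseteq> X" and \<phi>: "\<phi> \<in> lipschitz_free_in X N"
    and V: "closed V" "subspace V" "S ` N \<subseteq> V"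
  shows "linearization X S \<phi> \<in> V"
proof -
  have "\<mu> \<in> Lip0_dual X \<and> linearization X S \<mu> \<in> V" if "\<mu> \<in> span (delta X ` N)" for \<mu>
    using that
  proof (induction rule: span_induct_alt)
    case base
    show ?case unfolding linearization_zero
      using V(2) subspace_Lip0_dual by (intro conjI subspace_0)
  next
    case (step c x y)
    then obtain u where u: "u \<in> N" "x = delta X u" by auto
    have y: "y \<in> Lip0_dual X" using step(2) by blast
    have x: "x \<in> Lip0_dual X" using u N by (auto intro!: delta_in_Lip0_dual[OF X])
    have "linearization X S (c *\<^sub>R x + y) = c *\<^sub>R linearization X S x + linearization X S y"
      by (simp only: linearization_linear linearization_scale x y subspace_scale[OF subspace_Lip0_dual])
    moreover have "linearization X S x \<in> V" using linearization_delta[of u] u N V(3) by auto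
    ultimately have "linearization X S (c *\<^sub>R x + y) \<in> V"
      using step(2) V(2) by (simp only: subspace_add subspace_scale)
    moreover have "c *\<^sub>R x + y \<in> Lip0_dual X"
      by (intro subspace_add subspace_scale subspace_Lip0_dual x y)
    ultimately show ?case by blast
  qed
  then have mem: "linearization X S \<mu> \<in> V" if "\<mu> \<in> span (delta X ` N)" for \<mu> using that by blast
  have "\<exists>v\<in>V. dist v (linearization X S \<phi>) < e" if e: "e > 0" for e
  proof -
    have "e / L > 0" using e L by simp
    then obtain \<mu> where \<mu>: "\<mu> \<in> span (delta X ` N)" "Lip0_dual_norm X (\<phi> - \<mu>) < e / L"
      using \<phi> unfolding lipschitz_free_in_def by blast
    have d: "\<phi> \<in> Lip0_dual X" "\<mu> \<in> Lip0_dual X"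
      using \<phi> \<mu> span_delta_subset_free_in[OF X N] by (auto simp: lipschitz_free_in_def)
    have "norm (linearization X S (\<phi> - \<mu>)) \<le> L * Lip0_dual_norm X (\<phi> - \<mu>)"
      using d by (intro norm_linearization_le subspace_diff subspace_Lip0_dual)
    also have "\<dots> < e" using \<mu>(2) L by (simp add: field_simps)
    finally show ?thesis
      using mem[OF \<mu>(1)] d by (intro bexI[of _ "linearization X S \<mu>"]) (auto simp: linearization_linear dist_norm norm_minus_commute)
  qed
  then show ?thesis using V(1) closure_approachable by (metis closure_closed)
qed

end

text \<open>
  The conditions on a barycentric map determine it: both sides are bounded linear maps that send
  \<open>delta X x\<close> to \<open>x\<close>.
\<close>

lemma barycentric_map_eq_linearization:
  assumes X: "subspace X" and \<beta>: "is_barycentric_map X \<beta>" and \<phi>: "\<phi> \<in> lipschitz_free X"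
  shows "\<beta> \<phi> = linearization X (\<lambda>x. x) \<phi>"
proof -
  let ?l = "linearization X (\<lambda>x. x)"
  have lip: "lipschitz_on 1 X (\<lambda>x. x)" by (auto intro!: lipschitz_onI)
  note lin = linearization_linear[OF X lip _ zero_less_one] and del = linearization_delta[OF X lip _ zero_less_one]
    and nl = norm_linearization_le[OF X lip _ zero_less_one]
  note sub = span_delta_subset_free_in[OF X subset_refl]
  have dual: "lipschitz_free X \<subseteq> Lip0_dual X" by (auto simp: lipschitz_free_in_def)
  have \<beta>lin: "linear_map_on (lipschitz_free X) \<beta>" and \<beta>n: "\<forall>\<phi>\<in>lipschitz_free X. norm (\<beta> \<phi>) \<le> Lip0_dual_norm X \<phi>"
    and \<beta>\<delta>: "\<forall>x\<in>X. \<beta> (delta X x) = x"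
    using \<beta> by (auto simp: is_barycentric_map_def)
  have "\<mu> \<in> span (delta X ` X) \<and> \<beta> \<mu> = ?l \<mu>" if "\<mu> \<in> span (delta X ` X)" for \<mu>
    using that
  proof (induction rule: span_induct_alt)
    case base
    have "0 \<in> lipschitz_free X" using sub span_zero by blast
    then have "\<beta> (0 *\<^sub>R 0) = 0 *\<^sub>R \<beta> 0" using \<beta>lin unfolding linear_map_on_def by blast
    then show ?case
      unfolding linearization_zero[OF X lip refl zero_less_one] by (simp only: scaleR_zero_left span_zero simp_thms)
  next
    case (step c x y)
    then obtain u where u: "u \<in> X" "x = delta X u" by auto
    have x: "x \<in> span (delta X ` X)" using u by (intro span_base) blast
    then have cx: "c *\<^sub>R x \<in> span (delta X ` X)" by (rule span_scale)
    have y: "y \<in> span (delta X ` X)" using step(2) by blast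
    have "\<beta> (c *\<^sub>R x + y) = \<beta> (c *\<^sub>R x) + \<beta> y" "\<beta> (c *\<^sub>R x) = c *\<^sub>R \<beta> x"
      using \<beta>lin subsetD[OF sub(1) x] subsetD[OF sub(1) cx] subsetD[OF sub(1) y]
      unfolding linear_map_on_def by blast+
    moreover have "?l (c *\<^sub>R x + y) = ?l (c *\<^sub>R x) + ?l y" "?l (c *\<^sub>R x) = c *\<^sub>R ?l x"
      using lin(1)[OF refl subsetD[OF sub(2) cx] subsetD[OF sub(2) y]]
        linearization_scale[OF X lip refl zero_less_one subsetD[OF sub(2) x]] .
    moreover have "\<beta> x = ?l x" using u \<beta>\<delta> del by auto
    ultimately have "\<beta> (c *\<^sub>R x + y) = ?l (c *\<^sub>R x + y)" using step(2) by argo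
    moreover have "c *\<^sub>R x + y \<in> span (delta X ` X)" using cx y by (rule span_add)
    ultimately show ?case by blast
  qed
  then have eq: "\<beta> \<mu> = ?l \<mu>" if "\<mu> \<in> span (delta X ` X)" for \<mu> using that by blast
  have "norm (\<beta> \<phi> - ?l \<phi>) \<le> 0 + e" if e: "e > 0" for e
  proof -
    obtain \<mu> where \<mu>: "\<mu> \<in> span (delta X ` X)" "Lip0_dual_norm X (\<phi> - \<mu>) < e / 2"
      using \<phi> half_gt_zero[OF e] unfolding lipschitz_free_in_def by blast
    have m: "\<mu> \<in> lipschitz_free X" "\<mu> \<in> Lip0_dual X" "\<phi> \<in> Lip0_dual X" using sub \<mu> dual \<phi> by auto
    have diff: "\<phi> - \<mu> \<in> lipschitz_free X"
    proof -
      have "\<exists>\<nu>\<in>span (delta X ` X). Lip0_dual_norm X (\<phi> - \<mu> - \<nu>) < r" if r: "r > 0" for r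
      proof -
        obtain \<nu> where "\<nu> \<in> span (delta X ` X)" "Lip0_dual_norm X (\<phi> - \<nu>) < r"
          using \<phi> r unfolding lipschitz_free_in_def by blast
        then show ?thesis using \<mu>(1) by (intro bexI[of _ "\<nu> - \<mu>"]) (auto intro: span_diff)
      qed
      then show ?thesis using m by (auto simp: lipschitz_free_in_def intro!: subspace_diff subspace_Lip0_dual)
    qed
    have "\<beta> ((\<phi> - \<mu>) + \<mu>) = \<beta> (\<phi> - \<mu>) + \<beta> \<mu>"
      using \<beta>lin diff m unfolding linear_map_on_def by blast
    then have "\<beta> \<phi> = \<beta> (\<phi> - \<mu>) + \<beta> \<mu>" by simp
    moreover have "?l (\<phi> - \<mu>) = ?l \<phi> - ?l \<mu>" using lin m by auto
    ultimately have "\<beta> \<phi> - ?l \<phi> = \<beta> (\<phi> - \<mu>) - ?l (\<phi> - \<mu>)" using eq[OF \<mu>(1)] by simp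
    then have "norm (\<beta> \<phi> - ?l \<phi>) \<le> norm (\<beta> (\<phi> - \<mu>)) + norm (?l (\<phi> - \<mu>))"
      by (simp add: norm_triangle_ineq4)
    also have "\<dots> \<le> Lip0_dual_norm X (\<phi> - \<mu>) + Lip0_dual_norm X (\<phi> - \<mu>)"
      using \<beta>n diff nl[of "\<phi> - \<mu>"] dual by (intro add_mono) auto
    also have "\<dots> \<le> 0 + e" using \<mu>(2) by simp
    finally show ?thesis .
  qed
  then have "norm (\<beta> \<phi> - ?l \<phi>) \<le> 0" by (rule field_le_epsilon)
  then show ?thesis by simp
qed

text \<open>
  Continuity at \<open>0\<close> gives a bound on a small ball, which is rescaled.
\<close>

lemma bounded_linear_into_Lip0_dual:
  assumes X: "subspace X" and T: "T ` X \<subseteq> Lip0_dual X" "linear_map_on X T" "continuous_into_Lip0_dual X T"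
  obtains C where "C > 0" "\<And>x. x \<in> X \<Longrightarrow> Lip0_dual_norm X (T x) \<le> C * norm x"
proof -
  have X0: "0 \<in> X" using X by (rule subspace_0)
  have T0: "T 0 = 0"
  proof -
    have "T (0 *\<^sub>R 0) = 0 *\<^sub>R T 0" using T(2) X0 unfolding linear_map_on_def by blast
    then show ?thesis by simp
  qed
  obtain \<eta> where \<eta>: "\<eta> > 0" "\<And>x. x \<in> X \<Longrightarrow> norm x < \<eta> \<Longrightarrow> Lip0_dual_norm X (T x) < 1"
    using T(3) X0 T0 unfolding continuous_into_Lip0_dual_def
    by (metis diff_zero zero_less_one)
  have "Lip0_dual_norm X (T x) \<le> 2 / \<eta> * norm x" if x: "x \<in> X" for x
  proof (cases "x = 0")
    case True
    then show ?thesis using T0 by (simp add: Lip0_dual_norm_zero)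
  next
    case False
    define s where "s = \<eta> / (2 * norm x)"
    have s: "s > 0" using False \<eta> by (simp add: s_def)
    have sx: "s *\<^sub>R x \<in> X" using x X by (simp add: subspace_scale)
    have "norm (s *\<^sub>R x) < \<eta>" using False \<eta> by (simp add: s_def)
    then have lt: "Lip0_dual_norm X (T (s *\<^sub>R x)) < 1" using \<eta>(2) sx by blast
    have Ts: "T (s *\<^sub>R x) = s *\<^sub>R T x" using T(2) x unfolding linear_map_on_def by blast
    have dual: "T (s *\<^sub>R x) \<in> Lip0_dual X" using T(1) sx by blast
    show ?thesis
      unfolding Lip0_dual_norm_def
    proof (rule cSUP_least)
      show "{f \<in> Lip0 X. lip_const X f \<le> 1} \<noteq> {}" using zero_in_Lip0[of X] by blast
      fix f assume "f \<in> {f \<in> Lip0 X. lip_const X f \<le> 1}"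
      then have "\<bar>T (s *\<^sub>R x) f\<bar> < 1" using Lip0_dual_norm_bound[OF dual] lt by fastforce
      then have "s * \<bar>T x f\<bar> < 1" using s by (simp add: Ts abs_mult)
      then show "\<bar>T x f\<bar> \<le> 2 / \<eta> * norm x" using False \<eta>(1) by (simp add: s_def field_simps)
    qed
  qed
  then show ?thesis using that[of "2 / \<eta>"] \<eta>(1) by simp
qed

lemma finite_dim_range_translate:
  assumes "finite_dim_range_on X S" "subspace X" "S ` X \<subseteq> X"
  obtains B where "finite B" "B \<subseteq> X" "(\<lambda>x. S x - S 0) ` X \<subseteq> span B"
proof -
  obtain B where B: "finite B" "B \<subseteq> X" "S ` X \<subseteq> span B"
    using assms(1) unfolding finite_dim_range_on_def by blast
  have "S 0 \<in> span B" using B(3) subspace_0[OF assms(2)] by blast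
  then have "(\<lambda>x. S x - S 0) ` X \<subseteq> span B" using B(3) by (auto intro!: span_diff)
  then show ?thesis using that B by blast
qed

text \<open>
  The linear approximation is \<open>x \<mapsto> linearization X S (T x)\<close>, where
  \<open>S\<close> is a Lipschitz approximation that is translated so as to fix \<open>0\<close>.
  Its error at \<open>x\<close> is the difference of the linearizations of \<open>S\<close> and of
  the identity at \<open>T x\<close>; for \<open>T x\<close> close to a finite combination of point
  evaluations, this is governed by \<open>S y - y\<close> at finitely many points \<open>y\<close>.
\<close>

lemma BAP_of_lifting_and_Lipschitz_BAP:
  fixes X Y :: "ell_infty set"
  assumes banach: "banach_on X" and Y: "closed_subspace_of X Y"
    and lipBAP: "pair_Lipschitz_BAP X Y" and lift: "pair_Lipschitz_lifting X Y"
  shows "pair_BAP X Y"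
proof -
  have X: "subspace X" "complete X" using banach by (auto simp: banach_on_def)
  have Ys: "subspace Y" "Y \<subseteq> X" using Y by (auto simp: closed_subspace_of_def)
  have Yc: "closed Y"
    using Y complete_imp_closed[OF X(2)] by (auto simp: closed_subspace_of_def intro: closedin_closed_trans)
  have X0: "0 \<in> X" "0 \<in> Y" using X Ys by (auto simp: subspace_0)
  obtain \<beta> T where \<beta>: "is_barycentric_map X \<beta>" and T: "T ` X \<subseteq> lipschitz_free X" "linear_map_on X T"
      "continuous_into_Lip0_dual X T" "T ` Y \<subseteq> lipschitz_free_in X Y" and \<beta>T: "\<forall>x\<in>X. \<beta> (T x) = x"
    using lift unfolding pair_Lipschitz_lifting_def by blast
  have free_dual: "lipschitz_free X \<subseteq> Lip0_dual X" by (auto simp: lipschitz_free_in_def)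
  have T_dual: "T ` X \<subseteq> Lip0_dual X" using T(1) free_dual by blast
  obtain C where C: "C > 0" "\<And>x. x \<in> X \<Longrightarrow> Lip0_dual_norm X (T x) \<le> C * norm x"
    using bounded_linear_into_Lip0_dual[OF X(1) T_dual T(2,3)] by blast
  obtain lam where lam: "lam \<ge> 1" "pair_lambda_Lipschitz_BAP lam X Y"
    using lipBAP unfolding pair_Lipschitz_BAP_def by blast
  define lam' where "lam' = max 1 (lam * C)"
  have "pair_lambda_BAP lam' X Y"
    unfolding pair_lambda_BAP_def
  proof (intro allI impI, elim conjE)
    fix \<epsilon> :: real and K assume \<epsilon>: "\<epsilon> > 0" and K: "compact K" "K \<subseteq> X"
    \<comment> \<open>The three tolerances: \<open>e1\<close> for the net in \<open>K\<close>, \<open>e2\<close> for the functionals at net points, \<open>e3\<close> for the Lipschitz map.\<close>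
    define e1 where "e1 = \<epsilon> / (2 * (lam' + 1))"
    have lam'1: "lam' \<ge> 1" by (simp add: lam'_def)
    have e1: "e1 > 0" using \<epsilon> lam'1 by (simp add: e1_def)
    obtain A where A: "finite A" "A \<subseteq> K" "K \<subseteq> (\<Union>a\<in>A. ball a e1)"
      using compactE_image[OF K(1), of K "\<lambda>a. ball a e1"] e1 by force
    define e2 where "e2 = \<epsilon> / (4 * (lam + 1))"
    have e2: "e2 > 0" using \<epsilon> lam(1) by (simp add: e2_def)
    \<comment> \<open>Each net point is lifted to a functional, which is replaced by a finite combination of point
      evaluations; Lipschitz approximation is then only needed at the finitely many points involved.\<close>
    define Q where "Q a F c \<longleftrightarrow> finite F \<and> F \<subseteq> X \<and>
        Lip0_dual_norm X (T a - (\<Sum>x\<in>F. c x *\<^sub>R delta X x)) < e2" for a F c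
    have "\<exists>F c. Q a F c" if "a \<in> A" for a
    proof -
      have "T a \<in> lipschitz_free X" using that A K T by blast
      then obtain \<mu> where \<mu>: "\<mu> \<in> span (delta X ` X)" "Lip0_dual_norm X (T a - \<mu>) < e2"
        using e2 unfolding lipschitz_free_in_def by blast
      obtain t r where t: "finite t" "t \<subseteq> delta X ` X" "\<mu> = (\<Sum>a\<in>t. r a *\<^sub>R a)"
        using \<mu>(1) by (auto simp: span_explicit)
      obtain F where F: "F \<subseteq> X" "inj_on (delta X) F" "t = delta X ` F"
        using t(2) unfolding subset_image_inj by blast
      have "finite F" using finite_imageD[of "delta X" F] F t(1) by blast
      moreover have "\<mu> = (\<Sum>x\<in>F. r (delta X x) *\<^sub>R delta X x)"
        unfolding t(3) F(3) sum.reindex[OF F(2)] comp_def ..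
      ultimately have "Q a F (\<lambda>x. r (delta X x))" using F(1) \<mu>(2) unfolding Q_def by blast
      then show ?thesis by blast
    qed
    then have "\<forall>a\<in>A. \<exists>F c. Q a F c" by blast
    from bchoice[OF this] obtain F where "\<forall>a\<in>A. \<exists>c. Q a (F a) c" by blast
    from bchoice[OF this] obtain c where "\<forall>a\<in>A. Q a (F a) (c a)" by blast
    then have F: "\<And>a. a \<in> A \<Longrightarrow> finite (F a)" "\<And>a. a \<in> A \<Longrightarrow> F a \<subseteq> X"
      "\<And>a. a \<in> A \<Longrightarrow> Lip0_dual_norm X (T a - (\<Sum>x\<in>F a. c a x *\<^sub>R delta X x)) < e2"
      unfolding Q_def by blast+
    define M where "M = (\<Sum>a\<in>A. \<Sum>x\<in>F a. \<bar>c a x\<bar>)"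
    have M: "M \<ge> 0" unfolding M_def by (intro sum_nonneg) auto
    define e3 where "e3 = \<epsilon> / (8 * (M + 1))"
    have e3: "e3 > 0" using \<epsilon> M by (simp add: e3_def)
    let ?F = "insert 0 (\<Union>a\<in>A. F a)"
    have "compact ?F" using A(1) F(1) by (intro finite_imp_compact) auto
    moreover have "?F \<subseteq> X" using F(2) X0 by auto
    ultimately obtain S where S: "S ` X \<subseteq> X" "finite_dim_range_on X S" "S ` Y \<subseteq> Y"
        "lipschitz_on lam X S" "\<forall>x\<in>?F. norm (S x - x) \<le> e3"
      using lam(2) e3 unfolding pair_lambda_Lipschitz_BAP_def by metis
    define S0 where "S0 x = S x - S 0" for x
    have S0: "S0 0 = 0" by (simp add: S0_def)
    have S0_lip: "lipschitz_on lam X S0"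
      using S(4) by (auto simp: S0_def lipschitz_on_def dist_norm)
    obtain B where B: "finite B" "B \<subseteq> X" "S0 ` X \<subseteq> span B"
      using finite_dim_range_translate[OF S(2) X(1) S(1)] unfolding S0_def by blast
    have S0_Y: "S0 ` Y \<subseteq> Y" using S(3) X0 Ys by (auto simp: S0_def image_subset_iff intro!: subspace_diff)
    have S0_F: "norm (S0 x - x) \<le> 2 * e3" if "x \<in> ?F" for x
    proof -
      have "S0 x - x = (S x - x) - (S 0 - 0)" by (simp add: S0_def)
      then have "norm (S0 x - x) \<le> norm (S x - x) + norm (S 0 - 0)" by (simp only: norm_triangle_ineq4)
      then show ?thesis using S(5) that by fastforce
    qed
    have lam0: "lam > 0" using lam(1) by simp
    have id_lip: "lipschitz_on 1 X (\<lambda>x. x)" by (auto intro!: lipschitz_onI)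
    note lin = linearization_linear[OF X(1) S0_lip S0 lam0] and lid = linearization_linear[OF X(1) id_lip _ zero_less_one]
    define R where "R x = linearization X S0 (T x)" for x
    have spanX: "span B \<subseteq> X" using B(2) X(1) by (rule span_minimal)
    have R_span: "R ` X \<subseteq> span B"
    proof
      fix v assume "v \<in> R ` X"
      then obtain x where "x \<in> X" "v = R x" by blast
      then show "v \<in> span B"
        using linearization_in_closed_subspace[OF X(1) S0_lip S0 lam0 subset_refl, of "T x" "span B"]
          T(1) B closed_span_finite[OF B(1)] unfolding R_def by blast
    qed
    have R_Y: "R ` Y \<subseteq> Y"
    proof
      fix v assume "v \<in> R ` Y"
      then obtain x where "x \<in> Y" "v = R x" by blast
      then show "v \<in> Y"
        using linearization_in_closed_subspace[OF X(1) S0_lip S0 lam0 Ys(2), of "T x" Y]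
          T(4) Ys Yc S0_Y unfolding R_def by blast
    qed
    have R_lin: "linear_map_on X R"
    proof -
      have "R (x + y) = R x + R y" if "x \<in> X" "y \<in> X" for x y
        using that T(2) lin(1)[of "T x" "T y"] T_dual by (auto simp: linear_map_on_def R_def)
      moreover have "R (k *\<^sub>R x) = k *\<^sub>R R x" if "x \<in> X" for k x
        using that T(2) linearization_scale[OF X(1) S0_lip S0 lam0, of "T x"] T_dual by (auto simp: linear_map_on_def R_def)
      ultimately show ?thesis by (simp add: linear_map_on_def)
    qed
    have R_norm: "norm (R x) \<le> lam' * norm x" if "x \<in> X" for x
    proof -
      have "norm (R x) \<le> lam * Lip0_dual_norm X (T x)"
        unfolding R_def using norm_linearization_le[OF X(1) S0_lip S0 lam0] T_dual that by blast
      also have "\<dots> \<le> lam * (C * norm x)" using C(2)[OF that] lam0 by (intro mult_left_mono) auto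
      also have "\<dots> \<le> lam' * norm x"
        unfolding mult.assoc[symmetric] lam'_def by (intro mult_right_mono) auto
      finally show ?thesis .
    qed
    have R_A: "norm (R a - a) \<le> \<epsilon> / 2" if a: "a \<in> A" for a
    proof -
      let ?\<mu> = "\<Sum>x\<in>F a. c a x *\<^sub>R delta X x"
      let ?\<phi> = "T a - ?\<mu>"
      have aX: "a \<in> X" using a A K by blast
      have \<mu>: "?\<mu> \<in> Lip0_dual X"
        using F(2)[OF a] by (auto intro!: subspace_sum subspace_scale subspace_Lip0_dual delta_in_Lip0_dual[OF X(1)])
      have Ta: "T a \<in> Lip0_dual X" "T a \<in> lipschitz_free X" using T_dual T(1) aX by auto
      have \<phi>: "?\<phi> \<in> Lip0_dual X" using Ta \<mu> by (intro subspace_diff subspace_Lip0_dual)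
      have "a = linearization X (\<lambda>x. x) (T a)"
        using barycentric_map_eq_linearization[OF X(1) \<beta> Ta(2)] \<beta>T aX by simp
      also have "\<dots> = linearization X (\<lambda>x. x) ?\<phi> + (\<Sum>x\<in>F a. c a x *\<^sub>R x)"
        using linearization_sum_delta[OF X(1) id_lip _ zero_less_one F(1)[OF a] F(2)[OF a]] lid(2)[OF _ Ta(1) \<mu>]
        by simp
      finally have a_eq: "a = linearization X (\<lambda>x. x) ?\<phi> + (\<Sum>x\<in>F a. c a x *\<^sub>R x)" .
      have R_eq: "R a = linearization X S0 ?\<phi> + (\<Sum>x\<in>F a. c a x *\<^sub>R S0 x)"
        using linearization_sum_delta[OF X(1) S0_lip S0 lam0 F(1)[OF a] F(2)[OF a]] lin(2)[OF Ta(1) \<mu>]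
        by (simp add: R_def)
      have "norm (\<Sum>x\<in>F a. c a x *\<^sub>R (S0 x - x)) \<le> (\<Sum>x\<in>F a. \<bar>c a x\<bar> * (2 * e3))"
        using a S0_F by (intro sum_norm_le) (auto intro!: mult_left_mono)
      also have "\<dots> = (\<Sum>x\<in>F a. \<bar>c a x\<bar>) * (2 * e3)" by (simp add: sum_distrib_right)
      also have "\<dots> \<le> M * (2 * e3)"
        unfolding M_def using e3 A(1) a
        by (intro mult_right_mono member_le_sum[where f = "\<lambda>a. \<Sum>x\<in>F a. \<bar>c a x\<bar>"]) (auto intro: sum_nonneg)
      also have "\<dots> \<le> \<epsilon> / 4" using M \<epsilon> by (simp add: e3_def field_simps)
      finally have 1: "norm (\<Sum>x\<in>F a. c a x *\<^sub>R (S0 x - x)) \<le> \<epsilon> / 4" .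
      have "norm (linearization X S0 ?\<phi>) + norm (linearization X (\<lambda>x. x) ?\<phi>)
          \<le> lam * Lip0_dual_norm X ?\<phi> + 1 * Lip0_dual_norm X ?\<phi>"
        by (intro add_mono norm_linearization_le[OF X(1) S0_lip S0 lam0 \<phi>] norm_linearization_le[OF X(1) id_lip _ zero_less_one \<phi>]) simp
      also have "\<dots> = (lam + 1) * Lip0_dual_norm X ?\<phi>" by (simp add: algebra_simps)
      also have "\<dots> \<le> (lam + 1) * e2" using F(3)[OF a] lam0 by (intro mult_left_mono) auto
      also have "\<dots> = \<epsilon> / 4" using lam0 by (simp add: e2_def divide_simps)
      finally have 2: "norm (linearization X S0 ?\<phi>) + norm (linearization X (\<lambda>x. x) ?\<phi>) \<le> \<epsilon> / 4" .
      have "R a - a = (linearization X S0 ?\<phi> - linearization X (\<lambda>x. x) ?\<phi>) + (\<Sum>x\<in>F a. c a x *\<^sub>R (S0 x - x))"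
        by (subst a_eq, subst R_eq) (simp add: scaleR_diff_right sum_subtractf)
      then have "norm (R a - a) \<le> norm (linearization X S0 ?\<phi> - linearization X (\<lambda>x. x) ?\<phi>) + norm (\<Sum>x\<in>F a. c a x *\<^sub>R (S0 x - x))"
        by (simp only: norm_triangle_ineq)
      then show ?thesis
        using 1 2 norm_triangle_ineq4[of "linearization X S0 ?\<phi>" "linearization X (\<lambda>x. x) ?\<phi>"] by linarith
    qed
    have "norm (R x - x) \<le> \<epsilon>" if x: "x \<in> K" for x
    proof -
      obtain a where a: "a \<in> A" "dist a x < e1" using A(3) x by auto
      have aX: "a \<in> X" "x \<in> X" "x - a \<in> X" using a A K x X(1) by (auto intro!: subspace_diff)
      have "R ((x - a) + a) = R (x - a) + R a" using R_lin aX unfolding linear_map_on_def by blast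
      then have "R x - x = R (x - a) + (R a - a) + (a - x)" by simp
      then have "norm (R x - x) \<le> norm (R (x - a)) + norm (R a - a) + norm (a - x)"
        by (metis norm_triangle_le norm_triangle_mono order_refl norm_triangle_ineq add_mono_thms_linordered_semiring(3))
      also have "\<dots> \<le> lam' * norm (x - a) + \<epsilon> / 2 + norm (x - a)"
        using R_norm[OF aX(3)] R_A[OF a(1)] by (simp add: norm_minus_commute)
      also have "\<dots> = (lam' + 1) * norm (x - a) + \<epsilon> / 2" by (simp add: algebra_simps)
      also have "\<dots> \<le> (lam' + 1) * e1 + \<epsilon> / 2"
        using a(2) lam'1 by (intro add_right_mono mult_left_mono) (auto simp: dist_norm norm_minus_commute)
      also have "\<dots> = \<epsilon>"
      proof -
        have "(lam' + 1) * e1 = \<epsilon> / 2" using lam'1 by (simp add: e1_def divide_simps)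
        then show ?thesis by simp
      qed
      finally show ?thesis .
    qed
    moreover have "R ` X \<subseteq> X" using R_span spanX by blast
    moreover have "finite_dim_range_on X R" using R_span B unfolding finite_dim_range_on_def by blast
    ultimately show "\<exists>S. S ` X \<subseteq> X \<and> linear_map_on X S \<and> finite_dim_range_on X S \<and>
            (\<forall>x\<in>X. norm (S x) \<le> lam' * norm x) \<and> (\<forall>x\<in>K. norm (S x - x) \<le> \<epsilon>) \<and> S ` Y \<subseteq> Y"
      using R_lin R_norm R_Y by blast
  qed
  then show ?thesis unfolding pair_BAP_def lam'_def by (intro exI[of _ "max 1 (lam * C)"]) simp
qed


section \<open>Completeness of the space of bounded sequences\<close>

text \<open>
  The index set carries the discrete topology but no metric, so that completeness is derived here
  from the uniform Cauchy criterion.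
\<close>

lemma Cauchy_ell_infty_convergent:
  fixes f :: "nat \<Rightarrow> ell_infty"
  assumes "Cauchy f"
  shows "convergent f"
proof -
  have "\<exists>M. \<forall>m n x. M \<le> m \<and> M \<le> n \<and> True \<longrightarrow> dist (apply_bcontfun (f m) x) (apply_bcontfun (f n) x) < e"
    if e: "e > 0" for e
  proof -
    obtain M where "\<forall>m\<ge>M. \<forall>n\<ge>M. dist (f m) (f n) < e" using metric_CauchyD[OF assms e] by blast
    then show ?thesis using dist_bounded le_less_trans by blast
  qed
  then obtain g where "uniform_limit UNIV (\<lambda>n. apply_bcontfun (f n)) g sequentially"
    using uniformly_convergent_eq_cauchy[of "\<lambda>_. True" "\<lambda>n. apply_bcontfun (f n)"]
    unfolding uniform_limit_sequentially_iff by (metis (no_types, lifting))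
  from uniform_limit_bcontfunE[OF this sequentially_bot]
  obtain l where "f \<longlonglongrightarrow> l" by blast
  then show ?thesis by (rule convergentI)
qed

lemma closed_imp_complete_ell_infty:
  fixes S :: "ell_infty set"
  assumes "closed S"
  shows "complete S"
proof (rule completeI)
  fix f assume f: "\<forall>n. f n \<in> S" "Cauchy f"
  then obtain l where l: "f \<longlonglongrightarrow> l" using Cauchy_ell_infty_convergent convergent_def by blast
  then have "l \<in> S" using closed_sequentially[OF assms] f(1) by blast
  then show "\<exists>l\<in>S. f \<longlonglongrightarrow> l" using l by blast
qed


section \<open>Sequences of vectors coded as a single bounded sequence\<close>

definition row :: "nat \<Rightarrow> ell_infty \<Rightarrow> ell_infty" where
  "row m h = Bcontfun (\<lambda>k. apply_bcontfun h (prod_encode (m, k)))"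

text \<open>
  The sequence \<open>f\<close> of bounded sequences becomes one doubly indexed bounded sequence.
  The supremum norm of the sequence of vectors \<open>f\<close> is then the norm of \<open>glue
  f\<close>, provided that \<open>f\<close> is bounded.
\<close>

definition glue :: "(nat \<Rightarrow> ell_infty) \<Rightarrow> ell_infty" where
  "glue f = Bcontfun (\<lambda>j. apply_bcontfun (f (fst (prod_decode j))) (snd (prod_decode j)))"

lemma apply_row: "apply_bcontfun (row m h) k = apply_bcontfun h (prod_encode (m, k))"
proof -
  have "(\<lambda>k. apply_bcontfun h (prod_encode (m, k))) \<in> bcontfun"
    using norm_bounded[of h] by (intro bcontfun_normI) auto
  then show ?thesis unfolding row_def by (subst Bcontfun_inverse) (assumption, rule refl)
qed

lemma norm_row_le: "norm (row m h) \<le> norm h"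
  by (rule norm_bound) (simp only: apply_row norm_bounded)

lemma bounded_linear_row: "bounded_linear (row m)"
  by (rule bounded_linear_intro[where K = 1]) (auto intro!: bcontfun_eqI simp: apply_row norm_row_le)

lemmas row_simps = linear_add[OF bounded_linear.linear[OF bounded_linear_row]]
  linear_diff[OF bounded_linear.linear[OF bounded_linear_row]]
  linear_scale[OF bounded_linear.linear[OF bounded_linear_row]]
  linear_0[OF bounded_linear.linear[OF bounded_linear_row]]
  linear_sum[OF bounded_linear.linear[OF bounded_linear_row]]

lemma norm_le_rows:
  assumes "\<And>m. norm (row m h) \<le> c"
  shows "norm h \<le> c"
proof (rule norm_bound)
  fix j
  obtain m k where j: "j = prod_encode (m, k)" by (metis prod_decode_inverse surj_pair)
  have "norm (apply_bcontfun (row m h) k) \<le> norm (row m h)" by (rule norm_bounded)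
  then show "norm (apply_bcontfun h j) \<le> c" unfolding apply_row j using assms[of m] by linarith
qed

lemma rows_eqI:
  assumes "\<And>m. row m g = row m h"
  shows "g = h"
proof -
  have "norm (g - h) \<le> 0" by (rule norm_le_rows) (simp add: row_simps assms)
  then show ?thesis by simp
qed

lemma row_glue:
  assumes "\<And>m. norm (f m) \<le> c"
  shows "row m (glue f) = f m"
proof (rule bcontfun_eqI)
  fix k
  have "(\<lambda>j. apply_bcontfun (f (fst (prod_decode j))) (snd (prod_decode j))) \<in> bcontfun"
  proof (rule bcontfun_normI)
    show "norm (apply_bcontfun (f (fst (prod_decode j))) (snd (prod_decode j))) \<le> c" for j
      using norm_bounded assms by (rule order_trans)
  qed simp
  then have "apply_bcontfun (glue f) j = apply_bcontfun (f (fst (prod_decode j))) (snd (prod_decode j))" for j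
    unfolding glue_def by (subst Bcontfun_inverse) (assumption, rule refl)
  then show "apply_bcontfun (row m (glue f)) k = apply_bcontfun (f m) k" by (simp add: apply_row)
qed

definition place :: "nat \<Rightarrow> ell_infty \<Rightarrow> ell_infty" where
  "place n v = glue (\<lambda>m. if m = n then v else 0)"

definition tail :: "nat \<Rightarrow> ell_infty \<Rightarrow> ell_infty" where
  "tail n v = glue (\<lambda>m. if n \<le> m then v else 0)"

lemma row_place: "row m (place n v) = (if m = n then v else 0)"
  unfolding place_def by (rule row_glue[where c = "norm v"]) auto

lemma row_tail: "row m (tail n v) = (if n \<le> m then v else 0)"
  unfolding tail_def by (rule row_glue[where c = "norm v"]) auto

lemma linear_place: "linear (place n)"
  by (rule linearI; rule rows_eqI; simp add: row_simps row_place)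

lemma linear_tail: "linear (tail n)"
  by (rule linearI; rule rows_eqI; simp add: row_simps row_tail)

lemma norm_tail_le: "norm (tail n v) \<le> norm v"
  by (rule norm_le_rows) (auto simp: row_tail)


section \<open>The radial retraction onto a ball\<close>

definition radial :: "real \<Rightarrow> 'a::real_normed_vector \<Rightarrow> 'a" where
  "radial r u = (if norm u \<le> r then u else (r / norm u) *\<^sub>R u)"

text \<open>
  The factor \<open>a\<close> is \<open>min 1 (r / norm u)\<close>; the last equation carries no
  division.
\<close>

lemma radial_as_multiple:
  assumes "r \<ge> 0"
  obtains a where "0 \<le> a" "a \<le> 1" "radial r u = a *\<^sub>R u" "a * norm u = min (norm u) r"
proof (cases "norm u \<le> r")
  case True
  then show ?thesis using that[of 1] by (auto simp: radial_def)
next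
  case False
  then have "norm u > 0" using assms by linarith
  then show ?thesis using that[of "r / norm u"] False assms by (auto simp: radial_def)
qed

lemma norm_radial_le: "r \<ge> 0 \<Longrightarrow> norm (radial r u) \<le> norm u"
  by (rule radial_as_multiple[of r u]) (auto simp: min_def)

lemma radial_zero: "radial 0 u = 0"
  by (auto simp: radial_def)

lemma radial_in_subspace: "subspace V \<Longrightarrow> u \<in> V \<Longrightarrow> radial r u \<in> V"
  by (auto simp: radial_def subspace_scale)

text \<open>
  A vector whose norm is close to \<open>r\<close> is moved only a little; this is what makes the
  approximations below converge.
\<close>

lemma norm_diff_radial: "r \<ge> 0 \<Longrightarrow> norm (u - radial r u) \<le> \<bar>norm u - r\<bar>"
proof (cases "norm u \<le> r")
  case False
  assume "r \<ge> 0"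
  then have "norm u > 0" using False by linarith
  have "u - radial r u = (1 - r / norm u) *\<^sub>R u" using False by (simp add: radial_def scaleR_diff_left)
  then have "norm (u - radial r u) = \<bar>1 - r / norm u\<bar> * norm u" by simp
  also have "\<dots> = \<bar>(1 - r / norm u) * norm u\<bar>" by (simp add: abs_mult)
  also have "(1 - r / norm u) * norm u = norm u - r" using \<open>norm u > 0\<close> by (simp add: field_simps)
  finally show ?thesis by simp
qed (simp add: radial_def)

text \<open>
  Write the two sides as \<open>a u\<close> and \<open>b v\<close> with \<open>a \<le> b\<close>,
  say. Then \<open>a u - b v = a (u - v) - (b - a) v\<close>, and \<open>(b - a) * norm v\<close> is
  the difference of \<open>min (norm v) s\<close> and \<open>a * norm v\<close>, where the latter is
  within \<open>norm (u - v)\<close> of \<open>min (norm u) r\<close>.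
\<close>

lemma radial_Lipschitz:
  assumes "r \<ge> 0" "s \<ge> 0"
  shows "norm (radial r u - radial s v) \<le> 3 * norm (u - v) + \<bar>r - s\<bar>"
proof -
  have key: "norm (a *\<^sub>R u - b *\<^sub>R v) \<le> 3 * norm (u - v) + \<bar>r - s\<bar>"
    if "0 \<le> a" "a \<le> b" "b \<le> 1" "a * norm u = min (norm u) r" "b * norm v = min (norm v) s"
    for a b r s :: real and u v :: 'a
  proof -
    have tri: "norm u \<le> norm v + norm (u - v)" "norm v \<le> norm u + norm (u - v)"
      using norm_triangle_sub[of u v] norm_triangle_sub[of v u] by (auto simp: norm_minus_commute)
    have a: "a * norm (u - v) \<le> norm (u - v)" using that mult_right_mono[of a 1 "norm (u - v)"] by simp
    have "a * norm u \<le> a * norm v + a * norm (u - v)"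
      using mult_left_mono[OF tri(1) that(1)] by (simp add: distrib_left)
    moreover have "min (norm v) s - min (norm u) r \<le> norm (u - v) + \<bar>r - s\<bar>"
      using tri by (auto simp: min_def)
    ultimately have "(b - a) * norm v \<le> norm (u - v) + \<bar>r - s\<bar> + norm (u - v)"
      using that a by (simp add: left_diff_distrib)
    moreover have "norm (a *\<^sub>R (u - v) - (b - a) *\<^sub>R v) \<le> a * norm (u - v) + (b - a) * norm v"
      using norm_triangle_ineq4[of "a *\<^sub>R (u - v)" "(b - a) *\<^sub>R v"] that by simp
    then have "norm (a *\<^sub>R u - b *\<^sub>R v) \<le> a * norm (u - v) + (b - a) * norm v" by (simp add: algebra_simps)
    ultimately show ?thesis using a by linarith
  qed
  obtain a where a: "0 \<le> a" "a \<le> 1" "radial r u = a *\<^sub>R u" "a * norm u = min (norm u) r"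
    using radial_as_multiple[OF assms(1)] by blast
  obtain b where b: "0 \<le> b" "b \<le> 1" "radial s v = b *\<^sub>R v" "b * norm v = min (norm v) s"
    using radial_as_multiple[OF assms(2)] by blast
  show ?thesis
  proof (cases "a \<le> b")
    case True
    then show ?thesis using key[of a b u r v s] a b by simp
  next
    case False
    then have "norm (b *\<^sub>R v - a *\<^sub>R u) \<le> 3 * norm (v - u) + \<bar>s - r\<bar>"
      using key[of b a v s u r] a b by simp
    then show ?thesis using a b by (simp add: norm_minus_commute abs_minus_commute)
  qed
qed


section \<open>Separability from finite-dimensional approximation\<close>

text \<open>
  The rational combinations of the finite sets \<open>B n\<close> form a countable dense set.
\<close>

lemma separable_if_approximable:
  fixes X :: "'a::real_normed_vector set" and B :: "nat \<Rightarrow> 'a set"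
  assumes X: "subspace X" and B: "\<And>n. finite (B n)" "\<And>n. B n \<subseteq> X"
    and approx: "\<And>x e. x \<in> X \<Longrightarrow> e > 0 \<Longrightarrow> \<exists>n. \<exists>v\<in>span (B n). norm (v - x) < e"
  shows "separable_space (top_of_set X)"
proof -
  define D where "D = (\<Union>n. (\<lambda>c. \<Sum>b\<in>B n. c b *\<^sub>R b) ` (PiE (B n) (\<lambda>_. \<rat>)))"
  have "countable D"
    unfolding D_def by (intro countable_UN countable_image countable_PiE B countable_rat) auto
  moreover have DX: "D \<subseteq> X"
    unfolding D_def using B X by (auto intro!: subspace_sum subspace_scale)
  moreover have "(top_of_set X) closure_of D = X"
  proof -
    have "x \<in> (top_of_set X) closure_of D" if x: "x \<in> X" for x
      unfolding in_closure_of
    proof (intro conjI allI impI)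
      show "x \<in> topspace (top_of_set X)" using x by simp
      fix T assume "x \<in> T \<and> openin (top_of_set X) T"
      then obtain e where e: "e > 0" "\<forall>x'\<in>X. dist x' x < e \<longrightarrow> x' \<in> T"
        unfolding openin_euclidean_subtopology_iff by blast
      have "e / 2 > 0" using e by simp
      then obtain n v where v: "v \<in> span (B n)" "norm (v - x) < e / 2" using approx[OF x] by blast
      obtain c where c: "v = (\<Sum>b\<in>B n. c b *\<^sub>R b)" using v(1) B(1)[of n] by (auto simp: span_finite)
      define s where "s = (\<Sum>b\<in>B n. norm b)"
      have s: "s \<ge> 0" unfolding s_def by (intro sum_nonneg) auto
      define d where "d = e / (2 * (s + 1))"
      have d: "d > 0" using e s by (simp add: d_def)
      have "\<exists>q\<in>\<rat>. \<bar>q - c b\<bar> < d" for b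
      proof -
        obtain r where "r \<in> \<rat>" "c b - d < r" "r < c b + d"
          using Rats_dense_in_real[of "c b - d" "c b + d"] d by auto
        then show ?thesis by (intro bexI[of _ r]) linarith+
      qed
      then obtain q where q: "\<And>b. q b \<in> \<rat>" "\<And>b. \<bar>q b - c b\<bar> < d" by metis
      define w where "w = (\<Sum>b\<in>B n. restrict q (B n) b *\<^sub>R b)"
      have wD: "w \<in> D" unfolding D_def w_def using q(1) by (intro UN_I[of n] imageI) auto
      have "w - v = (\<Sum>b\<in>B n. (q b - c b) *\<^sub>R b)"
        unfolding w_def c by (simp add: sum_subtractf scaleR_diff_left)
      also have "norm \<dots> \<le> (\<Sum>b\<in>B n. d * norm b)"
        by (intro sum_norm_le) (simp add: mult_right_mono less_imp_le q(2))
      also have "\<dots> = d * s" by (simp add: s_def sum_distrib_left)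
      also have "\<dots> \<le> d * (s + 1)" using d by simp
      also have "\<dots> = e / 2" using s by (simp add: d_def divide_simps)
      finally have "norm (w - v) \<le> e / 2" .
      then have "norm ((w - v) + (v - x)) < e" using v(2) by (intro norm_triangle_lt) simp
      then have "w \<in> T" using e(2) wD DX by (auto simp: dist_norm)
      then show "\<exists>y. y \<in> D \<and> y \<in> T" using wD by blast
    qed
    then show ?thesis using closure_of_subset_topspace[of "top_of_set X" D] by auto
  qed
  ultimately show ?thesis unfolding separable_space_def by (intro exI[of _ D]) simp
qed


section \<open>Convergent sequences along a chain of finite-dimensional spaces\<close>

locale finite_dim_chain =
  fixes C :: "nat \<Rightarrow> ell_infty set"
  assumes finite_C: "finite (C n)" and C_mono: "C n \<subseteq> C (Suc n)"
begin

definition chain_union :: "ell_infty set" where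
  "chain_union = (\<Union>n. span (C n))"

definition conv_seqs :: "ell_infty set" where
  "conv_seqs = {h. (\<forall>m. row m h \<in> span (C m)) \<and> convergent (\<lambda>m. row m h)}"

definition null_seqs :: "ell_infty set" where
  "null_seqs = {h. (\<forall>m. row m h \<in> span (C m)) \<and> (\<lambda>m. row m h) \<longlonglongrightarrow> 0}"

definition seq_lim :: "ell_infty \<Rightarrow> ell_infty" where
  "seq_lim h = lim (\<lambda>m. row m h)"

lemma span_C_mono: "m \<le> n \<Longrightarrow> span (C m) \<subseteq> span (C n)"
  by (rule span_mono, rule lift_Suc_mono_le[of C]) (rule C_mono)

lemma subspace_chain_union: "subspace chain_union"
proof (rule subspaceI)
  show "0 \<in> chain_union" by (auto simp: chain_union_def span_zero)
  fix x y assume "x \<in> chain_union" "y \<in> chain_union"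
  then obtain m n where "x \<in> span (C m)" "y \<in> span (C n)" by (auto simp: chain_union_def)
  then have "x \<in> span (C (max m n))" "y \<in> span (C (max m n))"
    using span_C_mono[of m "max m n"] span_C_mono[of n "max m n"] by auto
  then have "x + y \<in> span (C (max m n))" by (rule span_add)
  then show "x + y \<in> chain_union" by (auto simp: chain_union_def)
qed (auto simp: chain_union_def intro: span_scale)

lemma null_subset_conv: "null_seqs \<subseteq> conv_seqs"
  by (auto simp: null_seqs_def conv_seqs_def convergent_def)

lemma rows_tendsto: "h \<in> conv_seqs \<Longrightarrow> (\<lambda>m. row m h) \<longlonglongrightarrow> seq_lim h"
  by (simp add: conv_seqs_def seq_lim_def convergent_LIMSEQ_iff)

lemma seq_limI: "(\<lambda>m. row m h) \<longlonglongrightarrow> l \<Longrightarrow> seq_lim h = l"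
  by (simp add: seq_lim_def limI)

lemma seq_lim_null: "h \<in> null_seqs \<Longrightarrow> seq_lim h = 0"
  by (rule seq_limI) (simp add: null_seqs_def)

lemma subspace_conv: "subspace conv_seqs"
  by (rule subspaceI)
     (auto simp: conv_seqs_def row_simps span_zero convergent_const intro!: span_add span_scale convergent_add
       bounded_linear.convergent[OF bounded_linear_scaleR_right])

lemma subspace_null: "subspace null_seqs"
proof (rule subspaceI)
  show "0 \<in> null_seqs" by (simp add: null_seqs_def row_simps span_zero)
  show "x + y \<in> null_seqs" if "x \<in> null_seqs" "y \<in> null_seqs" for x y
    using that tendsto_add[of "\<lambda>m. row m x" 0 sequentially "\<lambda>m. row m y" 0]
    by (auto simp: null_seqs_def row_simps intro!: span_add)
  show "c *\<^sub>R x \<in> null_seqs" if "x \<in> null_seqs" for c x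
    using that tendsto_scaleR[OF tendsto_const, of "\<lambda>m. row m x" 0 sequentially c]
    by (auto simp: null_seqs_def row_simps intro!: span_scale)
qed

lemma seq_lim_linear:
  assumes "g \<in> conv_seqs" "h \<in> conv_seqs"
  shows "seq_lim (g + h) = seq_lim g + seq_lim h" "seq_lim (g - h) = seq_lim g - seq_lim h"
    "seq_lim (c *\<^sub>R g) = c *\<^sub>R seq_lim g"
  using rows_tendsto[OF assms(1)] rows_tendsto[OF assms(2)]
  by (auto intro!: seq_limI tendsto_intros simp: row_simps)

lemma norm_seq_lim_le:
  assumes "h \<in> conv_seqs"
  shows "norm (seq_lim h) \<le> norm h"
  by (rule LIMSEQ_le_const2[OF tendsto_norm[OF rows_tendsto[OF assms]]]) (auto simp: norm_row_le)

lemma rows_in_span_closed: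
  assumes "\<And>e. e > 0 \<Longrightarrow> \<exists>g. (\<forall>m. row m g \<in> span (C m)) \<and> norm (g - h) < e"
  shows "row m h \<in> span (C m)"
proof -
  have "\<exists>y\<in>span (C m). dist y (row m h) < e" if e: "e > 0" for e
  proof -
    obtain g where "\<forall>m. row m g \<in> span (C m)" "norm (g - h) < e" using assms[OF e] by blast
    moreover have "dist (row m g) (row m h) \<le> norm (g - h)"
      using norm_row_le[of m "g - h"] by (simp add: row_simps dist_norm)
    ultimately show ?thesis by (intro bexI[of _ "row m g"]) auto
  qed
  then have "row m h \<in> closure (span (C m))" by (simp add: closure_approachable)
  then show ?thesis using closed_span_finite[OF finite_C] by simp
qed

lemma closed_conv: "closed conv_seqs"
  unfolding closure_subset_eq[symmetric]
proof
  fix h assume "h \<in> closure conv_seqs"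
  then have near: "\<exists>g\<in>conv_seqs. norm (g - h) < e" if "e > 0" for e
    using that by (auto simp: closure_approachable dist_norm)
  have "row m h \<in> span (C m)" for m
    using near by (intro rows_in_span_closed) (auto simp: conv_seqs_def)
  moreover have "Cauchy (\<lambda>m. row m h)"
  proof (rule CauchyI)
    fix e :: real assume e: "e > 0"
    then obtain g where g: "g \<in> conv_seqs" "norm (g - h) < e / 3" using near[of "e / 3"] by auto
    have "Cauchy (\<lambda>m. row m g)" using g(1) by (auto simp: conv_seqs_def convergent_Cauchy)
    then obtain M where M: "\<And>m n. m \<ge> M \<Longrightarrow> n \<ge> M \<Longrightarrow> norm (row m g - row n g) < e / 3"
      using e CauchyD[of "\<lambda>m. row m g" "e / 3"] by auto
    have "norm (row m h - row n h) < e" if "m \<ge> M" "n \<ge> M" for m n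
    proof -
      have eq: "row m h - row n h = (row m g - row n g) - row m (g - h) + row n (g - h)"
        by (simp add: row_simps)
      have "norm (row m h - row n h) \<le> norm (row m g - row n g) + norm (row m (g - h)) + norm (row n (g - h))"
        unfolding eq by (rule norm_triangle_le, rule add_right_mono, rule norm_triangle_ineq4)
      then show ?thesis using M[OF that] norm_row_le[of m "g - h"] norm_row_le[of n "g - h"] g(2) by linarith
    qed
    then show "\<exists>M. \<forall>m\<ge>M. \<forall>n\<ge>M. norm (row m h - row n h) < e" by blast
  qed
  ultimately show "h \<in> conv_seqs" by (auto simp: conv_seqs_def intro: Cauchy_ell_infty_convergent)
qed

lemma closed_null: "closed null_seqs"
  unfolding closure_subset_eq[symmetric]
proof
  fix h assume h: "h \<in> closure null_seqs"
  then have hc: "h \<in> conv_seqs"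
    using closed_conv null_subset_conv closure_mono closure_closed by blast
  have "norm (seq_lim h) \<le> 0 + e" if e: "e > 0" for e
  proof -
    obtain g where g: "g \<in> null_seqs" "norm (g - h) < e"
      using h e by (auto simp: closure_approachable dist_norm)
    have gc: "g \<in> conv_seqs" using g(1) null_subset_conv by blast
    have "seq_lim h = seq_lim (h - g)"
      using seq_lim_linear(2)[OF hc gc] seq_lim_null[OF g(1)] by simp
    moreover have "norm (seq_lim (h - g)) \<le> norm (h - g)"
      using hc gc by (intro norm_seq_lim_le subspace_diff subspace_conv)
    ultimately show ?thesis using g(2) by (simp add: norm_minus_commute)
  qed
  then have "norm (seq_lim h) \<le> 0" by (rule field_le_epsilon)
  then show "h \<in> null_seqs" using rows_tendsto[OF hc] hc by (simp add: null_seqs_def conv_seqs_def)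
qed

text \<open>
  The maps of the Lipschitz approximation property: the constant continuation after the term
  \<open>n\<close> is retracted onto the ball of radius \<open>\<parallel>lim h\<parallel>\<close>,
  hence is \<open>0\<close> for null sequences, and is nearly \<open>row n h\<close> when
  \<open>n\<close> is large.
\<close>

definition approx :: "nat \<Rightarrow> ell_infty \<Rightarrow> ell_infty" where
  "approx n h = glue (\<lambda>m. if m \<le> n then row m h else radial (norm (seq_lim h)) (row n h))"

lemma row_approx: "row m (approx n h) = (if m \<le> n then row m h else radial (norm (seq_lim h)) (row n h))"
  unfolding approx_def
  by (rule row_glue[where c = "norm h"]) (auto simp: norm_row_le intro: order_trans[OF norm_radial_le])

definition step_basis :: "nat \<Rightarrow> ell_infty set" where
  "step_basis n = (\<Union>m\<le>n. place m ` C m) \<union> tail (Suc n) ` C n"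

lemma finite_step_basis: "finite (step_basis n)"
  by (auto simp: step_basis_def finite_C)

lemma tail_in_conv:
  assumes "v \<in> span (C n)" "n \<le> k"
  shows "tail k v \<in> conv_seqs"
proof -
  have rows: "row m (tail k v) \<in> span (C m)" for m
    using subsetD[OF span_C_mono[of n m] assms(1)] assms(2) by (simp add: row_tail span_zero)
  have "(\<lambda>m. row m (tail k v)) \<longlonglongrightarrow> v"
    by (rule tendsto_eventually) (auto simp: eventually_sequentially row_tail)
  then show ?thesis
    using rows by (auto simp: conv_seqs_def convergent_def)
qed

lemma place_in_conv:
  assumes "v \<in> span (C m)"
  shows "place m v \<in> conv_seqs"
proof -
  have "(\<lambda>k. row k (place m v)) \<longlonglongrightarrow> 0"
    by (rule tendsto_eventually, rule eventually_mono[OF eventually_gt_at_top[of m]]) (simp add: row_place)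
  then show ?thesis
    using assms by (auto simp: conv_seqs_def convergent_def row_place span_zero)
qed

lemma step_basis_subset: "step_basis n \<subseteq> conv_seqs"
  by (auto simp: step_basis_def intro!: place_in_conv tail_in_conv[of _ n] span_base)

lemma approx_in_span:
  assumes "h \<in> conv_seqs"
  shows "approx n h \<in> span (step_basis n)"
proof -
  let ?v = "radial (norm (seq_lim h)) (row n h)"
  have rows: "row m h \<in> span (C m)" for m using assms by (simp add: conv_seqs_def)
  have "approx n h = (\<Sum>m\<le>n. place m (row m h)) + tail (Suc n) ?v"
  proof (rule rows_eqI)
    fix k
    have "(\<Sum>m\<le>n. row k (place m (row m h))) = (if k \<le> n then row k h else 0)"
      by (simp add: row_place)
    then show "row k (approx n h) = row k ((\<Sum>m\<le>n. place m (row m h)) + tail (Suc n) ?v)"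
      by (simp add: row_simps row_tail row_approx not_le Suc_le_eq)
  qed
  moreover have "place m (row m h) \<in> span (step_basis n)" if "m \<le> n" for m
  proof -
    have "place m (row m h) \<in> span (place m ` C m)"
      using rows linear_span_image[OF linear_place, of m "C m"] by blast
    then show ?thesis using span_mono[of "place m ` C m" "step_basis n"] that by (auto simp: step_basis_def)
  qed
  moreover have "tail (Suc n) ?v \<in> span (step_basis n)"
  proof -
    have "?v \<in> span (C n)" using rows by (intro radial_in_subspace) auto
    then have "tail (Suc n) ?v \<in> span (tail (Suc n) ` C n)"
      using linear_span_image[OF linear_tail, of "Suc n" "C n"] by blast
    then show ?thesis using span_mono[of "tail (Suc n) ` C n" "step_basis n"] by (auto simp: step_basis_def)
  qed
  ultimately show ?thesis by (auto intro!: span_add span_sum)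
qed

lemma approx_in_conv: "h \<in> conv_seqs \<Longrightarrow> approx n h \<in> conv_seqs"
  using approx_in_span span_minimal[OF step_basis_subset subspace_conv] by blast

lemma approx_in_null:
  assumes "h \<in> null_seqs"
  shows "approx n h \<in> null_seqs"
proof -
  have "row m (approx n h) = 0" if "m > n" for m
    using that by (simp add: row_approx seq_lim_null[OF assms] radial_zero)
  then have "(\<lambda>m. row m (approx n h)) \<longlonglongrightarrow> 0"
    by (intro tendsto_eventually) (auto simp: eventually_sequentially intro!: exI[of _ "Suc n"])
  then show ?thesis
    using approx_in_conv[of h n] assms null_subset_conv by (auto simp: null_seqs_def conv_seqs_def)
qed

lemma approx_Lipschitz: "lipschitz_on 4 conv_seqs (approx n)"
proof (rule lipschitz_onI)
  fix g h assume gh: "g \<in> conv_seqs" "h \<in> conv_seqs"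
  have row_le: "norm (row m g - row m h) \<le> norm (g - h)" for m
    using norm_row_le[of m "g - h"] by (simp add: row_simps)
  have "norm (seq_lim (g - h)) \<le> norm (g - h)"
    using gh by (intro norm_seq_lim_le subspace_diff subspace_conv)
  then have lim_le: "\<bar>norm (seq_lim g) - norm (seq_lim h)\<bar> \<le> norm (g - h)"
    using norm_triangle_ineq3[of "seq_lim g" "seq_lim h"] seq_lim_linear(2)[OF gh] by simp
  have "norm (approx n g - approx n h) \<le> 4 * norm (g - h)"
  proof (rule norm_le_rows)
    fix m
    show "norm (row m (approx n g - approx n h)) \<le> 4 * norm (g - h)"
    proof (cases "m \<le> n")
      case True
      then have "norm (row m (approx n g - approx n h)) = norm (row m g - row m h)"
        by (simp add: row_simps row_approx)
      then show ?thesis using row_le[of m] norm_ge_zero[of "g - h"] by linarith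
    next
      case False
      then show ?thesis
        using radial_Lipschitz[of "norm (seq_lim g)" "norm (seq_lim h)" "row n g" "row n h"] row_le[of n] lim_le
        by (simp add: row_simps row_approx)
    qed
  qed
  then show "dist (approx n g) (approx n h) \<le> 4 * dist g h" by (simp add: dist_norm)
qed simp

lemma approx_tendsto:
  assumes h: "h \<in> conv_seqs" and e: "e > 0"
  shows "\<exists>N. \<forall>n\<ge>N. norm (approx n h - h) < e"
proof -
  let ?l = "seq_lim h"
  obtain N where N: "\<And>m. m \<ge> N \<Longrightarrow> norm (row m h - ?l) < e / 4"
    using LIMSEQ_D[OF rows_tendsto[OF h], of "e / 4"] e by auto
  have "norm (approx n h - h) < e" if n: "n \<ge> N" for n
  proof -
    have "norm (approx n h - h) \<le> 3 / 4 * e"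
    proof (rule norm_le_rows)
      fix m
      show "norm (row m (approx n h - h)) \<le> 3 / 4 * e"
      proof (cases "m \<le> n")
        case True
        then show ?thesis using e by (simp add: row_simps row_approx)
      next
        case False
        let ?r = "radial (norm ?l) (row n h)"
        have "norm (row n h - ?r) \<le> \<bar>norm (row n h) - norm ?l\<bar>" by (rule norm_diff_radial) simp
        also have "\<dots> \<le> norm (row n h - ?l)" by (rule norm_triangle_ineq3)
        finally have 1: "norm (row n h - ?r) \<le> norm (row n h - ?l)" .
        have eq: "?r - row m h = (row n h - ?l) - (row n h - ?r) - (row m h - ?l)" by simp
        have "norm (?r - row m h) \<le> norm (row n h - ?l) + norm (row n h - ?r) + norm (row m h - ?l)"
          unfolding eq by (rule norm_triangle_le_diff, rule add_right_mono, rule norm_triangle_ineq4)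
        then have "norm (?r - row m h) \<le> 3 / 4 * e"
          using 1 N[OF n] N[of m] n False by simp
        then show ?thesis using False by (simp add: row_simps row_approx)
      qed
    qed
    then show ?thesis using e by simp
  qed
  then show ?thesis by blast
qed

lemma banach_conv: "banach_on conv_seqs"
  using subspace_conv closed_conv by (simp add: banach_on_def closed_imp_complete_ell_infty)

lemma closed_subspace_null: "closed_subspace_of conv_seqs null_seqs"
  using subspace_null null_subset_conv closed_null
  by (auto simp: closed_subspace_of_def intro: closed_subset)

lemma separable_conv: "separable_space (top_of_set conv_seqs)"
proof (rule separable_if_approximable[OF subspace_conv finite_step_basis step_basis_subset])
  fix h e assume h: "h \<in> conv_seqs" "(e::real) > 0"
  then obtain N where "norm (approx N h - h) < e" using approx_tendsto by blast
  then show "\<exists>n. \<exists>v\<in>span (step_basis n). norm (v - h) < e" using approx_in_span[OF h(1)] by blast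
qed

lemma Lipschitz_BAP: "pair_Lipschitz_BAP conv_seqs null_seqs"
proof -
  have "pair_lambda_Lipschitz_BAP 4 conv_seqs null_seqs"
    unfolding pair_lambda_Lipschitz_BAP_def
  proof (intro allI impI, elim conjE)
    fix \<epsilon> :: real and K assume \<epsilon>: "\<epsilon> > 0" and K: "compact K" "K \<subseteq> conv_seqs"
    \<comment> \<open>At a point within \<open>e\<close> of the net the error is at most \<open>4 * e + e + e\<close>.\<close>
    define e where "e = \<epsilon> / 10"
    have e: "e > 0" using \<epsilon> by (simp add: e_def)
    obtain A where A: "finite A" "A \<subseteq> K" "K \<subseteq> (\<Union>a\<in>A. ball a e)"
      using compactE_image[OF K(1), of K "\<lambda>a. ball a e"] e by force
    have "\<exists>N. \<forall>n\<ge>N. norm (approx n a - a) < e" if "a \<in> A" for a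
    proof -
      have "a \<in> conv_seqs" using that A(2) K(2) by blast
      then show ?thesis using e by (rule approx_tendsto)
    qed
    then obtain N where N: "\<And>a n. a \<in> A \<Longrightarrow> n \<ge> N a \<Longrightarrow> norm (approx n a - a) < e" by metis
    define n where "n = Max (insert 0 (N ` A))"
    have n: "n \<ge> N a" if "a \<in> A" for a using A(1) that by (simp add: n_def)
    have "norm (approx n x - x) \<le> \<epsilon>" if x: "x \<in> K" for x
    proof -
      obtain a where a: "a \<in> A" "dist a x < e" using A(3) x by auto
      have "dist (approx n x) (approx n a) \<le> 4 * dist x a"
        using lipschitz_onD[OF approx_Lipschitz] x a A(2) K(2) by blast
      then have 1: "norm (approx n x - approx n a) \<le> 4 * e" using a(2) by (simp add: dist_norm norm_minus_commute)
      have 2: "norm (approx n a - a) \<le> e" using N[OF a(1) n[OF a(1)]] by simp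
      have eq: "approx n x - x = (approx n x - approx n a) + (approx n a - a) + (a - x)" by simp
      have "norm (approx n x - x) \<le> norm (approx n x - approx n a) + norm (approx n a - a) + norm (a - x)"
        unfolding eq by (rule norm_triangle_le, rule add_right_mono, rule norm_triangle_ineq)
      then show ?thesis using 1 2 a(2) \<epsilon> by (simp add: dist_norm e_def)
    qed
    moreover have "finite_dim_range_on conv_seqs (approx n)"
      unfolding finite_dim_range_on_def
      by (intro exI[of _ "step_basis n"] conjI finite_step_basis step_basis_subset image_subsetI approx_in_span)
    ultimately show "\<exists>S. S ` conv_seqs \<subseteq> conv_seqs \<and> finite_dim_range_on conv_seqs S \<and> S ` null_seqs \<subseteq> null_seqs \<and>
            lipschitz_on 4 conv_seqs S \<and> (\<forall>x\<in>K. norm (S x - x) \<le> \<epsilon>)"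
      by (intro exI[of _ "approx n"] conjI image_subsetI approx_in_conv approx_in_null approx_Lipschitz) simp_all
  qed
  then show ?thesis unfolding pair_Lipschitz_BAP_def by (intro exI[of _ 4]) simp
qed

text \<open>
  A right inverse of the limit map on the union of the chain. The first terms are replaced by
  \<open>0\<close> because \<open>z\<close> does not belong to the first spaces of the chain. The
  resulting map is not linear, but it is linear modulo null sequences.
\<close>

definition lift_const :: "ell_infty \<Rightarrow> ell_infty" where
  "lift_const z = tail (LEAST n. z \<in> span (C n)) z"

lemma lift_const:
  assumes "z \<in> chain_union"
  shows "lift_const z \<in> conv_seqs" "seq_lim (lift_const z) = z" "norm (lift_const z) \<le> norm z"
proof -
  obtain n where "z \<in> span (C n)" using assms by (auto simp: chain_union_def)
  then have z: "z \<in> span (C (LEAST n. z \<in> span (C n)))" by (rule LeastI)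
  show "lift_const z \<in> conv_seqs" unfolding lift_const_def by (rule tail_in_conv[OF z order_refl])
  show "seq_lim (lift_const z) = z" unfolding lift_const_def
    by (intro seq_limI tendsto_eventually) (auto simp: eventually_sequentially row_tail)
  show "norm (lift_const z) \<le> norm z" unfolding lift_const_def by (rule norm_tail_le)
qed

lemma conv_lim_zero_null: "h \<in> conv_seqs \<Longrightarrow> seq_lim h = 0 \<Longrightarrow> h \<in> null_seqs"
  using rows_tendsto[of h] by (simp add: null_seqs_def conv_seqs_def)

lemma seq_lim_in_closure: "h \<in> conv_seqs \<Longrightarrow> seq_lim h \<in> closure chain_union"
  using rows_tendsto[of h] unfolding closure_sequential
  by (intro exI[of _ "\<lambda>m. row m h"]) (auto simp: conv_seqs_def chain_union_def)

lemma seq_lim_span: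
  assumes "B \<subseteq> conv_seqs" "v \<in> span B"
  shows "seq_lim v \<in> span (seq_lim ` B)"
proof -
  have "v \<in> conv_seqs \<and> seq_lim v \<in> span (seq_lim ` B)"
    using assms(2)
  proof (induction rule: span_induct_alt)
    case base
    have "seq_lim 0 = 0" by (rule seq_limI) (simp add: row_simps)
    then show ?case using subspace_0[OF subspace_conv] by (simp add: span_zero)
  next
    case (step c x y)
    have x: "x \<in> conv_seqs" "c *\<^sub>R x \<in> conv_seqs"
      using step(1) assms(1) subspace_scale[OF subspace_conv] by auto
    have "seq_lim (c *\<^sub>R x + y) = c *\<^sub>R seq_lim x + seq_lim y"
      using seq_lim_linear(1)[OF x(2)] seq_lim_linear(3)[OF x(1) x(1)] step(2) by simp
    moreover have "c *\<^sub>R seq_lim x \<in> span (seq_lim ` B)" using step(1) by (intro span_scale span_base) simp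
    ultimately show ?case
      using step(2) x subspace_add[OF subspace_conv] by (simp add: span_add)
  qed
  then show ?thesis by blast
qed

text \<open>
  The map induced on the quotient by the null sequences. It is only needed on the algebraic union of
  the chain, and takes its values in the closure.
\<close>

lemma BAP_passes_to_quotient:
  assumes BAP: "pair_lambda_BAP lam conv_seqs null_seqs" and F: "finite F" "F \<subseteq> chain_union" and \<epsilon>: "\<epsilon> > 0"
  obtains T B where "linear_map_on chain_union T" "finite B" "B \<subseteq> closure chain_union"
    "T ` chain_union \<subseteq> span B" "\<And>z. z \<in> chain_union \<Longrightarrow> norm (T z) \<le> lam * norm z"
    "\<And>z. z \<in> F \<Longrightarrow> norm (T z - z) \<le> \<epsilon>"
proof -
  let ?K = "lift_const ` F"
  have K: "compact ?K" "?K \<subseteq> conv_seqs" using F lift_const(1) by (auto intro: finite_imp_compact)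
  obtain S where S: "S ` conv_seqs \<subseteq> conv_seqs" "linear_map_on conv_seqs S"
      "finite_dim_range_on conv_seqs S" "\<forall>x\<in>conv_seqs. norm (S x) \<le> lam * norm x"
      "\<forall>x\<in>?K. norm (S x - x) \<le> \<epsilon>" "S ` null_seqs \<subseteq> null_seqs"
    using BAP[unfolded pair_lambda_BAP_def, THEN spec, THEN mp, OF \<epsilon>, THEN spec, THEN mp, OF conjI[OF K]]
    by (elim exE conjE) (rule that)
  obtain B0 where B0: "finite B0" "B0 \<subseteq> conv_seqs" "S ` conv_seqs \<subseteq> span B0"
    using S(3) unfolding finite_dim_range_on_def by (elim exE conjE) (rule that)
  have Sadd: "S (g + h) = S g + S h" if "g \<in> conv_seqs" "h \<in> conv_seqs" for g h
    using S(2) that unfolding linear_map_on_def by blast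
  have Sscale: "S (c *\<^sub>R h) = c *\<^sub>R S h" if "h \<in> conv_seqs" for c h
    using S(2) that unfolding linear_map_on_def by blast
  have Sin: "S h \<in> conv_seqs" if "h \<in> conv_seqs" for h using S(1) that by blast
  \<comment> \<open>\<open>S\<close> preserves the null sequences, so the limit of \<open>S h\<close> depends only on the limit of \<open>h\<close>.\<close>
  have same_lim: "seq_lim (S g) = seq_lim (S h)"
    if "g \<in> conv_seqs" "h \<in> conv_seqs" "seq_lim g = seq_lim h" for g h
  proof -
    have d: "g - h \<in> conv_seqs" using that by (intro subspace_diff subspace_conv)
    have "g - h \<in> null_seqs" using d that seq_lim_linear(2)[of g h] by (intro conv_lim_zero_null) auto
    then have "S (g - h) \<in> null_seqs" using S(6) by blast
    then have "seq_lim (S (g - h)) = 0" by (rule seq_lim_null)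
    moreover have "S (h + (g - h)) = S h + S (g - h)" using that d by (intro Sadd)
    ultimately show ?thesis using seq_lim_linear(1)[OF Sin[OF that(2)] Sin[OF d]] by simp
  qed
  define T where "T z = seq_lim (S (lift_const z))" for z
  note W = subspace_chain_union
  have "linear_map_on chain_union T"
    unfolding linear_map_on_def
  proof (intro conjI ballI allI)
    fix x y assume xy: "x \<in> chain_union" "y \<in> chain_union"
    have l: "lift_const x \<in> conv_seqs" "lift_const y \<in> conv_seqs" using xy lift_const(1) by auto
    have "T (x + y) = seq_lim (S (lift_const x + lift_const y))"
      unfolding T_def
      using l lift_const[OF subspace_add[OF W xy]] lift_const(2)[OF xy(1)] lift_const(2)[OF xy(2)]
      by (intro same_lim subspace_add[OF subspace_conv]) (auto simp: seq_lim_linear)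
    then show "T (x + y) = T x + T y" by (simp add: T_def Sadd[OF l] seq_lim_linear(1)[OF Sin[OF l(1)] Sin[OF l(2)]])
  next
    fix c x assume x: "x \<in> chain_union"
    have l: "lift_const x \<in> conv_seqs" using x lift_const(1) by auto
    have "T (c *\<^sub>R x) = seq_lim (S (c *\<^sub>R lift_const x))"
      unfolding T_def
      using l lift_const[OF subspace_scale[OF W x]] lift_const(2)[OF x]
      by (intro same_lim subspace_scale[OF subspace_conv]) (auto simp: seq_lim_linear(3)[OF l l])
    then show "T (c *\<^sub>R x) = c *\<^sub>R T x"
      by (simp add: T_def Sscale[OF l] seq_lim_linear(3)[OF Sin[OF l] Sin[OF l]])
  qed
  moreover have "finite (seq_lim ` B0)" using B0 by simp
  moreover have "seq_lim ` B0 \<subseteq> closure chain_union" using B0 seq_lim_in_closure by blast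
  moreover have "T ` chain_union \<subseteq> span (seq_lim ` B0)"
    using seq_lim_span[OF B0(2)] B0(3) lift_const(1) by (auto simp: T_def)
  moreover have "norm (T z) \<le> lam * norm z" if z: "z \<in> chain_union" for z
  proof (cases "z = 0")
    case True
    have "lift_const 0 = 0" using lift_const(3)[of 0] subspace_0[OF W] by simp
    moreover have "S 0 = 0" using Sscale[OF subspace_0[OF subspace_conv], of 0] by simp
    moreover have "seq_lim 0 = 0" by (rule seq_limI) (simp add: row_simps)
    ultimately show ?thesis using True by (simp add: T_def)
  next
    case False
    have l: "lift_const z \<in> conv_seqs" using z lift_const(1) by auto
    have bound: "norm (S (lift_const z)) \<le> lam * norm (lift_const z)" using S(4) l by blast
    have n: "norm (lift_const z) = norm z"
      using norm_seq_lim_le[OF l] lift_const(2,3)[OF z] by simp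
    show ?thesis unfolding T_def using norm_seq_lim_le[OF Sin[OF l]] bound n by simp
  qed
  moreover have "norm (T z - z) \<le> \<epsilon>" if z: "z \<in> F" for z
  proof -
    have l: "lift_const z \<in> conv_seqs" "z \<in> chain_union" using z F lift_const(1) by auto
    have "T z - z = seq_lim (S (lift_const z) - lift_const z)"
      using seq_lim_linear(2)[OF Sin[OF l(1)] l(1)] lift_const(2)[OF l(2)] by (simp add: T_def)
    also have "norm \<dots> \<le> norm (S (lift_const z) - lift_const z)"
      using l Sin by (intro norm_seq_lim_le subspace_diff subspace_conv) auto
    also have "\<dots> \<le> \<epsilon>" using S(5) z by blast
    finally show ?thesis .
  qed
  ultimately show ?thesis by (rule that)
qed

end


section \<open>Sign choices and a trace inequality\<close>

text \<open>
  Averaging over all signs turns the double sum into the trace, so some choice does at least as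
  well. Signs are found one at a time: the sign of a new index multiplies the sum \<open>X\<close>
  of its cross terms and is chosen to make this product nonnegative.
\<close>

lemma exists_signs_trace_le:
  fixes M :: "'i \<Rightarrow> 'i \<Rightarrow> real"
  assumes "finite A"
  shows "\<exists>\<theta>. (\<forall>i. \<theta> i = 1 \<or> \<theta> i = -1) \<and> (\<Sum>i\<in>A. M i i) \<le> (\<Sum>i\<in>A. \<Sum>j\<in>A. \<theta> i * \<theta> j * M i j)"
  using assms
proof (induction A)
  case empty
  show ?case by (intro exI[of _ "\<lambda>_. 1"]) simp
next
  case (insert a A)
  then obtain \<theta> where \<theta>: "\<forall>i. \<theta> i = 1 \<or> \<theta> i = -1" "(\<Sum>i\<in>A. M i i) \<le> (\<Sum>i\<in>A. \<Sum>j\<in>A. \<theta> i * \<theta> j * M i j)"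
    by blast
  define X where "X = (\<Sum>j\<in>A. \<theta> j * M a j) + (\<Sum>i\<in>A. \<theta> i * M i a)"
  define s :: real where "s = (if X \<ge> 0 then 1 else -1)"
  have s: "s = 1 \<or> s = -1" "s * s = 1" "s * X \<ge> 0" by (auto simp: s_def)
  let ?\<theta> = "\<theta>(a := s)"
  have eq: "?\<theta> i = \<theta> i" if "i \<in> A" for i using that insert.hyps by auto
  have row: "(\<Sum>j\<in>insert a A. ?\<theta> i * ?\<theta> j * M i j) = s * (\<theta> i * M i a) + (\<Sum>j\<in>A. \<theta> i * \<theta> j * M i j)"
    if "i \<in> A" for i
  proof -
    have "(\<Sum>j\<in>A. ?\<theta> i * ?\<theta> j * M i j) = (\<Sum>j\<in>A. \<theta> i * \<theta> j * M i j)"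
      using that by (intro sum.cong) (simp_all add: eq del: fun_upd_apply)
    then show ?thesis using insert.hyps eq[OF that] by simp
  qed
  have row_a: "(\<Sum>j\<in>insert a A. ?\<theta> a * ?\<theta> j * M a j) = M a a + s * (\<Sum>j\<in>A. \<theta> j * M a j)"
  proof -
    have "(\<Sum>j\<in>A. ?\<theta> a * ?\<theta> j * M a j) = (\<Sum>j\<in>A. s * (\<theta> j * M a j))"
      using insert.hyps by (intro sum.cong) auto
    then show ?thesis using insert.hyps s(2) by (simp add: sum_distrib_left)
  qed
  have "(\<Sum>i\<in>insert a A. \<Sum>j\<in>insert a A. ?\<theta> i * ?\<theta> j * M i j)
      = (\<Sum>j\<in>insert a A. ?\<theta> a * ?\<theta> j * M a j) + (\<Sum>i\<in>A. \<Sum>j\<in>insert a A. ?\<theta> i * ?\<theta> j * M i j)"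
    using insert.hyps by simp
  also have "(\<Sum>i\<in>A. \<Sum>j\<in>insert a A. ?\<theta> i * ?\<theta> j * M i j)
      = (\<Sum>i\<in>A. s * (\<theta> i * M i a) + (\<Sum>j\<in>A. \<theta> i * \<theta> j * M i j))"
    by (intro sum.cong refl row)
  also have "\<dots> = s * (\<Sum>i\<in>A. \<theta> i * M i a) + (\<Sum>i\<in>A. \<Sum>j\<in>A. \<theta> i * \<theta> j * M i j)"
    by (simp add: sum.distrib sum_distrib_left)
  finally have "(\<Sum>i\<in>insert a A. \<Sum>j\<in>insert a A. ?\<theta> i * ?\<theta> j * M i j)
      = M a a + s * X + (\<Sum>i\<in>A. \<Sum>j\<in>A. \<theta> i * \<theta> j * M i j)"
    unfolding row_a X_def by (simp add: distrib_left)
  moreover have "(\<Sum>i\<in>insert a A. M i i) = M a a + (\<Sum>i\<in>A. M i i)" using insert.hyps by simp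
  ultimately have "(\<Sum>i\<in>insert a A. M i i) \<le> (\<Sum>i\<in>insert a A. \<Sum>j\<in>insert a A. ?\<theta> i * ?\<theta> j * M i j)"
    using \<theta>(2) s(3) by linarith
  moreover have "\<forall>i. ?\<theta> i = 1 \<or> ?\<theta> i = -1" using \<theta>(1) s(1) by auto
  ultimately show ?case by blast
qed


section \<open>A coloured binary tree\<close>

text \<open>
  A node \<open>(n, S)\<close> with \<open>S \<subseteq> {..<n}\<close> is the vertex at level
  \<open>n\<close> of the binary tree whose path from the root turns right exactly at the steps
  \<open>i \<in> S\<close>. Its children are \<open>(n + 1, S)\<close> and \<open>(n + 1, insert n
  S)\<close>.
\<close>

type_synonym node = "nat \<times> nat set"

definition nodes :: "node set" where
  "nodes = {(n, S). S \<subseteq> {..<n}}"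

text \<open>
  The level modulo \<open>3\<close> together with the last two turns of the path. Nodes on
  neighbouring levels, and distinct nodes with the same grandparent, have different colours.
\<close>

definition color :: "nat \<Rightarrow> nat set \<Rightarrow> nat" where
  "color n S = 4 * (n mod 3) + 2 * of_bool (n - 1 \<in> S) + of_bool (n - 2 \<in> S)"

definition free_bits :: "nat \<Rightarrow> nat \<Rightarrow> nat set" where
  "free_bits n t = {i. i + 2 < n \<and> i mod 12 = t}"

text \<open>
  Two nodes are in the same class when their keys agree: they have the same level and colour, and
  their paths differ only at steps that are congruent modulo \<open>12\<close> to the colour and
  precede the last two. Thus classes of different colours vary in disjoint sets of steps, and the
  class of a node at level \<open>n + 2\<close> has at least \<open>2 ^ (n div 12)\<close> elements.
\<close>

fun key :: "node \<Rightarrow> nat \<times> nat \<times> nat set" where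
  "key (n, S) = (n, color n S, S - free_bits n (color n S))"

text \<open>
  Szankowski's vector \<open>x\<^sub>2\<^sub>i - x\<^sub>2\<^sub>i\<^sub>+\<^sub>1 +
  x\<^sub>4\<^sub>i + x\<^sub>4\<^sub>i\<^sub>+\<^sub>1 + x\<^sub>4\<^sub>i\<^sub>+\<^sub>2 +
  x\<^sub>4\<^sub>i\<^sub>+\<^sub>3\<close>, with the indices \<open>2i, 2i + 1\<close> and
  \<open>4i, \<dots>, 4i + 3\<close> replaced by the children and the grandchildren of \<open>(n,
  S)\<close>.
\<close>

definition zvec :: "nat \<Rightarrow> nat set \<Rightarrow> node \<Rightarrow> real" where
  "zvec n S i = of_bool (i = (n + 1, S)) - of_bool (i = (n + 1, insert n S))
     + of_bool (i = (n + 2, S)) + of_bool (i = (n + 2, insert n S))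
     + of_bool (i = (n + 2, insert (n + 1) S)) + of_bool (i = (n + 2, insert (n + 1) (insert n S)))"

definition bit_sign :: "nat \<Rightarrow> nat set \<Rightarrow> real" where
  "bit_sign n V = (if n \<in> V then -1 else 1)"

text \<open>
  For \<open>V\<close> at level \<open>n + 2\<close>: the signed vector of the parent minus the
  vector of the grandparent. Both have coefficient \<open>1\<close> at \<open>V\<close>, which
  therefore cancels.
\<close>

definition yvec :: "nat \<Rightarrow> nat set \<Rightarrow> node \<Rightarrow> real" where
  "yvec n V i = bit_sign (n + 1) V * zvec (n + 1) (V \<inter> {..<n + 1}) i - zvec n (V \<inter> {..<n}) i"

lemma color_lt: "color n S < 12"
proof -
  have "n mod 3 < 3" by simp
  then have "n mod 3 \<le> 2" by linarith
  then show ?thesis by (simp add: color_def of_bool_def)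
qed

lemma color_level:
  assumes "color n S = color m U"
  shows "n mod 3 = m mod 3"
proof -
  have "color k W div 4 = k mod 3" for k W
    by (cases "k - 1 \<in> W"; cases "k - 2 \<in> W") (simp_all add: color_def)
  then show ?thesis using assms by metis
qed

lemma color_bits:
  assumes "color n S = color n U"
  shows "n - 1 \<in> S \<longleftrightarrow> n - 1 \<in> U" "n - 2 \<in> S \<longleftrightarrow> n - 2 \<in> U"
proof -
  have "2 * of_bool (n - 1 \<in> S) + of_bool (n - 2 \<in> S) = (2 * of_bool (n - 1 \<in> U) + of_bool (n - 2 \<in> U) :: nat)"
    using assms by (simp add: color_def)
  then show "n - 1 \<in> S \<longleftrightarrow> n - 1 \<in> U" "n - 2 \<in> S \<longleftrightarrow> n - 2 \<in> U"
    by (cases "n - 1 \<in> S"; cases "n - 1 \<in> U"; cases "n - 2 \<in> S"; cases "n - 2 \<in> U"; simp)+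
qed

lemma zvec_support:
  assumes "zvec n S (m, U) \<noteq> 0" "S \<subseteq> {..<n}"
  shows "m = n + 1 \<or> m = n + 2" "U \<inter> {..<n} = S" "U \<subseteq> {..<m}"
proof -
  have "S \<subseteq> U \<and> ((m = n + 1 \<and> U \<subseteq> insert n S) \<or> (m = n + 2 \<and> U \<subseteq> insert (n + 1) (insert n S)))"
  proof (cases "m = n + 1")
    case True
    then show ?thesis
      using assms(1) by (cases "U = S"; cases "U = insert n S")
        (simp_all add: zvec_def subset_insertI subset_insertI2)
  next
    case False
    then show ?thesis
      using assms(1) by (cases "m = n + 2"; cases "U = S"; cases "U = insert n S"; cases "U = insert (n + 1) S";
        cases "U = insert (n + 1) (insert n S)")
        (simp_all add: zvec_def subset_insertI subset_insertI2)
  qed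
  then have SU: "S \<subseteq> U" and m: "(m = n + 1 \<and> U \<subseteq> insert n S) \<or> (m = n + 2 \<and> U \<subseteq> insert (n + 1) (insert n S))"
    by simp_all
  from m show "m = n + 1 \<or> m = n + 2" by argo
  have U: "U \<subseteq> insert (n + 1) (insert n S)" using m by (elim disjE conjE) (simp_all add: subset_insertI2)
  show "U \<inter> {..<n} = S"
  proof
    show "U \<inter> {..<n} \<subseteq> S" using U by fastforce
    show "S \<subseteq> U \<inter> {..<n}" using SU assms(2) by simp
  qed
  from m show "U \<subseteq> {..<m}"
  proof
    assume h: "m = n + 1 \<and> U \<subseteq> insert n S"
    have "insert n S \<subseteq> {..<m}" using assms(2) h by fastforce
    then show ?thesis using h order_trans by blast
  next
    assume h: "m = n + 2 \<and> U \<subseteq> insert (n + 1) (insert n S)"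
    have "insert (n + 1) (insert n S) \<subseteq> {..<m}" using assms(2) h by fastforce
    then show ?thesis using h order_trans by blast
  qed
qed

lemma distinct_extensions:
  fixes n :: nat
  assumes "n \<notin> S" "n + 1 \<notin> S"
  shows "insert n S \<noteq> S" "insert (n + 1) S \<noteq> S" "insert (n + 1) (insert n S) \<noteq> S"
    "insert (n + 1) S \<noteq> insert n S" "insert (n + 1) (insert n S) \<noteq> insert n S"
    "insert (n + 1) (insert n S) \<noteq> insert (n + 1) S"
proof -
  have "n + 1 \<noteq> n" "n \<noteq> n + 1" by simp_all
  with assms show "insert n S \<noteq> S" "insert (n + 1) S \<noteq> S" "insert (n + 1) (insert n S) \<noteq> S"
    "insert (n + 1) S \<noteq> insert n S" "insert (n + 1) (insert n S) \<noteq> insert n S"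
    "insert (n + 1) (insert n S) \<noteq> insert (n + 1) S" by blast+
qed

lemma zvec_grandchild:
  assumes "V \<subseteq> {..<n + 2}"
  shows "zvec n (V \<inter> {..<n}) (n + 2, V) = 1"
proof -
  define S where "S = V \<inter> {..<n}"
  have S: "n \<notin> S" "n + 1 \<notin> S" by (simp_all add: S_def)
  note ne = distinct_extensions[OF S]
  have V: "V = S \<union> (V \<inter> {n}) \<union> (V \<inter> {n + 1})"
  proof -
    have "{..<n + 2} = {..<n} \<union> {n} \<union> {n + 1}" by auto
    then show ?thesis using assms unfolding S_def by blast
  qed
  have "V = S \<or> V = insert n S \<or> V = insert (n + 1) S \<or> V = insert (n + 1) (insert n S)"
    using V by (cases "n \<in> V"; cases "n + 1 \<in> V") (simp_all add: insert_commute)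
  then have "zvec n S (n + 2, V) = 1"
    by (elim disjE; hypsubst) (simp_all add: zvec_def ne ne[symmetric] del: One_nat_def add_Suc_right)
  then show ?thesis by (simp add: S_def)
qed

lemma zvec_child:
  assumes "V \<subseteq> {..<n + 1}"
  shows "zvec n (V \<inter> {..<n}) (n + 1, V) = bit_sign n V"
proof -
  define S where "S = V \<inter> {..<n}"
  have S: "n \<notin> S" by (simp add: S_def)
  have V: "V = S \<union> (V \<inter> {n})"
  proof -
    have "{..<n + 1} = {..<n} \<union> {n}" by auto
    then show ?thesis using assms unfolding S_def by blast
  qed
  have "insert n S \<noteq> S" using S by blast
  moreover have "V = (if n \<in> V then insert n S else S)" using V by (cases "n \<in> V") simp_all
  ultimately have "zvec n S (n + 1, V) = bit_sign n V" by (cases "n \<in> V") (simp_all add: zvec_def bit_sign_def)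
  then show ?thesis by (simp add: S_def)
qed

lemma yvec_diagonal:
  assumes "V \<subseteq> {..<n + 2}"
  shows "yvec n V (n + 2, V) = 0"
proof -
  have "zvec (n + 1) (V \<inter> {..<n + 1}) (n + 2, V) = bit_sign (n + 1) V"
    using zvec_child[of V "n + 1"] assms by (simp add: numeral_2_eq_2)
  then show ?thesis using zvec_grandchild[OF assms] by (simp add: yvec_def bit_sign_def)
qed

text \<open>
  Every node \<open>u\<close> in the support of \<open>y\<^sub>V\<close> shares with
  \<open>V\<close> all but the last steps of the path, and has another colour: it is on an adjacent
  level, or it is a different node with the same grandparent. For the second case it matters that
  \<open>V\<close> is not in the support.
\<close>

lemma yvec_support:
  assumes "yvec n V (m, U) \<noteq> 0" "V \<subseteq> {..<n + 2}"
  shows "U \<inter> {..<n} = V \<inter> {..<n}" "color m U \<noteq> color (n + 2) V"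
proof -
  have "zvec (n + 1) (V \<inter> {..<n + 1}) (m, U) \<noteq> 0 \<or> zvec n (V \<inter> {..<n}) (m, U) \<noteq> 0"
    using assms(1) by (auto simp: yvec_def)
  then have *: "((m = n + 2 \<or> m = n + 3) \<and> U \<inter> {..<n + 1} = V \<inter> {..<n + 1} \<and> U \<subseteq> {..<m}) \<or>
      ((m = n + 1 \<or> m = n + 2) \<and> U \<inter> {..<n} = V \<inter> {..<n} \<and> U \<subseteq> {..<m})"
    using zvec_support[of "n + 1" "V \<inter> {..<n + 1}" m U] zvec_support[of n "V \<inter> {..<n}" m U] by auto
  have sub: "{..<n} = {..<n + 1} \<inter> {..<n}" by auto
  show low: "U \<inter> {..<n} = V \<inter> {..<n}"
    using * by (metis sub inf_assoc)
  show "color m U \<noteq> color (n + 2) V"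
  proof
    assume c: "color m U = color (n + 2) V"
    have "m = n + 1 \<or> m = n + 2 \<or> m = n + 3" using * by argo
    moreover have "(n + 1) mod 3 \<noteq> (n + 2) mod 3" "(n + 3) mod 3 \<noteq> (n + 2) mod 3"
      by (simp_all add: mod_Suc numeral_2_eq_2)
    ultimately have "m = n + 2" using color_level[OF c] by metis
    then have c': "color (n + 2) U = color (n + 2) V" and Us: "U \<subseteq> {..<n + 2}" using c * by auto
    have bits: "n + 1 \<in> U \<longleftrightarrow> n + 1 \<in> V" "n \<in> U \<longleftrightarrow> n \<in> V" using color_bits[OF c'] by simp_all
    have "x \<in> U \<longleftrightarrow> x \<in> V" for x
    proof -
      consider "x < n" | "x = n" | "x = n + 1" | "x \<ge> n + 2" by linarith
      then show ?thesis
      proof cases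
        case 1
        then show ?thesis using low by blast
      next
        case 4
        then show ?thesis using Us assms(2) by fastforce
      qed (use bits in simp_all)
    qed
    then have "U = V" by blast
    then show False using assms \<open>m = n + 2\<close> yvec_diagonal by simp
  qed
qed

text \<open>
  This is where the partition into classes is used. Suppose that \<open>V\<close> and
  \<open>V'\<close> of one class of colour \<open>t\<close> have support nodes \<open>u\<close> and
  \<open>u'\<close> in one class of colour \<open>s\<close>. The paths of \<open>V\<close> and
  \<open>V'\<close> differ at most at early steps of residue \<open>t\<close>, and those of
  \<open>u\<close> and \<open>u'\<close> at steps of residue \<open>s \<noteq> t\<close>. At early
  steps \<open>u\<close> agrees with \<open>V\<close> and \<open>u'\<close> with \<open>V'\<close>,
  so there is no difference at all.
\<close>

lemma yvec_supports_separated: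
  assumes "key (n + 2, V) = key (n + 2, V')" "V \<subseteq> {..<n + 2}" "V' \<subseteq> {..<n + 2}"
    and "key u = key u'" "yvec n V u \<noteq> 0" "yvec n V' u' \<noteq> 0"
  shows "V = V'"
proof -
  obtain m U m' U' where u: "u = (m, U)" "u' = (m', U')" by (metis surj_pair)
  define t where "t = color (n + 2) V"
  define s where "s = color m U"
  have V: "color (n + 2) V' = t" "V - free_bits (n + 2) t = V' - free_bits (n + 2) t"
    using assms(1) unfolding key.simps prod.inject t_def by metis+
  have U: "U - free_bits m s = U' - free_bits m s" and s': "color m' U' = s"
    using assms(4) unfolding u key.simps prod.inject s_def by metis+
  \<comment> \<open>Below step \<open>n\<close> the support nodes have the same paths as \<open>V\<close> and \<open>V'\<close>.\<close>
  have low: "U \<inter> {..<n} = V \<inter> {..<n}" "U' \<inter> {..<n} = V' \<inter> {..<n}" and "s \<noteq> t"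
    using yvec_support[OF assms(5)[unfolded u(1)] assms(2)] yvec_support[OF assms(6)[unfolded u(2)] assms(3)]
    unfolding s_def t_def by simp_all
  have "i \<in> V \<longleftrightarrow> i \<in> V'" for i
  proof (cases "i \<in> free_bits (n + 2) t")
    case True
    then have i: "i < n" "i \<notin> free_bits m s" using \<open>s \<noteq> t\<close> by (auto simp: free_bits_def)
    then have "i \<in> U \<longleftrightarrow> i \<in> U'" using U by blast
    then show ?thesis using low i(1) by blast
  next
    case False
    then show ?thesis using V(2) by blast
  qed
  then show ?thesis by blast
qed

lemma sum_abs_zvec_le:
  assumes "finite P"
  shows "(\<Sum>i\<in>P. \<bar>zvec n S i\<bar>) \<le> 6"
proof -
  have one: "(\<Sum>i\<in>P. of_bool (i = a) :: real) \<le> 1" for a :: node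
    using assms by (simp add: of_bool_def)
  have "(\<Sum>i\<in>P. \<bar>zvec n S i\<bar>) \<le> (\<Sum>i\<in>P. of_bool (i = (n + 1, S)) + of_bool (i = (n + 1, insert n S))
     + of_bool (i = (n + 2, S)) + of_bool (i = (n + 2, insert n S))
     + of_bool (i = (n + 2, insert (n + 1) S)) + of_bool (i = (n + 2, insert (n + 1) (insert n S))))"
    by (intro sum_mono) (auto simp: zvec_def of_bool_def)
  also have "\<dots> \<le> 1 + 1 + 1 + 1 + 1 + 1"
    unfolding sum.distrib by (intro add_mono one)
  finally show ?thesis by simp
qed

lemma sum_abs_yvec_le:
  assumes "finite P"
  shows "(\<Sum>i\<in>P. \<bar>yvec n V i\<bar>) \<le> 12"
proof -
  have "(\<Sum>i\<in>P. \<bar>yvec n V i\<bar>) \<le> (\<Sum>i\<in>P. \<bar>zvec (n + 1) (V \<inter> {..<n + 1}) i\<bar> + \<bar>zvec n (V \<inter> {..<n}) i\<bar>)"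
    by (intro sum_mono) (auto simp: yvec_def bit_sign_def)
  also have "\<dots> \<le> 6 + 6"
    unfolding sum.distrib by (intro add_mono sum_abs_zvec_le assms)
  finally show ?thesis by simp
qed

text \<open>
  The finite subsets of a single class. The norm of a finitely supported vector \<open>x\<close> is
  the supremum over all admissible \<open>P\<close> of the absolute value of the sum of
  \<open>x\<close> over \<open>P\<close>; up to a factor \<open>2\<close> this is the supremum over
  the classes of the \<open>\<ell>\<^sub>1\<close>-norm.
\<close>

definition admissible :: "node set set" where
  "admissible = {P. finite P \<and> P \<subseteq> nodes \<and> (\<exists>k. \<forall>i\<in>P. key i = k)}"

text \<open>
  Only one \<open>V \<in> A\<close> can contribute, since the supports of the others do not meet the
  class of \<open>P\<close>.
\<close>

lemma signed_yvec_sum_bound: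
  assumes P: "P \<in> admissible" and A: "finite A" "\<And>V. V \<in> A \<Longrightarrow> V \<subseteq> {..<n + 2} \<and> key (n + 2, V) = k"
    and \<theta>: "\<And>V. \<bar>\<theta> V\<bar> \<le> (1::real)"
  shows "\<bar>\<Sum>V\<in>A. \<theta> V * (\<Sum>i\<in>P. yvec n V i)\<bar> \<le> 12"
proof (cases "\<exists>V\<in>A. \<exists>i\<in>P. yvec n V i \<noteq> 0")
  case False
  then have "(\<Sum>V\<in>A. \<theta> V * (\<Sum>i\<in>P. yvec n V i)) = 0" by (intro sum.neutral) (simp add: sum.neutral)
  then show ?thesis by simp
next
  case True
  then obtain V i where Vi: "V \<in> A" "i \<in> P" "yvec n V i \<noteq> 0" by blast
  have fin: "finite P" using P by (simp add: admissible_def)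
  have "(\<Sum>i\<in>P. yvec n W i) = 0" if W: "W \<in> A - {V}" for W
  proof (rule sum.neutral, intro ballI)
    fix u assume u: "u \<in> P"
    have "key u = key i" using P u Vi(2) by (auto simp: admissible_def)
    then show "yvec n W u = 0" using yvec_supports_separated[of n W V u i] A(2)[of W] A(2)[of V] Vi W by auto
  qed
  then have "(\<Sum>W\<in>A. \<theta> W * (\<Sum>i\<in>P. yvec n W i)) = \<theta> V * (\<Sum>i\<in>P. yvec n V i)"
    using Vi(1) A(1) by (subst sum.remove[of A V]) (simp_all add: sum.neutral)
  also have "\<bar>\<dots>\<bar> \<le> 1 * (\<Sum>i\<in>P. \<bar>yvec n V i\<bar>)"
    unfolding abs_mult by (intro mult_mono \<theta> sum_abs) auto
  also have "\<dots> \<le> 12" using sum_abs_yvec_le[OF fin] by simp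
  finally show ?thesis .
qed


section \<open>Embedding into the bounded sequences\<close>

lemma countable_admissible: "countable admissible"
proof -
  have "nodes \<subseteq> (\<Union>n. Pair n ` Pow {..<n})" by (auto simp: nodes_def)
  moreover have "countable (\<Union>n. Pair n ` Pow {..<n::nat})"
    by (intro countable_UN countable_image) (auto intro!: countable_finite)
  ultimately have "countable nodes" by (rule countable_subset)
  then have "countable {P. finite P \<and> P \<subseteq> nodes}" by (rule countable_Collect_finite_subset)
  then show ?thesis by (rule countable_subset[rotated]) (auto simp: admissible_def)
qed

lemma coords_admissible: "from_nat_into admissible j \<in> admissible"
  by (rule from_nat_into) (auto simp: admissible_def)

text \<open>
  The image of \<open>zvec n S\<close> under the isometric embedding that lists the sums over all
  admissible sets.
\<close>

definition zelt :: "nat \<Rightarrow> nat set \<Rightarrow> ell_infty" where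
  "zelt n S = Bcontfun (\<lambda>j. \<Sum>i\<in>from_nat_into admissible j. zvec n S i)"

lemma apply_zelt: "apply_bcontfun (zelt n S) j = (\<Sum>i\<in>from_nat_into admissible j. zvec n S i)"
  and norm_zelt_le: "norm (zelt n S) \<le> 6"
proof -
  have b: "norm (\<Sum>i\<in>from_nat_into admissible j. zvec n S i) \<le> 6" for j
  proof -
    have "finite (from_nat_into admissible j)"
      using coords_admissible[of j] unfolding admissible_def by blast
    then show ?thesis
      unfolding real_norm_def by (rule order_trans[OF sum_abs sum_abs_zvec_le])
  qed
  then have "(\<lambda>j. \<Sum>i\<in>from_nat_into admissible j. zvec n S i) \<in> bcontfun"
    by (intro bcontfun_normI) auto
  then show *: "apply_bcontfun (zelt n S) j = (\<Sum>i\<in>from_nat_into admissible j. zvec n S i)" for j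
    unfolding zelt_def by (subst Bcontfun_inverse) (assumption, rule refl)
  show "norm (zelt n S) \<le> 6" by (rule norm_bound) (use b in \<open>simp add: *\<close>)
qed

definition coord_sum :: "node set \<Rightarrow> ell_infty \<Rightarrow> real" where
  "coord_sum P v = apply_bcontfun v (to_nat_on admissible P)"

abbreviation coord :: "node \<Rightarrow> ell_infty \<Rightarrow> real" where
  "coord i \<equiv> coord_sum {i}"

lemma abs_coord_sum_le: "\<bar>coord_sum P v\<bar> \<le> norm v"
  using norm_bounded[of v "to_nat_on admissible P"] by (simp add: coord_sum_def)

lemma bounded_linear_coord_sum: "bounded_linear (coord_sum P)"
proof (rule bounded_linear_intro[where K = 1])
  show "norm (coord_sum P v) \<le> norm v * 1" for v using abs_coord_sum_le by simp
qed (simp_all add: coord_sum_def)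

lemmas coord_sum_simps = linear_add[OF bounded_linear.linear[OF bounded_linear_coord_sum]]
  linear_diff[OF bounded_linear.linear[OF bounded_linear_coord_sum]]
  linear_scale[OF bounded_linear.linear[OF bounded_linear_coord_sum], unfolded real_scaleR_def]
  linear_sum[OF bounded_linear.linear[OF bounded_linear_coord_sum]]

lemma coord_sum_zelt:
  assumes "P \<in> admissible"
  shows "coord_sum P (zelt n S) = (\<Sum>i\<in>P. zvec n S i)"
  unfolding coord_sum_def apply_zelt from_nat_into_to_nat_on[OF countable_admissible assms] ..

lemma node_admissible: "S \<subseteq> {..<n} \<Longrightarrow> {(n, S)} \<in> admissible"
  by (auto simp: admissible_def nodes_def)

lemma coord_zelt: "U \<subseteq> {..<m} \<Longrightarrow> coord (m, U) (zelt n S) = zvec n S (m, U)"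
  by (simp add: coord_sum_zelt node_admissible)

definition yelt :: "nat \<Rightarrow> nat set \<Rightarrow> ell_infty" where
  "yelt n V = bit_sign (n + 1) V *\<^sub>R zelt (n + 1) (V \<inter> {..<n + 1}) - zelt n (V \<inter> {..<n})"

lemma norm_signed_yelt_sum_le:
  assumes A: "finite A" "\<And>V. V \<in> A \<Longrightarrow> V \<subseteq> {..<n + 2} \<and> key (n + 2, V) = k"
    and \<theta>: "\<And>V. \<bar>\<theta> V\<bar> \<le> (1::real)"
  shows "norm (\<Sum>V\<in>A. \<theta> V *\<^sub>R yelt n V) \<le> 12"
proof (rule norm_bound)
  fix j
  let ?P = "from_nat_into admissible j"
  have ap_sum: "apply_bcontfun (\<Sum>V\<in>A. f V) j = (\<Sum>V\<in>A. apply_bcontfun (f V) j)" for f :: "nat set \<Rightarrow> ell_infty"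
    using A(1) by (induction A) auto
  have "apply_bcontfun (yelt n V) j = (\<Sum>i\<in>?P. yvec n V i)" for V
    by (simp add: yelt_def yvec_def apply_zelt sum_subtractf sum_distrib_left)
  then have "apply_bcontfun (\<Sum>V\<in>A. \<theta> V *\<^sub>R yelt n V) j = (\<Sum>V\<in>A. \<theta> V * (\<Sum>i\<in>?P. yvec n V i))"
    by (simp add: ap_sum)
  then show "norm (apply_bcontfun (\<Sum>V\<in>A. \<theta> V *\<^sub>R yelt n V) j) \<le> 12"
    using signed_yvec_sum_bound[OF coords_admissible A \<theta>] by simp
qed

definition zgens :: "nat \<Rightarrow> ell_infty set" where
  "zgens n = (\<Union>m\<le>n. zelt m ` Pow {..<m})"

interpretation zchain: finite_dim_chain zgens
proof
  show "finite (zgens n)" for n by (auto simp: zgens_def)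
  show "zgens n \<subseteq> zgens (Suc n)" for n by (auto simp: zgens_def le_Suc_eq)
qed

abbreviation zspan :: "ell_infty set" where "zspan \<equiv> zchain.chain_union"

lemma zelt_in_zspan: "S \<subseteq> {..<n} \<Longrightarrow> zelt n S \<in> zspan"
  unfolding zchain.chain_union_def zgens_def by (intro UN_I[of n] span_base) auto

lemma yelt_in_zspan: "V \<subseteq> {..<n + 2} \<Longrightarrow> yelt n V \<in> zspan"
  unfolding yelt_def
  by (intro subspace_diff subspace_scale zchain.subspace_chain_union zelt_in_zspan) auto

lemma linear_zero_on_span:
  fixes f :: "'a::real_vector \<Rightarrow> 'b::real_vector"
  assumes "linear f" "\<And>x. x \<in> B \<Longrightarrow> f x = 0" "v \<in> span B"
  shows "f v = 0"
  using linear_eq_0_on_span[OF assms(1) _ assms(3)] assms(2) by blast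

text \<open>
  Identities between continuous functionals that hold on the vectors \<open>zelt n S\<close> extend
  to the completed space, where approximating operators take their values.
\<close>

lemma functional_zero_on_closure:
  fixes f :: "ell_infty \<Rightarrow> real"
  assumes f: "bounded_linear f" "\<And>n S. S \<subseteq> {..<n} \<Longrightarrow> f (zelt n S) = 0" and v: "v \<in> closure zspan"
  shows "f v = 0"
proof -
  have "f w = 0" if w: "w \<in> zspan" for w
  proof -
    obtain n where "w \<in> span (zgens n)" using w by (auto simp: zchain.chain_union_def)
    then show ?thesis
      by (rule linear_zero_on_span[OF bounded_linear.linear[OF f(1)], rotated]) (auto simp: zgens_def f(2))
  qed
  then have "zspan \<subseteq> f -` {0}" by auto
  moreover have "closed (f -` {0})"
    by (intro closed_vimage closed_singleton linear_continuous_on f)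
  ultimately have "closure zspan \<subseteq> f -` {0}" by (rule closure_minimal)
  then show ?thesis using v by auto
qed

lemma coord_sum_eq_sum_coord:
  assumes "v \<in> closure zspan" "P \<in> admissible"
  shows "coord_sum P v = (\<Sum>i\<in>P. coord i v)"
proof -
  have adm: "{i} \<in> admissible" if "i \<in> P" for i using assms(2) that by (auto simp: admissible_def)
  have "coord_sum P v - (\<Sum>i\<in>P. coord i v) = 0"
  proof (rule functional_zero_on_closure[OF _ _ assms(1)])
    show "bounded_linear (\<lambda>v. coord_sum P v - (\<Sum>i\<in>P. coord i v))"
      by (intro bounded_linear_sub bounded_linear_sum bounded_linear_coord_sum)
    show "coord_sum P (zelt n S) - (\<Sum>i\<in>P. coord i (zelt n S)) = 0" if "S \<subseteq> {..<n}" for n S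
      using adm by (simp add: coord_sum_zelt[OF assms(2)] coord_sum_zelt)
  qed
  then show ?thesis by simp
qed

text \<open>
  The coordinate functional of \<open>zelt n S\<close>, read off at the children of the node.
\<close>

definition biorth :: "nat \<Rightarrow> nat set \<Rightarrow> ell_infty \<Rightarrow> real" where
  "biorth n S v = (coord (n + 1, S) v - coord (n + 1, insert n S) v) / 2"

text \<open>
  The same functional, read off at the grandchildren (\<open>biorth_eq_biorth'\<close>).
\<close>

definition biorth' :: "nat \<Rightarrow> nat set \<Rightarrow> ell_infty \<Rightarrow> real" where
  "biorth' n S v = (coord (n + 2, S) v + coord (n + 2, insert n S) v
     + coord (n + 2, insert (n + 1) S) v + coord (n + 2, insert (n + 1) (insert n S)) v) / 4"

lemma bounded_linear_biorth: "bounded_linear (biorth n S)" "bounded_linear (biorth' n S)"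
  unfolding biorth_def biorth'_def
  by (intro bounded_linear_divide[THEN bounded_linear_compose] bounded_linear_sub bounded_linear_add bounded_linear_coord_sum)+

lemma abs_biorth_le: "\<bar>biorth n S v\<bar> \<le> norm v"
  using abs_coord_sum_le[of "{(n + 1, S)}" v] abs_coord_sum_le[of "{(n + 1, insert n S)}" v]
  by (simp add: biorth_def)

text \<open>
  Coefficients of \<open>zvec n S\<close> expressed through the ancestor \<open>V \<inter>
  {..<n}\<close> at level \<open>n\<close> of a node \<open>(m, V)\<close>.
\<close>

lemma zvec_eq:
  assumes "S \<subseteq> {..<n}" "V \<subseteq> {..<m}"
  shows "zvec n S (m, V) =
    (if V \<inter> {..<n} = S then if m = n + 1 then bit_sign n V else if m = n + 2 then 1 else 0 else 0)"
proof (cases "zvec n S (m, V) = 0")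
  case True
  have "m \<noteq> n + 1" "m \<noteq> n + 2" if "V \<inter> {..<n} = S"
    using that True zvec_child[of V n] zvec_grandchild[of V n] assms(2)
    by (auto simp: bit_sign_def split: if_splits)
  then show ?thesis using True by simp
next
  case False
  note * = zvec_support[OF False assms(1)]
  from *(1) show ?thesis
  proof
    assume "m = n + 1"
    then show ?thesis using *(2) zvec_child[of V n] assms(2) by simp
  next
    assume "m = n + 2"
    then show ?thesis using *(2) zvec_grandchild[of V n] assms(2) by simp
  qed
qed

text \<open>
  The vector of level \<open>m\<close> has equal coefficients at the two children of a node of level
  \<open>n = m + 1\<close>, and coefficients of opposite signs at two grandchildren with the same
  parent when \<open>m = n + 1\<close>. So the unwanted contributions cancel in both readings.
\<close>

lemma biorth_zelt:
  assumes S: "S \<subseteq> {..<n}" and U: "U \<subseteq> {..<m}"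
  shows "biorth n S (zelt m U) = of_bool (m = n \<and> U = S)" "biorth' n S (zelt m U) = of_bool (m = n \<and> U = S)"
proof -
  have sub: "S \<subseteq> {..<n + 1}" "insert n S \<subseteq> {..<n + 1}" "S \<subseteq> {..<n + 2}" "insert n S \<subseteq> {..<n + 2}"
     "insert (n + 1) S \<subseteq> {..<n + 2}" "insert (n + 1) (insert n S) \<subseteq> {..<n + 2}"
    using S by auto
  have nS: "n \<notin> S" "n + 1 \<notin> S" using S by auto
  note z = coord_zelt[OF sub(1)] coord_zelt[OF sub(2)] coord_zelt[OF sub(3)] coord_zelt[OF sub(4)]
    coord_zelt[OF sub(5)] coord_zelt[OF sub(6)] zvec_eq[OF U sub(1)] zvec_eq[OF U sub(2)]
    zvec_eq[OF U sub(3)] zvec_eq[OF U sub(4)] zvec_eq[OF U sub(5)] zvec_eq[OF U sub(6)]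
  have cut: "S \<inter> {..<n} = S" "insert n S \<inter> {..<n} = S" "insert (n + 1) S \<inter> {..<n} = S"
    "insert (n + 1) (insert n S) \<inter> {..<n} = S"
    using S by auto
  show "biorth n S (zelt m U) = of_bool (m = n \<and> U = S)"
  proof -
    consider "m = n" | "n = m + 1" | "m \<noteq> n" "n \<noteq> m + 1" by blast
    then show ?thesis
    proof cases
      case 1
      then show ?thesis unfolding biorth_def z using nS by (auto simp: cut bit_sign_def)
    next
      case 2
      have "insert n S \<inter> {..<m} = S \<inter> {..<m}" using 2 by auto
      then show ?thesis unfolding biorth_def z using 2 by simp
    next
      case 3
      then show ?thesis unfolding biorth_def z by simp
    qed
  qed
  show "biorth' n S (zelt m U) = of_bool (m = n \<and> U = S)"
  proof -
    consider "m = n" | "m = n + 1" | "m \<noteq> n" "m \<noteq> n + 1" by blast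
    then show ?thesis
    proof cases
      case 1
      then show ?thesis unfolding biorth'_def z using cut by auto
    next
      case 2
      have "insert (n + 1) S \<inter> {..<m} = S \<inter> {..<m}"
        "insert (n + 1) (insert n S) \<inter> {..<m} = insert n S \<inter> {..<m}" using 2 by auto
      moreover have "bit_sign m S = 1" "bit_sign m (insert n S) = 1" "bit_sign m (insert (n + 1) S) = -1"
        "bit_sign m (insert (n + 1) (insert n S)) = -1"
        using 2 nS by (simp_all add: bit_sign_def)
      ultimately show ?thesis unfolding biorth'_def z using 2 by simp
    next
      case 3
      then show ?thesis unfolding biorth'_def z by simp
    qed
  qed
qed

lemma biorth_eq_biorth':
  assumes "v \<in> closure zspan" "S \<subseteq> {..<n}"
  shows "biorth n S v = biorth' n S v"
proof -
  have "biorth n S v - biorth' n S v = 0"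
    by (rule functional_zero_on_closure[OF _ _ assms(1)])
       (use bounded_linear_biorth assms(2) in \<open>auto intro: bounded_linear_sub simp: biorth_zelt\<close>)
  then show ?thesis by simp
qed

text \<open>
  A finite combination of the vectors \<open>zelt n S\<close> has finite support, and the closure
  adds an arbitrarily small error.
\<close>

lemma coords_vanish_on_closure:
  assumes v: "v \<in> closure zspan" and e: "e > 0"
  shows "\<exists>N. \<forall>n\<ge>N. \<forall>S\<subseteq>{..<n}. \<bar>coord (n, S) v\<bar> < e"
proof -
  obtain w where w: "w \<in> zspan" "dist w v < e" using v e closure_approachable by blast
  obtain k where k: "w \<in> span (zgens k)" using w(1) by (auto simp: zchain.chain_union_def)
  have "\<bar>coord (n, S) v\<bar> < e" if n: "n \<ge> k + 3" and S: "S \<subseteq> {..<n}" for n S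
  proof -
    have "coord (n, S) x = 0" if "x \<in> zgens k" for x
      using that n by (auto simp: zgens_def coord_zelt[OF S] zvec_def)
    then have "coord (n, S) w = 0"
      by (rule linear_zero_on_span[OF bounded_linear.linear[OF bounded_linear_coord_sum] _ k])
    then have "coord (n, S) v = coord (n, S) (v - w)" by (simp add: coord_sum_simps)
    then show ?thesis
      using abs_coord_sum_le[of "{(n, S)}" "v - w"] w(2) by (simp add: dist_norm norm_minus_commute)
  qed
  then show ?thesis by blast
qed


section \<open>Normalized traces\<close>

definition avg_trace :: "nat \<Rightarrow> (ell_infty \<Rightarrow> ell_infty) \<Rightarrow> real" where
  "avg_trace n D = (\<Sum>S\<in>Pow {..<n}. biorth n S (D (zelt n S))) / 2 ^ n"

lemma sum_Pow_lessThan_Suc: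
  "(\<Sum>V\<in>Pow {..<Suc m}. f V) = (\<Sum>S\<in>Pow {..<m}. f S + f (insert m S))"
proof -
  have "Pow {..<Suc m} = Pow {..<m} \<union> insert m ` Pow {..<m}"
    by (simp add: lessThan_Suc Pow_insert)
  moreover have "Pow {..<m} \<inter> insert m ` Pow {..<m} = {}" by auto
  moreover have "inj_on (insert m) (Pow {..<m})"
    by (rule inj_onI) (metis PowD insert_ident lessThan_iff less_irrefl subsetD)
  ultimately show ?thesis
    by (simp add: sum.union_disjoint sum.reindex sum.distrib)
qed

lemma avg_trace_via_children:
  "avg_trace (n + 1) D =
     (\<Sum>V\<in>Pow {..<n + 2}. bit_sign (n + 1) V * coord (n + 2, V) (D (zelt (n + 1) (V \<inter> {..<n + 1})))) / 2 ^ (n + 2)"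
proof -
  let ?f = "\<lambda>V. bit_sign (n + 1) V * coord (n + 2, V) (D (zelt (n + 1) (V \<inter> {..<n + 1})))"
  have "{..<n + 2} = {..<Suc (n + 1)}" by simp
  then have "sum ?f (Pow {..<n + 2}) = (\<Sum>S\<in>Pow {..<n + 1}. ?f S + ?f (insert (n + 1) S))"
    by (simp only: sum_Pow_lessThan_Suc)
  also have "\<dots> = (\<Sum>S\<in>Pow {..<n + 1}. 2 * biorth (n + 1) S (D (zelt (n + 1) S)))"
  proof (rule sum.cong[OF refl])
    fix S assume "S \<in> Pow {..<n + 1}"
    then have cut: "S \<inter> {..<n + 1} = S" "insert (n + 1) S \<inter> {..<n + 1} = S" "n + 1 \<notin> S" by auto
    have "n + 2 = n + 1 + 1" by simp
    then show "?f S + ?f (insert (n + 1) S) = 2 * biorth (n + 1) S (D (zelt (n + 1) S))"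
      unfolding biorth_def bit_sign_def cut by (simp only: cut) simp
  qed
  also have "\<dots> = 2 * (\<Sum>S\<in>Pow {..<n + 1}. biorth (n + 1) S (D (zelt (n + 1) S)))"
    by (rule sum_distrib_left[symmetric])
  finally have "sum ?f (Pow {..<n + 2}) = 2 * (\<Sum>S\<in>Pow {..<n + 1}. biorth (n + 1) S (D (zelt (n + 1) S)))" .
  moreover have "(2::real) ^ (n + 2) = 2 * 2 ^ (n + 1)" by simp
  ultimately show ?thesis
    unfolding avg_trace_def by (simp only: mult_divide_mult_cancel_left_if) simp
qed

lemma avg_trace_via_grandchildren:
  assumes "\<And>S. S \<subseteq> {..<n} \<Longrightarrow> D (zelt n S) \<in> closure zspan"
  shows "avg_trace n D = (\<Sum>V\<in>Pow {..<n + 2}. coord (n + 2, V) (D (zelt n (V \<inter> {..<n})))) / 2 ^ (n + 2)"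
proof -
  let ?f = "\<lambda>V. coord (n + 2, V) (D (zelt n (V \<inter> {..<n})))"
  have "{..<n + 2} = {..<Suc (n + 1)}" "{..<n + 1} = {..<Suc n}" by simp_all
  then have "sum ?f (Pow {..<n + 2})
      = (\<Sum>S\<in>Pow {..<n}. (?f S + ?f (insert (n + 1) S)) + (?f (insert n S) + ?f (insert (n + 1) (insert n S))))"
    by (simp only: sum_Pow_lessThan_Suc)
  also have "\<dots> = (\<Sum>S\<in>Pow {..<n}. 4 * biorth n S (D (zelt n S)))"
  proof (rule sum.cong[OF refl])
    fix S assume S: "S \<in> Pow {..<n}"
    then have cut: "S \<inter> {..<n} = S" "insert n S \<inter> {..<n} = S" "insert (n + 1) S \<inter> {..<n} = S"
      "insert (n + 1) (insert n S) \<inter> {..<n} = S" by auto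
    have b: "biorth n S (D (zelt n S)) = biorth' n S (D (zelt n S))"
      using S assms by (intro biorth_eq_biorth') auto
    show "(?f S + ?f (insert (n + 1) S)) + (?f (insert n S) + ?f (insert (n + 1) (insert n S)))
        = 4 * biorth n S (D (zelt n S))"
      unfolding b biorth'_def cut by simp
  qed
  also have "\<dots> = 4 * (\<Sum>S\<in>Pow {..<n}. biorth n S (D (zelt n S)))"
    by (rule sum_distrib_left[symmetric])
  finally have "sum ?f (Pow {..<n + 2}) = 4 * (\<Sum>S\<in>Pow {..<n}. biorth n S (D (zelt n S)))" .
  moreover have "(2::real) ^ (n + 2) = 4 * 2 ^ n" by simp
  ultimately show ?thesis
    unfolding avg_trace_def by (simp only: mult_divide_mult_cancel_left_if) simp
qed

lemma card_free_bits: "t < 12 \<Longrightarrow> n div 12 \<le> card (free_bits (n + 2) t)"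
proof -
  assume t: "t < 12"
  have "(\<lambda>q. 12 * q + t) ` {..<n div 12} \<subseteq> free_bits (n + 2) t"
    using t by (auto simp: free_bits_def)
  moreover have "finite (free_bits (n + 2) t)" by (rule finite_subset[of _ "{..<n}"]) (auto simp: free_bits_def)
  ultimately have "card ((\<lambda>q. 12 * q + t) ` {..<n div 12}) \<le> card (free_bits (n + 2) t)" by (intro card_mono)
  moreover have "inj_on (\<lambda>q. 12 * q + t) {..<n div 12}" by (auto intro!: inj_onI)
  ultimately show ?thesis by (simp add: card_image)
qed

text \<open>
  Changing a path at the free steps of its colour keeps its key, so each class at level \<open>n +
  2\<close> has at least \<open>2 ^ (n div 12)\<close> elements.
\<close>

lemma card_keys_le:
  "card ((\<lambda>V. key (n + 2, V)) ` Pow {..<n + 2}) * 2 ^ (n div 12) \<le> 2 ^ (n + 2)"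
proof -
  let ?D = "Pow {..<n + 2}" and ?k = "\<lambda>V. key (n + 2, V)"
  have fin: "finite ?D" by simp
  have big: "2 ^ (n div 12) \<le> card {W\<in>?D. ?k W = ?k V}" if V: "V \<in> ?D" for V
  proof -
    define t where "t = color (n + 2) V"
    define F where "F = free_bits (n + 2) t"
    have F: "F \<subseteq> {..<n}" by (auto simp: F_def free_bits_def)
    let ?g = "\<lambda>R. (V - F) \<union> R"
    have "?g ` Pow F \<subseteq> {W\<in>?D. ?k W = ?k V}"
    proof
      fix W assume "W \<in> ?g ` Pow F"
      then obtain R where R: "R \<subseteq> F" "W = (V - F) \<union> R" by blast
      have "n + 1 \<notin> F" "n \<notin> F" using F by auto
      then have "n + 1 \<in> W \<longleftrightarrow> n + 1 \<in> V" "n \<in> W \<longleftrightarrow> n \<in> V" using R by blast+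
      then have c: "color (n + 2) W = t" by (simp add: color_def t_def)
      have "W - F = V - F" using R by blast
      then have "?k W = ?k V" using c by (simp add: F_def t_def)
      moreover have "W \<in> ?D" using R F V by auto
      ultimately show "W \<in> {W\<in>?D. ?k W = ?k V}" by blast
    qed
    then have "card (?g ` Pow F) \<le> card {W\<in>?D. ?k W = ?k V}" using fin by (intro card_mono) auto
    moreover have "inj_on ?g (Pow F)" by (rule inj_onI) blast
    moreover have "finite F" using F finite_subset by blast
    ultimately have "2 ^ card F \<le> card {W\<in>?D. ?k W = ?k V}" by (simp add: card_image card_Pow)
    moreover have "(2::nat) ^ (n div 12) \<le> 2 ^ card F"
      unfolding F_def using card_free_bits[OF color_lt] by (intro power_increasing) (auto simp: t_def)
    ultimately show ?thesis by linarith
  qed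
  have "card (?k ` ?D) * 2 ^ (n div 12) = (\<Sum>\<kappa>\<in>?k ` ?D. 2 ^ (n div 12))" by simp
  also have "\<dots> \<le> (\<Sum>\<kappa>\<in>?k ` ?D. card {W\<in>?D. ?k W = \<kappa>})"
    using big by (intro sum_mono) blast
  also have "\<dots> = card ?D"
    using sum.image_gen[OF fin, of "\<lambda>_. 1::nat" ?k] by simp
  also have "\<dots> = 2 ^ (n + 2)" by (simp add: card_Pow)
  finally show ?thesis .
qed

lemma linear_map_on_sum:
  assumes D: "linear_map_on W D" and W: "subspace W" and A: "finite A" "\<And>a. a \<in> A \<Longrightarrow> f a \<in> W"
  shows "D (\<Sum>a\<in>A. c a *\<^sub>R f a) = (\<Sum>a\<in>A. c a *\<^sub>R D (f a))"
  using A
proof (induction A)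
  case empty
  have "D (0 *\<^sub>R 0) = 0 *\<^sub>R D 0" using D subspace_0[OF W] unfolding linear_map_on_def by blast
  then show ?case by simp
next
  case (insert a A)
  have "c a *\<^sub>R f a \<in> W" "(\<Sum>a\<in>A. c a *\<^sub>R f a) \<in> W" "f a \<in> W"
    using insert.prems W by (auto intro!: subspace_sum subspace_scale)
  then have "D (c a *\<^sub>R f a + (\<Sum>a\<in>A. c a *\<^sub>R f a)) = c a *\<^sub>R D (f a) + D (\<Sum>a\<in>A. c a *\<^sub>R f a)"
    using D unfolding linear_map_on_def by metis
  then show ?case using insert by simp
qed

text \<open>
  For suitable signs the trace over the class is at most \<open>\<Sum>\<^sub>V \<theta>\<^sub>V
  x\<^sub>V\<^sup>*(w)\<close> with \<open>w = D (\<Sum>\<^sub>V \<theta>\<^sub>V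
  y\<^sub>V)\<close>. This is a difference of two sums of coordinates over admissible sets, and
  hence at most twice the norm of \<open>w\<close>.
\<close>

lemma class_trace_le:
  assumes D: "linear_map_on zspan D" "D ` zspan \<subseteq> closure zspan"
    and A: "A \<subseteq> Pow {..<n + 2}" "\<And>V. V \<in> A \<Longrightarrow> key (n + 2, V) = k"
    and M: "\<And>\<theta>. (\<forall>V. \<theta> V = 1 \<or> \<theta> V = (-1::real)) \<Longrightarrow> norm (D (\<Sum>V\<in>A. \<theta> V *\<^sub>R yelt n V)) \<le> M"
  shows "(\<Sum>V\<in>A. coord (n + 2, V) (D (yelt n V))) \<le> 2 * M"
proof -
  have fin: "finite A" using A(1) by (rule finite_subset) simp
  obtain \<theta> where \<theta>: "\<forall>V. \<theta> V = 1 \<or> \<theta> V = (-1::real)"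
      "(\<Sum>V\<in>A. coord (n + 2, V) (D (yelt n V))) \<le> (\<Sum>V\<in>A. \<Sum>V'\<in>A. \<theta> V * \<theta> V' * coord (n + 2, V) (D (yelt n V')))"
    using exists_signs_trace_le[OF fin, of "\<lambda>V V'. coord (n + 2, V) (D (yelt n V'))"] by blast
  define y where "y = (\<Sum>V\<in>A. \<theta> V *\<^sub>R yelt n V)"
  define w where "w = D y"
  have yW: "yelt n V \<in> zspan" if "V \<in> A" for V using that A(1) by (intro yelt_in_zspan) auto
  have "y \<in> zspan" unfolding y_def by (intro subspace_sum subspace_scale zchain.subspace_chain_union yW)
  then have wc: "w \<in> closure zspan" using D(2) by (auto simp: w_def)
  have w: "w = (\<Sum>V\<in>A. \<theta> V *\<^sub>R D (yelt n V))"
    unfolding w_def y_def by (rule linear_map_on_sum[OF D(1) zchain.subspace_chain_union fin yW])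
  have "(\<Sum>V\<in>A. \<Sum>V'\<in>A. \<theta> V * \<theta> V' * coord (n + 2, V) (D (yelt n V'))) = (\<Sum>V\<in>A. \<theta> V * coord (n + 2, V) w)"
    unfolding w by (simp add: coord_sum_simps sum_distrib_left mult.assoc)
  also have "\<dots> = coord_sum (Pair (n + 2) ` {V\<in>A. \<theta> V = 1}) w - coord_sum (Pair (n + 2) ` {V\<in>A. \<theta> V = -1}) w"
  proof -
    have adm: "Pair (n + 2) ` {V\<in>A. \<theta> V = s} \<in> admissible" for s
    proof -
      have "\<forall>i\<in>Pair (n + 2) ` {V\<in>A. \<theta> V = s}. key i = k" using A(2) by auto
      moreover have "finite (Pair (n + 2) ` {V\<in>A. \<theta> V = s})" using fin by simp
      moreover have "Pair (n + 2) ` {V\<in>A. \<theta> V = s} \<subseteq> nodes" using A(1) by (auto simp: nodes_def)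
      ultimately show ?thesis unfolding admissible_def by blast
    qed
    have part: "coord_sum (Pair (n + 2) ` {V\<in>A. \<theta> V = s}) w = (\<Sum>V\<in>{V\<in>A. \<theta> V = s}. coord (n + 2, V) w)" for s
      unfolding coord_sum_eq_sum_coord[OF wc adm] by (subst sum.reindex) (auto intro: inj_onI)
    have "(\<Sum>V\<in>A. \<theta> V * coord (n + 2, V) w)
        = (\<Sum>V\<in>A. (if \<theta> V = 1 then coord (n + 2, V) w else 0) - (if \<theta> V = -1 then coord (n + 2, V) w else 0))"
      using \<theta>(1) by (intro sum.cong) auto
    also have "\<dots> = (\<Sum>V\<in>{V\<in>A. \<theta> V = 1}. coord (n + 2, V) w) - (\<Sum>V\<in>{V\<in>A. \<theta> V = -1}. coord (n + 2, V) w)"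
      by (simp only: sum_subtractf sum.inter_filter[OF fin])
    finally show ?thesis unfolding part .
  qed
  also have "\<dots> \<le> 2 * norm w"
    using abs_coord_sum_le[of "Pair (n + 2) ` {V\<in>A. \<theta> V = 1}" w] abs_coord_sum_le[of "Pair (n + 2) ` {V\<in>A. \<theta> V = -1}" w]
    by linarith
  also have "\<dots> \<le> 2 * M" using M[OF \<theta>(1)] by (simp add: w_def y_def)
  finally show ?thesis using \<theta>(2) by linarith
qed

text \<open>
  Reading \<open>avg_trace (n + 1)\<close> at children and \<open>avg_trace n\<close> at
  grandchildren expresses both as sums over the nodes \<open>V\<close> of level \<open>n +
  2\<close>; the difference involves \<open>D y\<^sub>V\<close>. The sum over a class is at most
  \<open>2 * M\<close>, and there are at most \<open>2 ^ (n + 2) / 2 ^ (n div 12)\<close> classes.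
\<close>

lemma avg_trace_step:
  assumes D: "linear_map_on zspan D" "D ` zspan \<subseteq> closure zspan" and M0: "M \<ge> 0"
    and M: "\<And>A k \<theta>. A \<subseteq> Pow {..<n + 2} \<Longrightarrow> (\<forall>V\<in>A. key (n + 2, V) = k) \<Longrightarrow> (\<forall>V. \<theta> V = 1 \<or> \<theta> V = (-1::real))
        \<Longrightarrow> norm (D (\<Sum>V\<in>A. \<theta> V *\<^sub>R yelt n V)) \<le> M"
  shows "avg_trace (n + 1) D - avg_trace n D \<le> 2 * M * (1 / 2) ^ (n div 12)"
proof -
  let ?D = "Pow {..<n + 2}" and ?k = "\<lambda>V. key (n + 2, V)"
  let ?K = "?k ` ?D"
  have Dy: "D (yelt n V) = bit_sign (n + 1) V *\<^sub>R D (zelt (n + 1) (V \<inter> {..<n + 1})) - D (zelt n (V \<inter> {..<n}))" for V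
  proof -
    have z: "zelt (n + 1) (V \<inter> {..<n + 1}) \<in> zspan" "zelt n (V \<inter> {..<n}) \<in> zspan" by (intro zelt_in_zspan; simp)+
    have lin: "D (x + y) = D x + D y" "D (c *\<^sub>R x) = c *\<^sub>R D x" if "x \<in> zspan" "y \<in> zspan" for x y c
      using D(1) that unfolding linear_map_on_def by blast+
    have "yelt n V = bit_sign (n + 1) V *\<^sub>R zelt (n + 1) (V \<inter> {..<n + 1}) + (-1) *\<^sub>R zelt n (V \<inter> {..<n})"
      by (simp add: yelt_def)
    then show ?thesis
      using z by (simp only: lin subspace_scale[OF zchain.subspace_chain_union]) simp
  qed
  have "avg_trace (n + 1) D - avg_trace n D = (\<Sum>V\<in>?D. coord (n + 2, V) (D (yelt n V))) / 2 ^ (n + 2)"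
    using avg_trace_via_children[of n D] avg_trace_via_grandchildren[of n D] D(2) zelt_in_zspan
    by (simp add: Dy coord_sum_simps sum_subtractf diff_divide_distrib image_subset_iff)
  also have "(\<Sum>V\<in>?D. coord (n + 2, V) (D (yelt n V))) = (\<Sum>\<kappa>\<in>?K. \<Sum>V\<in>{V\<in>?D. ?k V = \<kappa>}. coord (n + 2, V) (D (yelt n V)))"
    by (rule sum.image_gen) simp
  also have "\<dots> \<le> (\<Sum>\<kappa>\<in>?K. 2 * M)"
  proof (rule sum_mono)
    fix \<kappa>
    show "(\<Sum>V\<in>{V\<in>?D. ?k V = \<kappa>}. coord (n + 2, V) (D (yelt n V))) \<le> 2 * M"
    proof (rule class_trace_le[OF D, where k = \<kappa>])
      show "norm (D (\<Sum>V\<in>{V\<in>?D. ?k V = \<kappa>}. \<theta> V *\<^sub>R yelt n V)) \<le> M"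
        if "\<forall>V. \<theta> V = 1 \<or> \<theta> V = (-1::real)" for \<theta>
        using that by (intro M[where k = \<kappa>]) auto
    qed auto
  qed
  also have "\<dots> = real (card ?K) * (2 * M)" by simp
  finally have 1: "avg_trace (n + 1) D - avg_trace n D \<le> real (card ?K) * (2 * M) / 2 ^ (n + 2)"
    by (simp add: divide_right_mono)
  have "real (card ?K * 2 ^ (n div 12)) \<le> real (2 ^ (n + 2))"
    using card_keys_le[of n] by (simp only: of_nat_le_iff)
  then have "real (card ?K) * 2 ^ (n div 12) \<le> 2 ^ (n + 2)"
    by (simp only: of_nat_mult of_nat_power of_nat_numeral)
  then have "real (card ?K) / 2 ^ (n + 2) \<le> (1 / 2) ^ (n div 12)"
    unfolding power_one_over by (subst pos_divide_le_eq, simp, subst mult.commute, subst times_divide_eq_right,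
      subst pos_le_divide_eq, simp, simp only: mult_1_right)
  then have "real (card ?K) / 2 ^ (n + 2) * (2 * M) \<le> (1 / 2) ^ (n div 12) * (2 * M)"
    using M0 by (intro mult_right_mono) auto
  then show ?thesis using 1 by (simp only: times_divide_eq_left times_divide_eq_right mult.commute)
qed

text \<open>
  The vectors \<open>T (zelt n S)\<close> are combinations of the finite set \<open>B\<close> with
  uniformly bounded coefficients, and high coordinates of the elements of \<open>B\<close> are
  small.
\<close>

lemma avg_trace_finite_rank_tendsto_zero:
  assumes B: "finite B" "B \<subseteq> closure zspan" and T: "T ` zspan \<subseteq> span B"
    and lam: "\<And>z. z \<in> zspan \<Longrightarrow> norm (T z) \<le> lam * norm z" "lam \<ge> 0" and e: "e > 0"
  shows "\<exists>N. \<forall>n\<ge>N. \<bar>avg_trace n T\<bar> \<le> e"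
proof -
  obtain M where M: "M \<ge> 0" "\<forall>v\<in>span B. \<exists>c. v = (\<Sum>b\<in>B. c b *\<^sub>R b) \<and> (\<forall>b\<in>B. \<bar>c b\<bar> \<le> M * norm v)"
    using finite_span_bounded_coefficients[OF B(1)] by blast
  define Q where "Q = M * (lam * 6) * card B + 1"
  define d where "d = e / Q"
  have Q: "Q > 0" unfolding Q_def using M(1) lam(2) by (intro add_nonneg_pos mult_nonneg_nonneg) auto
  have d: "d > 0" using e Q by (simp add: d_def)
  have "\<forall>b\<in>B. \<exists>N. \<forall>n\<ge>N. \<forall>S\<subseteq>{..<n}. \<bar>coord (n, S) b\<bar> < d"
    using coords_vanish_on_closure[OF _ d] B(2) by blast
  from bchoice[OF this] obtain N where N: "\<forall>b\<in>B. \<forall>n\<ge>N b. \<forall>S\<subseteq>{..<n}. \<bar>coord (n, S) b\<bar> < d" by blast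
  define N0 where "N0 = Max (insert 0 (N ` B))"
  have N0: "N b \<le> N0" if "b \<in> B" for b using B(1) that by (simp add: N0_def)
  have "\<bar>avg_trace n T\<bar> \<le> e" if n: "n \<ge> N0" for n
  proof -
    have one: "\<bar>biorth n S (T (zelt n S))\<bar> \<le> e" if S: "S \<in> Pow {..<n}" for S
    proof -
      let ?v = "T (zelt n S)"
      have z: "zelt n S \<in> zspan" using S by (intro zelt_in_zspan) auto
      then have "?v \<in> span B" using T by blast
      then obtain c where c: "?v = (\<Sum>b\<in>B. c b *\<^sub>R b)" "\<forall>b\<in>B. \<bar>c b\<bar> \<le> M * norm ?v" using M(2) by blast
      have "norm ?v \<le> lam * norm (zelt n S)" by (rule lam(1)[OF z])
      also have "\<dots> \<le> lam * 6" using norm_zelt_le lam(2) by (rule mult_left_mono)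
      finally have nv: "M * norm ?v \<le> M * (lam * 6)" using M(1) by (rule mult_left_mono)
      have co: "\<bar>coord (n + 1, U) ?v\<bar> \<le> e" if U: "U \<subseteq> {..<n + 1}" for U
      proof -
        have "coord (n + 1, U) ?v = (\<Sum>b\<in>B. c b * coord (n + 1, U) b)"
          unfolding c(1) by (simp add: coord_sum_simps)
        also have "\<bar>\<dots>\<bar> \<le> (\<Sum>b\<in>B. \<bar>c b * coord (n + 1, U) b\<bar>)" by (rule sum_abs)
        also have "\<dots> \<le> (\<Sum>b\<in>B. M * (lam * 6) * d)"
        proof (rule sum_mono)
          fix b assume b: "b \<in> B"
          have "\<bar>coord (n + 1, U) b\<bar> \<le> d" using N b U n N0[OF b] by (simp add: less_imp_le)
          then show "\<bar>c b * coord (n + 1, U) b\<bar> \<le> M * (lam * 6) * d"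
            unfolding abs_mult using c(2) b nv M(1) lam(2) by (intro mult_mono) force+
        qed
        also have "\<dots> = (Q - 1) * d" by (simp add: Q_def)
        also have "\<dots> \<le> Q * d" using d by (intro mult_right_mono) auto
        also have "\<dots> = e" using Q by (simp add: d_def)
        finally show ?thesis .
      qed
      have "S \<subseteq> {..<n + 1}" "insert n S \<subseteq> {..<n + 1}" using S by auto
      from co[OF this(1)] co[OF this(2)] show ?thesis by (simp add: biorth_def)
    qed
    have "\<bar>\<Sum>S\<in>Pow {..<n}. biorth n S (T (zelt n S))\<bar> \<le> (\<Sum>S\<in>Pow {..<n}. \<bar>biorth n S (T (zelt n S))\<bar>)"
      by (rule sum_abs)
    also have "\<dots> \<le> (\<Sum>S\<in>Pow {..<n}. e)" by (intro sum_mono one)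
    also have "\<dots> = 2 ^ n * e" by (simp add: card_Pow)
    finally show ?thesis by (simp add: avg_trace_def divide_simps mult.commute)
  qed
  then show ?thesis by blast
qed

text \<open>
  With \<open>r ^ 12 = 1 / 2\<close> the terms are at most \<open>2 * r ^ n\<close>.
\<close>

lemma summable_half_power_div: "summable (\<lambda>n. (1 / 2 :: real) ^ (n div 12))"
proof -
  define r where "r = root 12 (1 / 2 :: real)"
  have r: "0 < r" "r < 1" "r ^ 12 = 1 / 2" by (simp_all add: r_def real_root_pow_pos)
  have "summable (\<lambda>n. 2 * r ^ n)" using r by (intro summable_mult summable_geometric) auto
  then show ?thesis
  proof (rule summable_comparison_test'[where N = 0])
    fix n :: nat
    have "n \<le> 12 * (n div 12) + 12" by presburger
    then have "r ^ (12 * (n div 12) + 12) \<le> r ^ n" using r by (intro power_decreasing) auto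
    moreover have "r ^ (12 * (n div 12) + 12) = (1 / 2) ^ (n div 12) * (1 / 2)"
      unfolding power_add power_mult r(3) by simp
    ultimately show "norm ((1 / 2 :: real) ^ (n div 12)) \<le> 2 * r ^ n" by simp
  qed
qed

lemma avg_trace_id_minus: "avg_trace n (\<lambda>z. z - T z) = 1 - avg_trace n T"
proof -
  have "biorth n S (zelt n S - T (zelt n S)) = 1 - biorth n S (T (zelt n S))" if "S \<in> Pow {..<n}" for S
    using that biorth_zelt(1)[of S n S n]
    by (simp add: linear_diff[OF bounded_linear.linear[OF bounded_linear_biorth(1)]])
  then have "(\<Sum>S\<in>Pow {..<n}. biorth n S (zelt n S - T (zelt n S)))
      = (\<Sum>S\<in>Pow {..<n}. 1 - biorth n S (T (zelt n S)))" by (intro sum.cong) auto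
  also have "\<dots> = 2 ^ n - (\<Sum>S\<in>Pow {..<n}. biorth n S (T (zelt n S)))" by (simp add: sum_subtractf card_Pow)
  finally show ?thesis by (simp add: avg_trace_def diff_divide_distrib)
qed

text \<open>
  The test set \<open>F\<close> contains the signed sums of the \<open>y\<^sub>V\<close> for the
  levels below \<open>N0\<close>, where \<open>I - T\<close> is at most \<open>\<epsilon>\<close>.
  On the remaining levels only \<open>\<parallel>I - T\<parallel> \<le> 1 + lam\<close> is used, and
  \<open>N0\<close> is chosen such that the sum of these increments is at most \<open>1/4\<close>.
\<close>

lemma zchain_not_BAP: "\<not> pair_BAP zchain.conv_seqs zchain.null_seqs"
proof
  assume "pair_BAP zchain.conv_seqs zchain.null_seqs"
  then obtain lam where lam: "lam \<ge> 1" "pair_lambda_BAP lam zchain.conv_seqs zchain.null_seqs"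
    unfolding pair_BAP_def by blast
  define a :: "nat \<Rightarrow> real" where "a n = (1 / 2) ^ (n div 12)" for n
  have a: "summable a" "\<And>n. a n \<ge> 0" using summable_half_power_div by (auto simp: a_def[abs_def])
  \<comment> \<open>The increments from level \<open>N0\<close> on are at most \<open>2 * (12 * (1 + lam)) * a n\<close>, with sum at most \<open>1/4\<close>.\<close>
  define \<eta> where "\<eta> = 1 / (4 * (24 * (1 + lam)))"
  have \<eta>: "\<eta> > 0" using lam(1) by (simp add: \<eta>_def)
  obtain N0 where N0: "\<And>n. norm (sum a {N0..<n}) < \<eta>"
    using a(1) \<eta> unfolding summable_Cauchy by blast
  \<comment> \<open>This bounds the initial trace plus the increments below level \<open>N0\<close> by \<open>1/4\<close>.\<close>
  define \<epsilon> where "\<epsilon> = 1 / (4 * (1 + 2 * suminf a))"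
  have suma: "suminf a \<ge> 0" using a by (intro suminf_nonneg)
  then have \<epsilon>: "\<epsilon> > 0" by (simp add: \<epsilon>_def)
  define F where "F = insert (zelt 0 {}) (\<Union>n<N0. (\<lambda>(P, N). sum (yelt n) P - sum (yelt n) N) `
      (Pow (Pow {..<n + 2}) \<times> Pow (Pow {..<n + 2})))"
  have F: "finite F" "F \<subseteq> zspan"
  proof -
    show "finite F" by (simp add: F_def)
    have "sum (yelt n) P - sum (yelt n) N \<in> zspan" if "P \<in> Pow (Pow {..<n + 2})" "N \<in> Pow (Pow {..<n + 2})" for n P N
      using that by (intro subspace_diff subspace_sum zchain.subspace_chain_union yelt_in_zspan) auto
    then show "F \<subseteq> zspan" by (auto simp: F_def zelt_in_zspan)
  qed
  obtain T B where T: "linear_map_on zspan T" "finite B" "B \<subseteq> closure zspan"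
    "T ` zspan \<subseteq> span B" "\<And>z. z \<in> zspan \<Longrightarrow> norm (T z) \<le> lam * norm z"
    "\<And>z. z \<in> F \<Longrightarrow> norm (T z - z) \<le> \<epsilon>"
    by (rule zchain.BAP_passes_to_quotient[OF lam(2) F \<epsilon>]) (rule that)
  define D where "D = (\<lambda>z. z - T z)"
  have cl: "subspace (closure zspan)" by (rule subspace_closure[OF zchain.subspace_chain_union])
  have D: "linear_map_on zspan D" "D ` zspan \<subseteq> closure zspan"
  proof -
    show "linear_map_on zspan D" using T(1) by (auto simp: D_def linear_map_on_def algebra_simps)
    have "span B \<subseteq> closure zspan" using T(3) cl by (rule span_minimal)
    then show "D ` zspan \<subseteq> closure zspan"
      using T(4) closure_subset[of zspan] by (auto simp: D_def intro!: subspace_diff[OF cl])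
  qed
  have step: "avg_trace (n + 1) D - avg_trace n D \<le> 2 * (if n < N0 then \<epsilon> else (1 + lam) * 12) * a n" for n
    unfolding a_def
  proof (rule avg_trace_step[OF D])
    show "0 \<le> (if n < N0 then \<epsilon> else (1 + lam) * 12)" using \<epsilon> lam(1) by simp
    fix A k and \<theta> :: "nat set \<Rightarrow> real"
    assume A: "A \<subseteq> Pow {..<n + 2}" "\<forall>V\<in>A. key (n + 2, V) = k" and \<theta>: "\<forall>V. \<theta> V = 1 \<or> \<theta> V = (-1::real)"
    have fin: "finite A" using A(1) by (rule finite_subset) simp
    let ?y = "\<Sum>V\<in>A. \<theta> V *\<^sub>R yelt n V"
    show "norm (D ?y) \<le> (if n < N0 then \<epsilon> else (1 + lam) * 12)"
    proof (cases "n < N0")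
      case True
      have "?y = (\<Sum>V\<in>A. (if \<theta> V = 1 then yelt n V else 0) - (if \<theta> V = -1 then yelt n V else 0))"
        using \<theta> by (intro sum.cong) auto
      also have "\<dots> = sum (yelt n) {V\<in>A. \<theta> V = 1} - sum (yelt n) {V\<in>A. \<theta> V = -1}"
        by (simp only: sum_subtractf sum.inter_filter[OF fin])
      finally have eq: "?y = (\<lambda>(P, N). sum (yelt n) P - sum (yelt n) N) ({V\<in>A. \<theta> V = 1}, {V\<in>A. \<theta> V = -1})"
        by simp
      have "({V\<in>A. \<theta> V = 1}, {V\<in>A. \<theta> V = -1}) \<in> Pow (Pow {..<n + 2}) \<times> Pow (Pow {..<n + 2})"
        using A(1) by blast
      then have "?y \<in> F" unfolding eq F_def using True by (intro insertI2 UN_I[of n] imageI) simp_all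
      then show ?thesis using T(6)[of ?y] True by (simp add: D_def norm_minus_commute)
    next
      case False
      have yW: "?y \<in> zspan"
        using A(1) by (intro subspace_sum subspace_scale zchain.subspace_chain_union yelt_in_zspan) auto
      have "norm ?y \<le> 12"
      proof (rule norm_signed_yelt_sum_le[OF fin, where k = k])
        show "\<bar>\<theta> V\<bar> \<le> 1" for V using \<theta>[rule_format, of V] by auto
      qed (use A in auto)
      then have "norm ?y + lam * norm ?y \<le> (1 + lam) * 12"
        using lam(1) mult_left_mono[of "norm ?y" 12 "1 + lam"] by (simp add: distrib_right)
      then show ?thesis
        using norm_triangle_ineq4[of ?y "T ?y"] T(5)[OF yW] False by (simp add: D_def)
    qed
  qed
  have upper: "avg_trace n D \<le> \<epsilon> + 2 * \<epsilon> * suminf a + 1 / 4" for n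
  proof -
    have "avg_trace n D - avg_trace 0 D = (\<Sum>k<n. avg_trace (Suc k) D - avg_trace k D)"
      by (rule sum_lessThan_telescope[symmetric])
    also have "\<dots> \<le> (\<Sum>k<n. 2 * \<epsilon> * a k + (if k < N0 then 0 else 24 * (1 + lam) * a k))"
    proof (rule sum_mono)
      fix k
      have "2 * (if k < N0 then \<epsilon> else (1 + lam) * 12) * a k \<le> 2 * \<epsilon> * a k + (if k < N0 then 0 else 24 * (1 + lam) * a k)"
        using \<epsilon> a(2)[of k] by simp
      then show "avg_trace (Suc k) D - avg_trace k D \<le> 2 * \<epsilon> * a k + (if k < N0 then 0 else 24 * (1 + lam) * a k)"
        using step[of k] by simp
    qed
    also have "\<dots> = 2 * \<epsilon> * (\<Sum>k<n. a k) + 24 * (1 + lam) * (\<Sum>k\<in>{N0..<n}. a k)"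
    proof -
      have "(\<Sum>k<n. if k < N0 then 0 else 24 * (1 + lam) * a k) = (\<Sum>k\<in>{N0..<n}. 24 * (1 + lam) * a k)"
        by (rule sum.mono_neutral_cong_right) auto
      then show ?thesis by (simp add: sum.distrib sum_distrib_left)
    qed
    also have "\<dots> \<le> 2 * \<epsilon> * suminf a + 24 * (1 + lam) * \<eta>"
    proof (intro add_mono mult_left_mono)
      show "(\<Sum>k<n. a k) \<le> suminf a" using a by (intro sum_le_suminf) auto
      show "(\<Sum>k\<in>{N0..<n}. a k) \<le> \<eta>" using N0[of n] by simp
    qed (use \<epsilon> lam(1) in auto)
    also have "24 * (1 + lam) * \<eta> = 1 / 4" using lam(1) by (simp add: \<eta>_def divide_simps)
    finally have 1: "avg_trace n D - avg_trace 0 D \<le> 2 * \<epsilon> * suminf a + 1 / 4" .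
    have "avg_trace 0 D = biorth 0 {} (D (zelt 0 {}))" by (simp add: avg_trace_def)
    also have "\<dots> \<le> norm (D (zelt 0 {}))" using abs_biorth_le[of 0 "{}" "D (zelt 0 {})"] by linarith
    also have "\<dots> \<le> \<epsilon>" using T(6)[of "zelt 0 {}"] by (simp add: D_def F_def norm_minus_commute)
    finally show ?thesis using 1 by linarith
  qed
  obtain N where "\<forall>n\<ge>N. \<bar>avg_trace n T\<bar> \<le> 1 / 4"
    using avg_trace_finite_rank_tendsto_zero[OF T(2,3,4,5), of "1 / 4"] lam(1) by auto
  then have "\<bar>avg_trace N T\<bar> \<le> 1 / 4" by blast
  moreover have "avg_trace N D = 1 - avg_trace N T" unfolding D_def by (rule avg_trace_id_minus)
  moreover have "\<epsilon> + 2 * \<epsilon> * suminf a = 1 / 4" using suma by (simp add: \<epsilon>_def divide_simps)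
  ultimately show False using upper[of N] by linarith
qed


section \<open>The pair\<close>

theorem proposition6p11:
  shows "\<exists>X Y :: ell_infty set.
           banach_on X \<and> separable_space (top_of_set X) \<and>
           closed_subspace_of X Y \<and>
           pair_Lipschitz_BAP X Y \<and> \<not> pair_BAP X Y \<and> \<not> pair_Lipschitz_lifting X Y"
proof (intro exI conjI)
  show "\<not> pair_Lipschitz_lifting zchain.conv_seqs zchain.null_seqs"
    using BAP_of_lifting_and_Lipschitz_BAP[OF zchain.banach_conv zchain.closed_subspace_null zchain.Lipschitz_BAP]
      zchain_not_BAP by blast
qed (fact zchain.banach_conv zchain.separable_conv zchain.closed_subspace_null zchain.Lipschitz_BAP zchain_not_BAP)+

end
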